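(* Let $\alpha > 0$, $\beta \in \mathbb{R}$ and $k \in [0,1)$. Let $f \in \mathcal{B}(\alpha,\beta)$, and let $g$ and $h$ be functions as in the definition of $\mathcal{B}(\alpha,\beta)$ representing $f$, i.e. $$f(z) = \left[ (\alpha + i\beta) \int_0^z g(\zeta)^{\alpha} h(\zeta) \zeta^{i\beta - 1}\, d\zeta \right]^{1/(\alpha + i\beta)}.$$ Suppose that $$h(z) \in U(k) \quad\text{and}\quad i\beta + \alpha \frac{z g'(z)}{g(z)} \in U(k)$$ for all $z \in \mathbb{D}$. Then $f$ can be extended to a $k$-quasiconformal automorphism of $\mathbb{C}$.
   Context: $\mathbb{D} = \{z \in \mathbb{C} : |z| < 1\}$. $\mathcal{A}$ denotes the class of functions $f$ analytic on $\mathbb{D}$ with $f(0) = 0$ and $f'(0) = 1$. A function $g \in \mathcal{A}$ is called starlike if $\operatorname{Re}\{z g'(z)/g(z)\} > 0$ in $\mathbb{D}$ (such functions are univalent); the quotient $zg'(z)/g(z)$ takes the value $1$ at $z=0$. Definition (Bazilevič functions). Let $\alpha > 0$ and $\beta \in \mathbb{R}$. A function $f \in \mathcal{A}$ is called Bazilevič of type $(\alpha,\beta)$ if $$f(z) = \left[ (\alpha + i\beta) \int_0^z g(\zeta)^{\alpha} h(\zeta) \zeta^{i\beta - 1}\, d\zeta \right]^{1/(\alpha + i\beta)}$$ for a starlike univalent function $g \in \mathcal{A}$ and an analytic function $h$ on $\mathbb{D}$ with $h(0) = 1$ satisfying $\operatorname{Re}(e^{i\lambda} h) > 0$ in $\mathbb{D}$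 for some $\lambda \in \mathbb{R}$. The class of such functions is denoted $\mathcal{B}(\alpha,\beta)$. The powers are understood in the usual way: $f(z) = z\,F(z)^{1/(\alpha+i\beta)}$, where $F(z) = (\alpha+i\beta)\int_0^1 s^{\alpha+i\beta-1} \left(\frac{g(sz)}{sz}\right)^{\alpha} h(sz)\, ds$, and the branches of $(g(\zeta)/\zeta)^{\alpha}$ and $F(z)^{1/(\alpha+i\beta)}$ are the analytic ones taking the value $1$ at the origin. For $0 \leq k < 1$, $$U(k) = \left\{ w \in \mathbb{C} : \left| \frac{w-1}{w+1} \right| \leq k \right\} = \left\{ w \in \mathbb{C} : \left| w - \frac{1+k^2}{1-k^2} \right| \leq \frac{2k}{1-k^2} \right\}.$$ A sense-preserving homeomorphism $F$ of a domain $G \subset \mathbb{C}$ is called $k$-quasiconformal, $k \in [0,1)$, if $F_z$ and $F_{\bar z}$, the partial derivatives in $z$ and $\bar z$ in the distributional sense, are locally integrable on $G$ and satisfy $|F_{\bar z}| \leq k |F_z|$ almost everywhere in $G$. A $k$-quasiconformal automorphism of $\mathbb{C}$ is a $k$-quasiconformal homeomorphism of $\mathbb{C}$ onto itself. *)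

theory Defs
  imports "HOL-Complex_Analysis.Complex_Analysis"
begin

abbreviation unit_disc :: "complex set" where
  "unit_disc \<equiv> ball 0 1"

definition class_A :: "(complex \<Rightarrow> complex) set" where
  "class_A = {f. f holomorphic_on unit_disc \<and> f 0 = 0 \<and> deriv f 0 = 1}"

text \<open>The quotient \<open>z g'(z) / g(z)\<close>, with its removable singularity at the origin filled in.\<close>

definition log_quot :: "(complex \<Rightarrow> complex) \<Rightarrow> complex \<Rightarrow> complex" where
  "log_quot g z = (if z = 0 then 1 else z * deriv g z / g z)"

text \<open>If \<open>g\<close> vanishes at some \<open>z \<noteq> 0\<close>, the quotient below is \<open>0\<close> by the convention
  \<open>x / 0 = 0\<close>, so the strict inequality also forces \<open>g\<close> to be zero-free off the origin.\<close>

definition starlike_fun :: "(complex \<Rightarrow> complex) \<Rightarrow> bool" where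
  "starlike_fun g \<longleftrightarrow> g \<in> class_A \<and> (\<forall>z\<in>unit_disc. Re (log_quot g z) > 0)"

text \<open>\<open>P\<close> is the analytic branch on the unit disc of \<open>p\<^sup>a\<close> with value \<open>1\<close> at the origin,
  where \<open>p(z)\<close> tends to \<open>1\<close> as \<open>z\<close> tends to \<open>0\<close>. Near the origin this branch is the principal
  power, and by the identity theorem this determines \<open>P\<close> on the whole disc. The value of \<open>p\<close>
  at the origin itself is irrelevant.\<close>

definition analytic_power :: "(complex \<Rightarrow> complex) \<Rightarrow> complex \<Rightarrow> (complex \<Rightarrow> complex) \<Rightarrow> bool" where
  "analytic_power p a P \<longleftrightarrow>
     P holomorphic_on unit_disc \<and> P 0 = 1 \<and> (\<forall>\<^sub>F z in at 0. P z = p z powr a)"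

text \<open>Here \<open>P\<close> stands for the branch of \<open>(g(z) / z)\<^sup>\<alpha>\<close>.\<close>

definition bazilevic_integral ::
    "real \<Rightarrow> real \<Rightarrow> (complex \<Rightarrow> complex) \<Rightarrow> (complex \<Rightarrow> complex) \<Rightarrow> complex \<Rightarrow> complex" where
  "bazilevic_integral \<alpha> \<beta> P h z =
     (of_real \<alpha> + \<i> * of_real \<beta>) *
     integral {0..1::real} (\<lambda>s. of_real s powr (of_real \<alpha> + \<i> * of_real \<beta> - 1)
                               * P (of_real s * z) * h (of_real s * z))"

definition bazilevic_rep ::
    "real \<Rightarrow> real \<Rightarrow> (complex \<Rightarrow> complex) \<Rightarrow> (complex \<Rightarrow> complex) \<Rightarrow> (complex \<Rightarrow> complex) \<Rightarrow> bool" where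
  "bazilevic_rep \<alpha> \<beta> g h f \<longleftrightarrow>
     starlike_fun g \<and>
     h holomorphic_on unit_disc \<and> h 0 = 1 \<and>
     (\<exists>t::real. \<forall>z\<in>unit_disc. Re (exp (\<i> * of_real t) * h z) > 0) \<and>
     (\<exists>P Q. analytic_power (\<lambda>z. g z / z) (of_real \<alpha>) P \<and>
            analytic_power (bazilevic_integral \<alpha> \<beta> P h) (1 / (of_real \<alpha> + \<i> * of_real \<beta>)) Q \<and>
            (\<forall>z\<in>unit_disc. f z = z * Q z))"

definition bazilevic :: "real \<Rightarrow> real \<Rightarrow> (complex \<Rightarrow> complex) set" where
  "bazilevic \<alpha> \<beta> = {f \<in> class_A. \<exists>g h. bazilevic_rep \<alpha> \<beta> g h f}"

text \<open>The point \<open>-1\<close> has to be excluded explicitly because of \<open>x / 0 = 0\<close>.\<close>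

definition U :: "real \<Rightarrow> complex set" where
  "U k = {w. w \<noteq> -1 \<and> norm ((w - 1) / (w + 1)) \<le> k}"

definition partial_x :: "(complex \<Rightarrow> complex) \<Rightarrow> complex \<Rightarrow> complex" where
  "partial_x \<phi> z = frechet_derivative \<phi> (at z) 1"

definition partial_y :: "(complex \<Rightarrow> complex) \<Rightarrow> complex \<Rightarrow> complex" where
  "partial_y \<phi> z = frechet_derivative \<phi> (at z) \<i>"

definition wirtinger :: "(complex \<Rightarrow> complex) \<Rightarrow> complex \<Rightarrow> complex" where
  "wirtinger \<phi> z = (partial_x \<phi> z - \<i> * partial_y \<phi> z) / 2"

definition wirtinger_bar :: "(complex \<Rightarrow> complex) \<Rightarrow> complex \<Rightarrow> complex" where
  "wirtinger_bar \<phi> z = (partial_x \<phi> z + \<i> * partial_y \<phi> z) / 2"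

primrec C_k :: "nat \<Rightarrow> (complex \<Rightarrow> complex) \<Rightarrow> bool" where
  "C_k 0 \<phi> \<longleftrightarrow> continuous_on UNIV \<phi>"
| "C_k (Suc n) \<phi> \<longleftrightarrow>
     (\<forall>z. \<phi> differentiable (at z)) \<and> C_k n (partial_x \<phi>) \<and> C_k n (partial_y \<phi>)"

definition test_function :: "complex set \<Rightarrow> (complex \<Rightarrow> complex) \<Rightarrow> bool" where
  "test_function G \<phi> \<longleftrightarrow>
     (\<forall>n. C_k n \<phi>) \<and> compact (closure {z. \<phi> z \<noteq> 0}) \<and> closure {z. \<phi> z \<noteq> 0} \<subseteq> G"

definition locally_integrable :: "complex set \<Rightarrow> (complex \<Rightarrow> complex) \<Rightarrow> bool" where
  "locally_integrable G u \<longleftrightarrow> (\<forall>K. compact K \<and> K \<subseteq> G \<longrightarrow> u absolutely_integrable_on K)"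

definition distr_dz :: "complex set \<Rightarrow> (complex \<Rightarrow> complex) \<Rightarrow> (complex \<Rightarrow> complex) \<Rightarrow> bool" where
  "distr_dz G F u \<longleftrightarrow> locally_integrable G u \<and>
     (\<forall>\<phi>. test_function G \<phi> \<longrightarrow>
        (LINT z:G|lebesgue. u z * \<phi> z) = - (LINT z:G|lebesgue. F z * wirtinger \<phi> z))"

definition distr_dzbar :: "complex set \<Rightarrow> (complex \<Rightarrow> complex) \<Rightarrow> (complex \<Rightarrow> complex) \<Rightarrow> bool" where
  "distr_dzbar G F v \<longleftrightarrow> locally_integrable G v \<and>
     (\<forall>\<phi>. test_function G \<phi> \<longrightarrow>
        (LINT z:G|lebesgue. v z * \<phi> z) = - (LINT z:G|lebesgue. F z * wirtinger_bar \<phi> z))"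

text \<open>A homeomorphism preserves orientation if the image of every positively oriented circle,
  bounding a closed disc in the domain, winds once in the positive sense around the image of
  its centre.\<close>

definition sense_preserving :: "complex set \<Rightarrow> (complex \<Rightarrow> complex) \<Rightarrow> bool" where
  "sense_preserving G F \<longleftrightarrow>
     (\<forall>z r. 0 < r \<and> cball z r \<subseteq> G \<longrightarrow> winding_number (F \<circ> circlepath z r) (F z) = 1)"

definition quasiconformal_on :: "real \<Rightarrow> complex set \<Rightarrow> (complex \<Rightarrow> complex) \<Rightarrow> bool" where
  "quasiconformal_on k G F \<longleftrightarrow>
     0 \<le> k \<and> k < 1 \<and>
     open G \<and> connected G \<and> G \<noteq> {} \<and>
     (\<exists>F'. homeomorphism G (F ` G) F F') \<and>
     sense_preserving G F \<and>
     (\<exists>u v. distr_dz G F u \<and> distr_dzbar G F v \<and>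
            (AE z in lebesgue. z \<in> G \<longrightarrow> norm (v z) \<le> k * norm (u z)))"

definition quasiconformal_automorphism :: "real \<Rightarrow> (complex \<Rightarrow> complex) \<Rightarrow> bool" where
  "quasiconformal_automorphism k F \<longleftrightarrow> quasiconformal_on k UNIV F \<and> range F = UNIV"

end

theory Submission
  imports Defs
begin

text \<open>Put \<open>c = \<alpha> + \<i>\<beta>\<close>, \<open>G = g\<^sup>\<alpha> z\<^sup>\<i>\<^sup>\<beta>\<close> and \<open>\<Phi> = f\<^sup>c\<close>, so that \<open>z G' = q G\<close> and \<open>z \<Phi>' = c h G\<close> with
  \<open>h, q\<close> taking values in the disc \<open>U(k)\<close>. Becker's extension of \<open>f\<close> through the Loewner chain
  \<open>(\<Phi> + c (e\<^sup>t - 1) G)\<^sup>1\<^sup>/\<^sup>c\<close> is \<open>F(\<rho> u) = (\<Phi>(u) + c (\<rho> - 1) G(u))\<^sup>1\<^sup>/\<^sup>c\<close> for \<open>|u| = 1 \<le> \<rho>\<close>. In the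
  coordinate \<open>\<sigma> + \<i>\<theta> = log (\<rho> u)\<close> one has \<open>c d log F = (d\<sigma> + \<i> w d\<theta>) / \<kappa>\<close>, where
  \<open>w = h/\<rho> + (1 - 1/\<rho>) q\<close> lies in \<open>U(k)\<close> by convexity, and \<open>|1 - w| \<le> k |1 + w|\<close> is the dilatation
  bound. The factor \<open>\<kappa>\<close> is bounded away from \<open>0\<close> because \<open>K = \<Phi>/(c G)\<close> solves \<open>z K' + q K = h\<close> and
  hence avoids the negative axis.

  For the dilations \<open>f(rz)/r\<close> with \<open>r < 1\<close> everything is smooth up to the circle, and \<open>log F\<close> is
  locally expanding with a constant independent of \<open>r\<close>; a uniformly locally expanding map of the
  plane is a covering, hence globally expanding, and this survives the limit \<open>r \<rightarrow> 1\<close>. The weak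
  derivatives are also obtained by letting \<open>r \<rightarrow> 1\<close>: along a suitable sequence \<open>h\<close> and \<open>q\<close> have
  radial limits almost everywhere, by Parseval's identity.\<close>

text \<open>The powers that define G and \<Phi> are multivalued. The construction therefore works
  with c log F as a function of \<zeta> = log z: a turn about the origin adds 2 \<pi> \<i> c to it,
  and division by c followed by exp undoes this.

  What shapes the injectivity proof is that the differential jumps across the imaginary axis: on the
  left the coefficient of d\<sigma> is w as well, on the right it is 1. The coefficient w / \<kappa>
  of \<i> d\<theta> is common to both sides. A fixed direction is found against which both
  differentials are positive at all nearby points; cutting a segment where it crosses the axis then
  gives local expansion by the mean value theorem. How near is near depends on the modulus of
  continuity of w / \<kappa>, hence on r, but the constant does not, and the covering argument
  removes the radius.

  The functions log (G / z^c) and K extend continuously to the closed disc, because z times their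
  derivatives is a bounded expression in h, q and K. For h and q themselves only radial limits are
  available, and these enter only in the weak derivatives.\<close>

subsection \<open>The disc U(k) and the avoided slit\<close>

text \<open>This is an Apollonius disc, obtained by squaring the cross-multiplied inequality. The
  disc form supplies convexity and bounds, the quotient form the dilatation estimate.\<close>

lemma U_eq_cball:
  assumes "0 \<le> k" "k < 1"
  shows "U k = cball (complex_of_real ((1 + k\<^sup>2) / (1 - k\<^sup>2))) (2 * k / (1 - k\<^sup>2))"
proof (intro set_eqI)
  fix w :: complex
  define x y where "x = Re w" and "y = Im w"
  have k2: "1 - k\<^sup>2 > 0" using assms by (simp add: power_less_one_iff abs_square_less_1)
  have "w \<in> U k \<longleftrightarrow> w \<noteq> -1 \<and> norm (w - 1) \<le> k * norm (w + 1)"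
  proof (cases "w = -1")
    case False
    hence "w + 1 \<noteq> 0" by (simp add: add_eq_0_iff2)
    thus ?thesis by (auto simp: U_def norm_divide divide_simps)
  qed (simp add: U_def)
  \<comment> \<open>At w = -1 the inequality would read 2 \<le> 0, so the excluded point takes care
    of itself.\<close>
  also have "\<dots> \<longleftrightarrow> norm (w - 1) \<le> k * norm (w + 1)"
    by auto
  also have "\<dots> \<longleftrightarrow> (norm (w - 1))\<^sup>2 \<le> (k * norm (w + 1))\<^sup>2"
    using assms by (metis abs_ge_zero abs_le_square_iff abs_norm_cancel abs_of_nonneg mult_nonneg_nonneg norm_ge_zero)
  also have "\<dots> \<longleftrightarrow> (x - 1)\<^sup>2 + y\<^sup>2 \<le> k\<^sup>2 * ((x + 1)\<^sup>2 + y\<^sup>2)"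
    by (simp add: cmod_power2 power_mult_distrib x_def y_def)
  also have "\<dots> \<longleftrightarrow> (x\<^sup>2 + y\<^sup>2) * (1 - k\<^sup>2) + (1 - k\<^sup>2) \<le> 2 * (1 + k\<^sup>2) * x"
    by (auto simp: power2_eq_square algebra_simps)
  also have "\<dots> \<longleftrightarrow> ((x\<^sup>2 + y\<^sup>2) * (1 - k\<^sup>2) + (1 - k\<^sup>2)) / (1 - k\<^sup>2) \<le> 2 * (1 + k\<^sup>2) * x / (1 - k\<^sup>2)"
    using k2 by (simp add: divide_le_cancel)
  also have "((x\<^sup>2 + y\<^sup>2) * (1 - k\<^sup>2) + (1 - k\<^sup>2)) / (1 - k\<^sup>2) = x\<^sup>2 + y\<^sup>2 + 1"
    using k2 by (simp add: field_simps)
  also have "x\<^sup>2 + y\<^sup>2 + 1 \<le> 2 * (1 + k\<^sup>2) * x / (1 - k\<^sup>2)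
     \<longleftrightarrow> (x - (1 + k\<^sup>2) / (1 - k\<^sup>2))\<^sup>2 + y\<^sup>2 \<le> ((1 + k\<^sup>2) / (1 - k\<^sup>2))\<^sup>2 - 1"
    by (simp add: power2_diff algebra_simps)
  also have "((1 + k\<^sup>2) / (1 - k\<^sup>2))\<^sup>2 - 1 = (2 * k / (1 - k\<^sup>2))\<^sup>2"
    using k2 by (simp add: divide_simps) (simp add: power2_eq_square algebra_simps)
  also have "(x - (1 + k\<^sup>2) / (1 - k\<^sup>2))\<^sup>2 + y\<^sup>2 = (norm (w - complex_of_real ((1 + k\<^sup>2) / (1 - k\<^sup>2))))\<^sup>2"
    by (simp add: cmod_power2 x_def y_def)
  also have "\<dots> \<le> (2 * k / (1 - k\<^sup>2))\<^sup>2 \<longleftrightarrow> norm (w - complex_of_real ((1 + k\<^sup>2) / (1 - k\<^sup>2))) \<le> 2 * k / (1 - k\<^sup>2)"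
    using assms k2 by (simp add: abs_le_square_iff[symmetric])
  finally show "w \<in> U k \<longleftrightarrow> w \<in> cball (complex_of_real ((1 + k\<^sup>2) / (1 - k\<^sup>2))) (2 * k / (1 - k\<^sup>2))"
    by (simp add: dist_norm norm_minus_commute)
qed

text \<open>The real diameter of the disc ends at C - R and C + R, which simplify to reciprocal
  numbers.\<close>

lemma U_bounds:
  assumes "0 \<le> k" "k < 1" "w \<in> U k"
  shows "Re w \<ge> (1 - k) / (1 + k)" "norm w \<le> (1 + k) / (1 - k)"
proof -
  define C R where "C = (1 + k\<^sup>2) / (1 - k\<^sup>2)" and "R = 2 * k / (1 - k\<^sup>2)"
  have k2: "1 - k\<^sup>2 > 0" using assms by (simp add: power_less_one_iff abs_square_less_1)
  have fac: "1 - k\<^sup>2 = (1 - k) * (1 + k)" by (simp add: power2_eq_square algebra_simps)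
  have w: "norm (w - complex_of_real C) \<le> R"
    using assms by (simp add: U_eq_cball C_def R_def dist_norm norm_minus_commute)
  have C: "C \<ge> 0" using k2 by (simp add: C_def)
  have "C - R = (1 - k) / (1 + k)"
    using assms unfolding C_def R_def fac by (simp add: divide_simps) (simp add: power2_eq_square algebra_simps)
  moreover have "C + R = (1 + k) / (1 - k)"
    using assms unfolding C_def R_def fac by (simp add: divide_simps) (simp add: power2_eq_square algebra_simps)
  moreover have "\<bar>Re (w - complex_of_real C)\<bar> \<le> R"
    using w abs_Re_le_cmod order_trans by blast
  moreover have "norm w \<le> norm (w - complex_of_real C) + C"
    using norm_triangle_ineq[of "w - complex_of_real C" "complex_of_real C"] C by simp
  ultimately show "Re w \<ge> (1 - k) / (1 + k)" "norm w \<le> (1 + k) / (1 - k)"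
    using w by auto
qed

lemma U_norm_le:
  assumes "w \<in> U k"
  shows "norm (1 - w) \<le> k * norm (1 + w)"
proof -
  have "w + 1 \<noteq> 0" using assms by (auto simp: U_def add_eq_0_iff2)
  thus ?thesis using assms
    by (simp add: U_def norm_divide divide_simps norm_minus_commute add.commute)
qed

lemma convex_U: "0 \<le> k \<Longrightarrow> k < 1 \<Longrightarrow> convex (U k)"
  by (simp add: U_eq_cball)

lemma Re_inverse_pos:
  assumes "Re y > 0"
  shows "Re (inverse y) > 0"
proof -
  have "(Re y)\<^sup>2 + (Im y)\<^sup>2 > 0" using assms by (intro add_pos_nonneg) auto
  hence "Re y / ((Re y)\<^sup>2 + (Im y)\<^sup>2) > 0" by (rule divide_pos_pos[OF assms])
  thus ?thesis by (simp only: inverse_complex.sel)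
qed

lemma inner_mult_self: "inner (w::complex) (w * v) = (norm w)\<^sup>2 * Re v"
  unfolding power2_norm_eq_inner by (simp add: inner_complex_def algebra_simps)

text \<open>At a point of smallest modulus where \<open>K\<close> meets the slit, following the local inverse of \<open>K\<close>
  along the slit towards \<open>-\<infinity>\<close> would decrease the modulus further.\<close>

lemma slit_avoidance:
  assumes K: "K holomorphic_on ball 0 1" and K0: "K 0 \<notin> \<real>\<^sub>\<le>\<^sub>0"
    and h: "\<And>z. z \<in> ball 0 1 \<Longrightarrow> Re (h z) > 0"
    and q: "\<And>z. z \<in> ball 0 1 \<Longrightarrow> Re (q z) > 0"
    and ode: "\<And>z. z \<in> ball 0 1 \<Longrightarrow> z * deriv K z + q z * K z = h z"
    and z: "z \<in> ball 0 1"
  shows "K z \<notin> \<real>\<^sub>\<le>\<^sub>0"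
proof
  assume Kz: "K z \<in> \<real>\<^sub>\<le>\<^sub>0"
  define S where "S = cball 0 (norm z) \<inter> K -` \<real>\<^sub>\<le>\<^sub>0"
  have sub: "cball 0 (norm z) \<subseteq> ball (0::complex) 1" using z by auto
  have "continuous_on (cball 0 (norm z)) K"
    using K sub by (meson continuous_on_subset holomorphic_on_imp_continuous_on)
  hence "closed S" unfolding S_def
    by (intro continuous_closed_preimage) auto
  hence "compact S" by (metis S_def compact_Int_closed compact_cball inf.absorb2 inf_le1)
  moreover have "S \<noteq> {}" using Kz by (auto simp: S_def)
  ultimately obtain w where w: "w \<in> S" and min: "\<And>y. y \<in> S \<Longrightarrow> norm w \<le> norm y"
    using continuous_attains_inf[of S norm] by (auto intro: continuous_intros)
  have wb: "w \<in> ball 0 1" using w sub by (auto simp: S_def)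
  have "w \<noteq> 0" using w K0 by (auto simp: S_def)
  obtain t where t: "K w = - complex_of_real t" "t \<ge> 0"
    using w by (auto simp: S_def elim!: nonpos_Reals_cases) (metis of_real_minus neg_0_le_iff_le add.inverse_inverse)
  define D where "D = deriv K w"
  \<comment> \<open>With K w = -t and t \<ge> 0 the term -q K becomes q t, which cannot leave the
    right half-plane.\<close>
  have wD: "w * D = h w + q w * complex_of_real t"
    using ode[OF wb] t by (simp add: D_def algebra_simps)
  have RewD: "Re (w * D) > 0"
    unfolding wD using h[OF wb] q[OF wb] t by (simp add: add_pos_nonneg)
  hence "D \<noteq> 0" by auto
  obtain r where r: "r > 0" "ball w r \<subseteq> ball 0 1" "inj_on K (ball w r)"
    using has_complex_derivative_locally_injective[OF K wb open_ball] \<open>D \<noteq> 0\<close> unfolding D_def by blast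
  have Kr: "K holomorphic_on ball w r" using K r(2) holomorphic_on_subset by blast
  obtain g where g: "g holomorphic_on (K ` ball w r)"
      "\<And>z. z \<in> ball w r \<Longrightarrow> deriv K z * deriv g (K z) = 1"
      "\<And>z. z \<in> ball w r \<Longrightarrow> g (K z) = z"
    using holomorphic_has_inverse[OF Kr _ r(3)] by blast
  have op: "open (K ` ball w r)"
    using open_mapping_thm3[OF Kr _ r(3)] by auto
  have Kw: "K w \<in> K ` ball w r" using r by auto
  have "deriv g (K w) = 1 / D"
    using g(2)[of w] r \<open>D \<noteq> 0\<close> by (simp add: D_def eq_divide_eq mult.commute)
  hence dg: "(g has_field_derivative (1 / D)) (at (K w))"
    using holomorphic_derivI[OF g(1) op Kw] by metis
  \<comment> \<open>The squared modulus of the preimage of a point further out on the slit.\<close>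
  define \<phi> where "\<phi> = (\<lambda>e::real. (norm (g (K w - complex_of_real e)))\<^sup>2)"
  have d1: "((\<lambda>e::real. g (K w - complex_of_real e)) has_vector_derivative (- (1 / D))) (at 0)"
  proof -
    have "((\<lambda>e. g (K w - e)) has_field_derivative (1 / D) * (0 - 1)) (at (of_real 0))"
      by (rule DERIV_chain2[where f = g]) (use dg in \<open>auto intro!: derivative_eq_intros\<close>)
    from has_vector_derivative_real_field[OF this] show ?thesis by simp
  qed
  have "(\<phi> has_real_derivative (2 * inner (g (K w)) (- (1 / D)))) (at 0)"
    unfolding \<phi>_def power2_norm_eq_inner has_field_derivative_def
    by (rule derivative_eq_intros d1[unfolded has_vector_derivative_def] refl)+
       (auto simp: inner_commute algebra_simps fun_eq_iff)
  moreover have "inner (g (K w)) (- (1 / D)) < 0"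
  proof -
    \<comment> \<open>The preimage starts off in the direction -1/D, and 1/D is w times a number of
      positive real part; so its modulus decreases.\<close>
    have "1 / D = w * inverse (w * D)" using \<open>w \<noteq> 0\<close> by (simp add: field_simps)
    hence "inner w (1 / D) = (norm w)\<^sup>2 * Re (inverse (w * D))" by (simp only: inner_mult_self)
    moreover have "Re (inverse (w * D)) > 0" by (rule Re_inverse_pos[OF RewD])
    moreover have "(norm w)\<^sup>2 > 0" using \<open>w \<noteq> 0\<close> by simp
    ultimately have "inner w (1 / D) > 0" by (simp only: mult_pos_pos)
    moreover have "g (K w) = w" using g(3) r by simp
    ultimately show ?thesis by (simp only: inner_minus_right neg_less_0_iff_less)
  qed
  ultimately obtain d where d: "d > 0" "\<And>e. 0 < e \<Longrightarrow> e < d \<Longrightarrow> \<phi> e < \<phi> 0"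
    using DERIV_neg_dec_right[of \<phi> "2 * inner (g (K w)) (- (1 / D))" 0] by auto
  obtain \<epsilon> where \<epsilon>: "\<epsilon> > 0" "ball (K w) \<epsilon> \<subseteq> K ` ball w r"
    using op Kw openE by blast
  define e where "e = min d \<epsilon> / 2"
  have e: "0 < e" "e < d" "e < \<epsilon>" using d \<epsilon> by (auto simp: e_def)
  have "K w - complex_of_real e \<in> ball (K w) \<epsilon>" using e by (simp add: dist_norm)
  then obtain y where y: "y \<in> ball w r" "K y = K w - complex_of_real e" using \<epsilon> by (metis (no_types) image_iff subsetD)
  have "\<phi> e < \<phi> 0" using d e by auto
  hence "(norm y)\<^sup>2 < (norm w)\<^sup>2"
    using g(3)[OF y(1)] g(3)[of w] r y(2) by (simp add: \<phi>_def)
  hence lt: "norm y < norm w" by (rule power2_less_imp_less) simp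
  moreover have "y \<in> S"
  proof -
    have "norm w \<le> norm z" using w by (auto simp: S_def)
    moreover have "K y \<in> \<real>\<^sub>\<le>\<^sub>0" using y t e by (simp add: complex_nonpos_Reals_iff)
    ultimately show ?thesis using lt by (simp add: S_def)
  qed
  ultimately show False using min by force
qed

text \<open>Where |K| exceeds B, the equation makes |K| strictly decreasing outwards along the
  radius; hence a maximum over a closed disc about 0 cannot exceed B.\<close>

lemma radial_norm_bound:
  assumes K: "K holomorphic_on ball 0 1" and K0: "norm (K 0) \<le> B"
    and h: "\<And>z. z \<in> ball 0 1 \<Longrightarrow> norm (h z) \<le> B * Re (q z)"
    and q: "\<And>z. z \<in> ball 0 1 \<Longrightarrow> Re (q z) > 0"
    and ode: "\<And>z. z \<in> ball 0 1 \<Longrightarrow> z * deriv K z + q z * K z = h z"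
    and z: "z \<in> ball 0 1"
  shows "norm (K z) \<le> B"
proof (rule ccontr)
  assume "\<not> norm (K z) \<le> B"
  have sub: "cball 0 (norm z) \<subseteq> ball (0::complex) 1" using z by auto
  have "continuous_on (cball 0 (norm z)) (\<lambda>z. norm (K z))"
    using K sub by (intro continuous_on_norm) (meson continuous_on_subset holomorphic_on_imp_continuous_on)
  then obtain w where w: "w \<in> cball 0 (norm z)" and max: "\<And>y. y \<in> cball 0 (norm z) \<Longrightarrow> norm (K y) \<le> norm (K w)"
    using continuous_attains_sup[of "cball 0 (norm z)" "\<lambda>z. norm (K z)"] by auto
  have Kw: "norm (K w) > B" using max[of z] \<open>\<not> norm (K z) \<le> B\<close> by simp
  have wb: "w \<in> ball 0 1" using w sub by auto
  define \<phi> where "\<phi> = (\<lambda>t::real. (norm (K (complex_of_real t * w)))\<^sup>2)"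
  have "(K has_field_derivative deriv K w) (at w)"
    using holomorphic_derivI[OF K _ wb] by auto
  hence "((\<lambda>t. K (t * w)) has_field_derivative deriv K w * w) (at (of_real 1))"
    by (intro DERIV_chain2[where f = K]) (auto intro!: derivative_eq_intros)
  from has_vector_derivative_real_field[OF this]
  have d1: "((\<lambda>t::real. K (of_real t * w)) has_vector_derivative (deriv K w * w)) (at 1)" .
  have "(\<phi> has_real_derivative (2 * inner (K w) (deriv K w * w))) (at 1)"
    unfolding \<phi>_def power2_norm_eq_inner has_field_derivative_def
    by (rule derivative_eq_intros d1[unfolded has_vector_derivative_def] refl)+
       (auto simp: inner_commute algebra_simps fun_eq_iff)
  moreover have "inner (K w) (deriv K w * w) < 0"
  proof -
    have "deriv K w * w = h w - q w * K w" using ode[OF wb] by (simp add: algebra_simps)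
    hence "inner (K w) (deriv K w * w) = inner (K w) (h w) - inner (K w) (q w * K w)"
      by (simp add: inner_diff_right)
    also have "inner (K w) (q w * K w) = Re (q w) * (norm (K w))\<^sup>2"
      by (simp add: inner_complex_def power2_norm_eq_inner algebra_simps)
    also have "inner (K w) (h w) \<le> norm (K w) * norm (h w)" by (rule norm_cauchy_schwarz)
    also have "\<dots> \<le> norm (K w) * (B * Re (q w))" using h[OF wb] by (intro mult_left_mono) auto
    also have "\<dots> < norm (K w) * (norm (K w) * Re (q w))"
    proof -
      have "norm (K w) > 0" using Kw K0 norm_ge_zero[of "K 0"] by linarith
      thus ?thesis using Kw q[OF wb] by (intro mult_strict_left_mono mult_strict_right_mono) auto
    qed
    finally show ?thesis by (simp add: power2_eq_square algebra_simps)
  qed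
  ultimately obtain d where d: "d > 0" "\<And>e. 0 < e \<Longrightarrow> e < d \<Longrightarrow> \<phi> (1 - e) > \<phi> 1"
    using DERIV_neg_dec_left[of \<phi> "2 * inner (K w) (deriv K w * w)" 1] by auto
  define e where "e = min d 1 / 2"
  have e: "0 < e" "e < d" "e < 1" using d by (auto simp: e_def)
  have "norm (K (complex_of_real (1 - e) * w)) > norm (K w)"
    using d(2)[OF e(1,2)] by - (rule power2_less_imp_less, simp_all add: \<phi>_def)
  moreover have "norm (complex_of_real (1 - e) * w) \<le> norm z"
  proof -
    have "norm (complex_of_real (1 - e) * w) = (1 - e) * norm w" using e by (simp add: norm_mult del: of_real_diff)
    also have "\<dots> \<le> 1 * norm w" using e by (intro mult_right_mono) auto
    finally show ?thesis using w by simp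
  qed
  ultimately show False using max[of "complex_of_real (1 - e) * w"] by force
qed

subsection \<open>The differential equation behind a Bazilevic function\<close>

lemma not_nonpos_Reals_if_Re_pos: "Re x > 0 \<Longrightarrow> x \<notin> \<real>\<^sub>\<le>\<^sub>0"
  by (auto simp: complex_nonpos_Reals_iff)

text \<open>Comparing coefficients forces b n = c a n / (n + c). Since |n + c| \<ge> Re c > 0, no
  denominator vanishes and the series still converges in the whole disc.\<close>

lemma regular_solution_exists:
  assumes p: "p holomorphic_on ball 0 1" and c: "Re c > 0"
  obtains I where "I holomorphic_on ball 0 1" "I 0 = p 0"
    "\<And>z. z \<in> ball 0 1 \<Longrightarrow> z * deriv I z + c * I z = c * p z"
proof
  define a where "a = (\<lambda>n. (deriv ^^ n) p 0 / fact n)"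
  define b where "b = (\<lambda>n. c * a n / (of_nat n + c))"
  define I where "I = (\<lambda>z. \<Sum>n. b n * z ^ n)"
  have nz: "of_nat n + c \<noteq> 0" for n
  proof
    assume "of_nat n + c = 0"
    hence "Re (of_nat n + c) = 0" by simp
    thus False using c by simp
  qed
  have sums_p: "(\<lambda>n. a n * z ^ n) sums p z" if "z \<in> ball 0 1" for z
    using holomorphic_power_series[OF p that] by (simp add: a_def)
  have summ_b: "summable (\<lambda>n. b n * z ^ n)" if z: "norm z < 1" for z
  proof -
    obtain \<rho> where \<rho>: "norm z < \<rho>" "\<rho> < 1" using dense[OF z] by blast
    have "\<rho> > 0" using \<rho>(1) norm_ge_zero[of z] by linarith
    have "summable (\<lambda>n. a n * (complex_of_real \<rho>) ^ n)"
      using sums_p[of "complex_of_real \<rho>"] \<rho> \<open>\<rho> > 0\<close> by (auto simp: sums_iff)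
    hence "summable (\<lambda>n. norm (a n * z ^ n))"
      by (rule powser_insidea) (use \<rho> \<open>\<rho> > 0\<close> in auto)
    hence "summable (\<lambda>n. norm c / Re c * norm (a n * z ^ n))" by (rule summable_mult)
    thus ?thesis
    proof (rule summable_comparison_test'[where N = 0])
      fix n :: nat
      have "Re c \<le> norm (of_nat n + c)"
        using complex_Re_le_cmod[of "of_nat n + c"] by simp
      hence "norm c * norm (a n * z ^ n) / norm (of_nat n + c) \<le> norm c * norm (a n * z ^ n) / Re c"
        using c nz[of n] by (intro divide_left_mono mult_nonneg_nonneg mult_pos_pos) auto
      thus "norm (b n * z ^ n) \<le> norm c / Re c * norm (a n * z ^ n)"
        by (simp add: b_def norm_divide norm_mult mult_ac)
    qed
  qed
  have der: "(I has_field_derivative (\<Sum>n. diffs b n * z ^ n)) (at z)" if "z \<in> ball 0 1" for z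
    unfolding I_def by (rule termdiffs_strong'[where K = 1]) (use summ_b that in auto)
  show "I holomorphic_on ball 0 1"
    by (rule holomorphic_onI) (use der in \<open>auto simp: field_differentiable_def intro: has_field_derivative_at_within\<close>)
  show "I 0 = p 0"
  proof -
    have "a 0 = p 0" by (simp add: a_def)
    moreover have "I 0 = b 0" unfolding I_def using suminf_finite[of "{0}" "\<lambda>n. b n * 0 ^ n"] by simp
    moreover have "b 0 = a 0" using nz[of 0] by (simp add: b_def)
    ultimately show ?thesis by simp
  qed
  show "z * deriv I z + c * I z = c * p z" if z: "z \<in> ball 0 1" for z
  proof -
    have "summable (\<lambda>n. diffs b n * z ^ n)"
      by (rule termdiff_converges[where K = 1]) (use z summ_b in auto)
    from diffs_equiv[OF this]
    have "(\<lambda>n. of_nat n * b n * z ^ (n - Suc 0)) sums deriv I z"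
      using DERIV_imp_deriv[OF der[OF z]] by simp
    hence "(\<lambda>n. z * (of_nat n * b n * z ^ (n - Suc 0))) sums (z * deriv I z)"
      by (rule sums_mult)
    moreover have "(\<lambda>n. c * (b n * z ^ n)) sums (c * I z)"
      unfolding I_def by (intro sums_mult summable_sums summ_b) (use z in auto)
    ultimately have "(\<lambda>n. z * (of_nat n * b n * z ^ (n - Suc 0)) + c * (b n * z ^ n)) sums (z * deriv I z + c * I z)"
      by (rule sums_add)
    moreover have "z * (of_nat n * b n * z ^ (n - Suc 0)) + c * (b n * z ^ n) = c * (a n * z ^ n)" for n
    proof -
      have "z * (of_nat n * b n * z ^ (n - Suc 0)) = of_nat n * b n * z ^ n"
        by (cases n) (auto simp: algebra_simps)
      hence "z * (of_nat n * b n * z ^ (n - Suc 0)) + c * (b n * z ^ n) = (of_nat n + c) * b n * z ^ n"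
        by (simp add: algebra_simps)
      also have "(of_nat n + c) * b n = c * a n" using nz[of n] by (simp add: b_def)
      finally show ?thesis by simp
    qed
    ultimately have "(\<lambda>n. c * (a n * z ^ n)) sums (z * deriv I z + c * I z)" by simp
    moreover have "(\<lambda>n. c * (a n * z ^ n)) sums (c * p z)"
      by (intro sums_mult sums_p z)
    ultimately show ?thesis using sums_unique2 by blast
  qed
qed

text \<open>By the equation for I, the integrand multiplied by c is the derivative of s^c I(s z),
  which is continuous with value 0 at s = 0 because Re c > 0.\<close>

lemma bazilevic_integral_eq:
  fixes \<alpha> \<beta> :: real
  defines "c \<equiv> complex_of_real \<alpha> + \<i> * complex_of_real \<beta>"
  assumes \<alpha>: "\<alpha> > 0" and I: "I holomorphic_on ball 0 1"
    and ode: "\<And>z. z \<in> ball 0 1 \<Longrightarrow> z * deriv I z + c * I z = c * (P z * h z)"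
    and z: "z \<in> ball 0 1"
  shows "bazilevic_integral \<alpha> \<beta> P h z = I z"
proof -
  have c: "Re c = \<alpha>" by (simp add: c_def)
  hence "c \<noteq> 0" using \<alpha> by auto
  have sz: "complex_of_real s * z \<in> ball 0 1" if "s \<in> {0..1}" for s
  proof -
    have "norm (complex_of_real s * z) \<le> 1 * norm z"
      using that by (simp add: norm_mult mult_left_le_one_le)
    thus ?thesis using z by simp
  qed
  define G where "G = (\<lambda>s::real. of_real s powr c * I (of_real s * z))"
  define G' where "G' = (\<lambda>s::real. c * (of_real s powr (c - 1) * P (of_real s * z) * h (of_real s * z)))"
  \<comment> \<open>The interior version of the fundamental theorem is chosen because s^c need not
    be differentiable at 0.\<close>
  have "(G' has_integral (G 1 - G 0)) {0..1}"
  proof (rule fundamental_theorem_of_calculus_interior)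
    show "continuous_on {0..1} G" unfolding G_def
    proof (intro continuous_on_mult)
      show "continuous_on {0..1::real} (\<lambda>x. complex_of_real x powr c)"
        by (rule continuous_on_powr_complex) (use c \<alpha> in \<open>auto intro!: continuous_intros\<close>)
      show "continuous_on {0..1::real} (\<lambda>x. I (complex_of_real x * z))"
        by (rule continuous_on_compose2[OF holomorphic_on_imp_continuous_on[OF I]])
           (use sz in \<open>auto intro!: continuous_intros\<close>)
    qed
    fix s :: real assume s: "s \<in> {0<..<1}"
    define x where "x = complex_of_real s"
    have xz: "x * z \<in> ball 0 1" using sz[of s] s by (simp add: x_def)
    have xn: "x \<notin> \<real>\<^sub>\<le>\<^sub>0" "x \<noteq> 0" using s by (auto simp: x_def)
    have dI: "((\<lambda>x. I (x * z)) has_field_derivative (deriv I (x * z) * z)) (at x)"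
      by (rule DERIV_chain2[where f = I])
         (use holomorphic_derivI[OF I _ xz] in \<open>auto intro!: derivative_eq_intros\<close>)
    have "((\<lambda>x. x powr c * I (x * z)) has_field_derivative
            (c * x powr (c - 1) * I (x * z) + deriv I (x * z) * z * x powr c)) (at x)"
      by (rule DERIV_mult[OF has_field_derivative_powr[OF xn(1)] dI])
    also have "c * x powr (c - 1) * I (x * z) + deriv I (x * z) * z * x powr c =
               x powr (c - 1) * (x * z * deriv I (x * z) + c * I (x * z))"
      using xn by (simp add: powr_diff field_simps)
    also have "\<dots> = x powr (c - 1) * (c * (P (x * z) * h (x * z)))" by (simp only: ode[OF xz])
    also have "\<dots> = G' s" by (simp add: G'_def x_def)
    finally show "(G has_vector_derivative G' s) (at s)"
      unfolding x_def G_def by (rule has_vector_derivative_real_field)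
  qed auto
  hence "(G' has_integral I z) {0..1}" using \<open>c \<noteq> 0\<close> by (simp add: G_def)
  from has_integral_mult_right[OF this, of "inverse c"]
  have "((\<lambda>s. of_real s powr (c - 1) * P (of_real s * z) * h (of_real s * z)) has_integral (inverse c * I z)) {0..1}"
    using \<open>c \<noteq> 0\<close> by (simp add: G'_def mult.assoc[symmetric])
  hence "integral {0..1} (\<lambda>s. of_real s powr (c - 1) * P (of_real s * z) * h (of_real s * z)) = inverse c * I z"
    by (rule integral_unique)
  thus ?thesis using \<open>c \<noteq> 0\<close> unfolding bazilevic_integral_def c_def[symmetric] by simp
qed

text \<open>Close to the origin |Im M| < \<pi>, so \<open>Ln\<close> inverts \<open>exp\<close>
  there and the principal power is exp (a M); the identity theorem carries this to the whole
  disc.\<close>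

lemma analytic_power_exp:
  assumes P: "analytic_power p a P"
    and M: "M holomorphic_on ball 0 1" "M 0 = 0"
    and p: "\<And>z. z \<in> ball 0 1 \<Longrightarrow> z \<noteq> 0 \<Longrightarrow> p z = exp (M z)"
    and z: "z \<in> ball 0 1"
  shows "P z = exp (a * M z)"
proof -
  have "isCont M 0"
    using M(1) by (meson centre_in_ball continuous_on_eq_continuous_at holomorphic_on_imp_continuous_on open_ball zero_less_one)
  hence "((\<lambda>z. Im (M z)) \<longlongrightarrow> 0) (at 0)"
    using tendsto_Im[of M "M 0" "at 0"] M(2) by (simp add: isCont_def)
  hence "\<forall>\<^sub>F z in at 0. \<bar>Im (M z)\<bar> < pi"
    by (intro order_tendstoD(2)[of "\<lambda>z. \<bar>Im (M z)\<bar>" 0]) (auto intro: tendsto_rabs_zero)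
  moreover have "\<forall>\<^sub>F z in at 0. P z = p z powr a"
    using P by (simp add: analytic_power_def)
  moreover have "\<forall>\<^sub>F z in at (0::complex). z \<in> ball 0 1"
    by (rule eventually_at_in_open') auto
  moreover have "\<forall>\<^sub>F z in at (0::complex). z \<noteq> 0"
    by (rule eventually_neq_at_within)
  ultimately have "\<forall>\<^sub>F z in at 0. P z = exp (a * M z)"
  proof eventually_elim
    case (elim z)
    have "Ln (exp (M z)) = M z" using elim by (intro Ln_exp) auto
    thus ?case using elim p[of z] by (simp add: powr_def)
  qed
  then obtain d where d: "d > 0" "\<And>z. z \<noteq> 0 \<Longrightarrow> dist z 0 < d \<Longrightarrow> P z = exp (a * M z)"
    by (auto simp: eventually_at)
  have P0: "P 0 = exp (a * M 0)" using P M by (simp add: analytic_power_def)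
  show ?thesis
  proof (rule analytic_continuation_open[of "ball 0 (min d 1)" "ball 0 1" P "\<lambda>z. exp (a * M z)"])
    show "P holomorphic_on ball 0 1" using P by (simp add: analytic_power_def)
    show "(\<lambda>z. exp (a * M z)) holomorphic_on ball 0 1" by (intro holomorphic_intros M)
    show "P z = exp (a * M z)" if "z \<in> ball 0 (min d 1)" for z
      using d(2)[of z] P0 that by (cases "z = 0") auto
  qed (use d z in \<open>auto\<close>)
qed

text \<open>The branches of powers in the definition become exponentials of holomorphic functions.
  Because K avoids the slit, \<open>Ln (K z)\<close> is holomorphic, and exponents that vanish at 0
  single out the prescribed branches.\<close>

lemma bazilevic_data:
  fixes \<alpha> \<beta> :: real
  defines "c \<equiv> complex_of_real \<alpha> + \<i> * complex_of_real \<beta>"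
  assumes \<alpha>: "\<alpha> > 0" and rep: "bazilevic_rep \<alpha> \<beta> g h f"
    and h: "\<And>z. z \<in> ball 0 1 \<Longrightarrow> Re (h z) > 0"
  defines "q \<equiv> (\<lambda>z. \<i> * complex_of_real \<beta> + complex_of_real \<alpha> * log_quot g z)"
  obtains l K where "l holomorphic_on ball 0 1" "l 0 = 0" "K holomorphic_on ball 0 1" "K 0 = 1 / c"
    "\<And>z. z \<in> ball 0 1 \<Longrightarrow> z * deriv l z = q z - c"
    "\<And>z. z \<in> ball 0 1 \<Longrightarrow> z * deriv K z + q z * K z = h z"
    "\<And>z. z \<in> ball 0 1 \<Longrightarrow> f z = z * exp ((l z + Ln c + Ln (K z)) / c)"
    "q holomorphic_on ball 0 1"
proof -
  have Rec: "Re c = \<alpha>" by (simp add: c_def)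
  hence c0: "c \<noteq> 0" using \<alpha> by auto
  have sf: "starlike_fun g" and hh: "h holomorphic_on ball 0 1" and h0: "h 0 = 1"
    using rep by (auto simp: bazilevic_rep_def)
  obtain P Q where P: "analytic_power (\<lambda>z. g z / z) (of_real \<alpha>) P"
    and Q: "analytic_power (bazilevic_integral \<alpha> \<beta> P h) (1 / c) Q"
    and f: "\<And>z. z \<in> ball 0 1 \<Longrightarrow> f z = z * Q z"
    using rep by (auto simp: bazilevic_rep_def c_def)
  have gh: "g holomorphic_on ball 0 1" and ratio_min: "g 0 = 0" and g1: "deriv g 0 = 1"
    and pos: "\<And>z. z \<in> ball 0 1 \<Longrightarrow> Re (log_quot g z) > 0"
    using sf by (auto simp: starlike_fun_def class_A_def)
  have gnz: "g z \<noteq> 0" if "z \<in> ball 0 1" "z \<noteq> 0" for z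
    using pos[OF that(1)] that(2) by (auto simp: log_quot_def)
  \<comment> \<open>g(z) / z with its removable singularity filled in; it has no zeros, hence a
    holomorphic logarithm.\<close>
  define G where "G = (\<lambda>z. if z = 0 then deriv g 0 else (g z - g 0) / (z - 0))"
  have Gh: "G holomorphic_on ball 0 1" unfolding G_def by (rule pole_lemma[OF gh]) simp
  have Gnz: "G z \<noteq> 0" if "z \<in> ball 0 1" for z using gnz[OF that] ratio_min g1 by (auto simp: G_def)
  obtain L0 where L0: "L0 holomorphic_on ball 0 1" "\<And>z. z \<in> ball 0 1 \<Longrightarrow> exp (L0 z) = G z"
    using holomorphic_logarithm_exists[OF convex_ball open_ball Gh Gnz, of 0] by auto
  define L where "L = (\<lambda>z. L0 z - L0 0)"
  have Lh: "L holomorphic_on ball 0 1" unfolding L_def by (intro holomorphic_intros L0)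
  have L_0: "L 0 = 0" by (simp add: L_def)
  have expL: "exp (L z) = G z" if "z \<in> ball 0 1" for z
  proof -
    have "exp (L0 0) = 1" using L0(2)[of 0] g1 by (simp add: G_def)
    thus ?thesis using L0(2)[OF that] by (simp add: L_def exp_diff)
  qed
  have dL: "(L has_field_derivative deriv L z) (at z)" if "z \<in> ball 0 1" for z
    using holomorphic_derivI[OF Lh _ that] by simp
  have geq: "g z = z * exp (L z)" if "z \<in> ball 0 1" for z
    using expL[OF that] ratio_min by (auto simp: G_def)
  have lq: "log_quot g z = 1 + z * deriv L z" if z: "z \<in> ball 0 1" for z
  proof (cases "z = 0")
    case False
    have "((\<lambda>z. z * exp (L z)) has_field_derivative (exp (L z) * (1 + z * deriv L z))) (at z)"
      by (auto intro!: derivative_eq_intros dL[OF z] simp: algebra_simps)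
    hence "(g has_field_derivative (exp (L z) * (1 + z * deriv L z))) (at z)"
      by (rule has_field_derivative_transform_within_open[where S = "ball 0 1"])
         (use z geq in auto)
    hence "deriv g z = exp (L z) * (1 + z * deriv L z)" by (rule DERIV_imp_deriv)
    thus ?thesis using False geq[OF z] by (simp add: log_quot_def)
  qed (simp add: log_quot_def)
  define l where "l = (\<lambda>z. complex_of_real \<alpha> * L z)"
  have lh: "l holomorphic_on ball 0 1" unfolding l_def by (intro holomorphic_intros Lh)
  have l0: "l 0 = 0" by (simp add: l_def L_0)
  have dl: "(l has_field_derivative deriv l z) (at z)" if "z \<in> ball 0 1" for z
    using holomorphic_derivI[OF lh _ that] by simp
  have lq': "z * deriv l z = q z - c" if z: "z \<in> ball 0 1" for z
  proof -
    have "deriv l z = complex_of_real \<alpha> * deriv L z" unfolding l_def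
      by (rule DERIV_imp_deriv) (auto intro!: derivative_eq_intros dL[OF z])
    thus ?thesis by (simp add: q_def c_def lq[OF z] algebra_simps)
  qed
  have Rq: "Re (q z) > 0" if z: "z \<in> ball 0 1" for z
    using pos[OF z] \<alpha> by (simp add: q_def)
  have qh: "q holomorphic_on ball 0 1"
    by (rule holomorphic_transform[of "\<lambda>z. c + z * deriv l z"])
       (auto intro!: holomorphic_intros holomorphic_deriv lh simp: lq')
  have Pexp: "P z = exp (l z)" if z: "z \<in> ball 0 1" for z
    using analytic_power_exp[OF P Lh L_0 _ z] geq by (simp add: l_def)
  have P': "P holomorphic_on ball 0 1" using P by (simp add: analytic_power_def)
  obtain I where I: "I holomorphic_on ball 0 1" "I 0 = P 0 * h 0"
    "\<And>z. z \<in> ball 0 1 \<Longrightarrow> z * deriv I z + c * I z = c * (P z * h z)"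
    by (rule regular_solution_exists[of "\<lambda>z. P z * h z" c, OF holomorphic_on_mult[OF P' hh]])
       (use Rec \<alpha> in auto)
  \<comment> \<open>I is the Bazilevic integral, that is \<Phi> / z^c. Division by c exp l, which is
    c G / z^c, turns its equation into the one for K.\<close>
  define K where "K = (\<lambda>z. I z / (c * exp (l z)))"
  have Kh: "K holomorphic_on ball 0 1"
    unfolding K_def by (intro holomorphic_intros I lh) (use c0 in auto)
  have K0: "K 0 = 1 / c" using I(2) Pexp[of 0] h0 by (simp add: K_def l0)
  have dI: "(I has_field_derivative deriv I z) (at z)" if "z \<in> ball 0 1" for z
    using holomorphic_derivI[OF I(1) _ that] by simp
  have dK: "z * deriv K z + q z * K z = h z" if z: "z \<in> ball 0 1" for z
  proof -
    have "(K has_field_derivative (deriv I z - I z * deriv l z) / (c * exp (l z))) (at z)"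
      unfolding K_def
      by (rule derivative_eq_intros dI[OF z] dl[OF z] refl | use c0 in \<open>simp add: field_simps\<close>)+
    hence "deriv K z = (deriv I z - I z * deriv l z) / (c * exp (l z))" by (rule DERIV_imp_deriv)
    hence "z * deriv K z = (z * deriv I z - I z * (z * deriv l z)) / (c * exp (l z))"
      by (simp add: algebra_simps)
    also have "z * deriv I z = c * (P z * h z) - c * I z" using I(3)[OF z] by (simp add: algebra_simps)
    also have "z * deriv l z = q z - c" by (rule lq'[OF z])
    also have "(c * (P z * h z) - c * I z - I z * (q z - c)) / (c * exp (l z)) = h z - q z * K z"
      using c0 by (simp add: Pexp[OF z] K_def field_simps)
    finally show ?thesis by simp
  qed
  have cinv: "1 / c \<notin> \<real>\<^sub>\<le>\<^sub>0"
  proof -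
    have "Re (inverse c) > 0" using Rec \<alpha> by (intro Re_inverse_pos) simp
    hence "inverse c \<notin> \<real>\<^sub>\<le>\<^sub>0" by (rule not_nonpos_Reals_if_Re_pos)
    thus ?thesis unfolding inverse_eq_divide .
  qed
  have Kns: "K z \<notin> \<real>\<^sub>\<le>\<^sub>0" if "z \<in> ball 0 1" for z
    by (rule slit_avoidance[OF Kh cinv[folded K0] h Rq dK that])
  \<comment> \<open>A logarithm of I = c exp (l) K; it vanishes at the origin because K 0 = 1 /
    c.\<close>
  define M where "M = (\<lambda>z. l z + Ln c + Ln (K z))"
  have Mh: "M holomorphic_on ball 0 1"
    unfolding M_def using Kns by (intro holomorphic_intros lh holomorphic_on_Ln'[OF _ Kh]) auto
  have cns: "c \<notin> \<real>\<^sub>\<le>\<^sub>0" using Rec \<alpha> by (auto simp: complex_nonpos_Reals_iff)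
  have M0: "M 0 = 0" using Ln_inverse[OF cns] by (simp add: M_def l0 K0 inverse_eq_divide)
  have "bazilevic_integral \<alpha> \<beta> P h z = exp (M z)" if z: "z \<in> ball 0 1" for z
  proof -
    have "K z \<noteq> 0" using Kns[OF z] by auto
    hence "exp (M z) = c * exp (l z) * K z" using c0 by (simp add: M_def exp_add)
    also have "\<dots> = I z" using c0 by (simp add: K_def)
    also have "\<dots> = bazilevic_integral \<alpha> \<beta> P h z"
      using bazilevic_integral_eq[OF \<alpha> I(1) _ z, of \<beta> P h] I(3) by (simp add: c_def)
    finally show ?thesis by simp
  qed
  hence "Q z = exp (1 / c * M z)" if z: "z \<in> ball 0 1" for z
    using analytic_power_exp[OF Q Mh M0 _ z] by simp
  hence "f z = z * exp ((l z + Ln c + Ln (K z)) / c)" if z: "z \<in> ball 0 1" for z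
    using f[OF z] z by (simp add: M_def)
  thus ?thesis using that[OF lh l0 Kh K0 lq' dK _ qh] by blast
qed

subsection \<open>Uniformly locally expanding maps\<close>

text \<open>By invariance of domain the image of the ball is open, and expansion keeps the image of
  the bounding sphere outside the target ball B. So the image meets B in a set that is both open and
  closed in B.\<close>

lemma locally_expanding_ball_subset:
  fixes f :: "'a::euclidean_space \<Rightarrow> 'a"
  assumes cont: "continuous_on UNIV f" and c: "c > 0"
    and expd: "\<And>x y. dist x y < d \<Longrightarrow> c * dist x y \<le> dist (f x) (f y)"
    and e: "0 < e" "2 * e \<le> d"
  shows "inj_on f (ball x e)" "ball (f x) (c * e) \<subseteq> f ` ball x e"
proof -
  show inj: "inj_on f (ball x e)"
  proof (rule inj_onI)
    fix y z assume yz: "y \<in> ball x e" "z \<in> ball x e" "f y = f z"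
    have "dist y z \<le> dist x y + dist x z" by (rule dist_triangle3)
    hence "dist y z < d" using yz e by auto
    from expd[OF this] yz c show "y = z" by (simp add: mult_le_0_iff)
  qed
  define B where "B = ball (f x) (c * e)"
  have op: "open (f ` ball x e)"
    by (rule invariance_of_domain) (use inj cont continuous_on_subset in auto)
  have "f y \<notin> B" if "dist x y = e" for y
    using expd[of x y] that e by (simp add: B_def)
  hence eq: "B \<inter> f ` ball x e = B \<inter> f ` cball x e"
    by (force simp: less_le)
  have "compact (f ` cball x e)"
    by (rule compact_continuous_image) (use cont continuous_on_subset in auto)
  hence "closedin (top_of_set B) (B \<inter> f ` ball x e)"
    unfolding eq by (intro closedin_closed_Int compact_imp_closed)
  moreover have "openin (top_of_set B) (B \<inter> f ` ball x e)"
    by (intro openin_open_Int op)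
  moreover have "connected B" by (simp add: B_def)
  moreover have "f x \<in> B \<inter> f ` ball x e" using e c by (simp add: B_def)
  ultimately have "B \<inter> f ` ball x e = B" by (metis connected_clopen empty_iff)
  thus "ball (f x) (c * e) \<subseteq> f ` ball x e" by (auto simp: B_def)
qed

text \<open>A uniformly locally expanding map is a covering, hence injective because the space is
  simply connected; its inverse is then Lipschitz along segments.\<close>

lemma locally_expanding_imp_covering:
  fixes f :: "'a::euclidean_space \<Rightarrow> 'a"
  assumes cont: "continuous_on UNIV f" and c: "c > 0" and d: "d > 0"
    and expd: "\<And>x y. dist x y < d \<Longrightarrow> c * dist x y \<le> dist (f x) (f y)"
  shows "covering_space UNIV f UNIV"
proof
  define e where "e = d / 3"
  have e: "e > 0" "2 * e \<le> d" "2 * (e / 2) \<le> d" "2 * e < d" using d by (auto simp: e_def)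
  note ball = locally_expanding_ball_subset[where d = d, OF cont c expd]
  have near: "\<exists>z. f z = y \<and> dist x z < e / 2" if "dist (f x) y < c * (e / 2)" for x y
    using ball(2)[where e = "e / 2" and x = x] e that by (force simp: subset_iff)
  show "f ` UNIV = UNIV"
  proof -
    have "open (range f)"
      unfolding open_contains_ball
    proof
      fix w assume "w \<in> range f"
      then obtain x where "w = f x" by auto
      hence "ball w (c * e) \<subseteq> range f" using ball(2)[where e = e and x = x] e by auto
      thus "\<exists>r>0. ball w r \<subseteq> range f" using e c by (intro exI[of _ "c * e"]) auto
    qed
    \<comment> \<open>By \<open>near\<close>, a point within c e / 2 of a value is itself a
      value.\<close>
    moreover have "closed (range f)"
      unfolding closed_def open_contains_ball
    proof
      fix y assume y: "y \<in> - range f"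
      have "ball y (c * (e / 2)) \<subseteq> - range f"
      proof
        fix w assume w: "w \<in> ball y (c * (e / 2))"
        show "w \<in> - range f"
        proof
          assume "w \<in> range f"
          then obtain x where "w = f x" by auto
          with w near[of x y] y show False by (auto simp: dist_commute)
        qed
      qed
      thus "\<exists>r>0. ball y r \<subseteq> - range f" using e c by (intro exI[of _ "c * (e / 2)"]) auto
    qed
    ultimately show ?thesis using clopen[of "range f"] by auto
  qed
  fix y :: 'a
  define T where "T = ball y (c * (e / 2))"
  \<comment> \<open>The sheet over T about a point x of the fibre of y. Two sheets that meet have
    centres less than 2 e < d apart, and there expansion forces equality.\<close>
  define V where "V = (\<lambda>x. ball x e \<inter> f -` T)"
  have openV: "open (V x)" for x
    unfolding V_def T_def by (intro open_Int open_ball open_vimage cont)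
  have disj: "x = x'" if "f x = y" "f x' = y" "z \<in> V x" "z \<in> V x'" for x x' z
  proof -
    have "dist x x' \<le> dist x z + dist x' z" by (rule dist_triangle2)
    hence "dist x x' < d" using that e by (auto simp: V_def)
    from expd[OF this] that c show ?thesis by (simp add: mult_le_0_iff)
  qed
  show "\<exists>T. y \<in> T \<and> openin (top_of_set UNIV) T \<and>
          (\<exists>v. \<Union> v = UNIV \<inter> f -` T \<and> (\<forall>u\<in>v. openin (top_of_set UNIV) u) \<and>
               pairwise disjnt v \<and> (\<forall>u\<in>v. \<exists>q. homeomorphism u T f q))"
  proof (intro exI[of _ T] conjI exI[of _ "V ` {x. f x = y}"] ballI)
    show "y \<in> T" using e c by (simp add: T_def)
    show "openin (top_of_set UNIV) T" by (simp add: T_def)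
    show "\<Union> (V ` {x. f x = y}) = UNIV \<inter> f -` T"
    proof (intro set_eqI iffI)
      fix z assume z: "z \<in> UNIV \<inter> f -` T"
      then obtain x where x: "f x = y" "dist z x < e / 2"
        using near[of z y] by (auto simp: T_def dist_commute)
      hence "z \<in> V x" using z e zero_le_dist[of z x] by (auto simp: V_def dist_commute)
      thus "z \<in> \<Union> (V ` {x. f x = y})" using x by auto
    qed (auto simp: V_def)
    show "pairwise disjnt (V ` {x. f x = y})"
      using disj by (fastforce simp: pairwise_def disjnt_iff)
    fix u assume "u \<in> V ` {x. f x = y}"
    then obtain x where x: "f x = y" "u = V x" by auto
    show "openin (top_of_set UNIV) u" using openV x by simp
    have inj: "inj_on f u"
      using ball(1)[where e = e and x = x] e x by (auto simp: V_def inj_on_def)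
    have "f ` u = T"
    proof
      show "T \<subseteq> f ` u"
      proof
        fix t assume t: "t \<in> T"
        have "c * (e / 2) \<le> c * e" using e c by (intro mult_left_mono) auto
        hence "t \<in> ball (f x) (c * e)" using x t by (simp add: T_def)
        then obtain s where "s \<in> ball x e" "t = f s" using ball(2)[where e = e and x = x] e by auto
        thus "t \<in> f ` u" using t x by (auto simp: V_def)
      qed
    qed (auto simp: x V_def)
    moreover have "open u" "continuous_on u f"
      using openV x continuous_on_subset[OF cont subset_UNIV] by auto
    then obtain q where "homeomorphism u (f ` u) f q"
      using invariance_of_domain_homeomorphism[OF _ _ order_refl inj] by blast
    ultimately show "\<exists>q. homeomorphism u T f q" by auto
  qed
qed (rule cont)

text \<open>The radius d only governs how finely the segment is subdivided; c survives unchanged,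
  which is what makes the later bounds uniform in r.\<close>

lemma locally_expanding_imp_expanding:
  fixes f :: "'a::euclidean_space \<Rightarrow> 'a"
  assumes cont: "continuous_on UNIV f" and c: "c > 0" and d: "d > 0"
    and expd: "\<And>x y. dist x y < d \<Longrightarrow> c * dist x y \<le> dist (f x) (f y)"
  shows "c * dist x y \<le> dist (f x) (f y)"
proof -
  have cov: "covering_space UNIV f UNIV"
    by (rule locally_expanding_imp_covering[OF assms])
  \<comment> \<open>Lifting the identity through the covering gives a right inverse of f. It is a
    left inverse too: its composition after f and the identity both lift f and agree at x.\<close>
  have "simply_connected (UNIV :: 'a set)" "locally path_connected (UNIV :: 'a set)"
    by (auto intro: convex_imp_simply_connected convex_imp_locally_path_connected)
  then obtain g where g: "continuous_on UNIV g" "g (f x) = x" "\<And>y. f (g y) = y"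
    using covering_space_lift_strong[OF cov, of x "f x" UNIV id] by auto
  have gf: "g (f z) = z" for z
  proof (rule covering_space_lift_unique[OF cov, of "\<lambda>z. g (f z)" x "\<lambda>z. z" UNIV f])
    show "continuous_on UNIV (\<lambda>z. g (f z))"
      by (rule continuous_on_compose2[OF g(1) cont]) auto
  qed (use g cont in auto)
  define e where "e = d / 3"
  have e: "e > 0" "2 * e \<le> d" "e < d" using d by (auto simp: e_def)
  have small: "c * dist (g p) (g p') \<le> dist p p'" if "dist p p' < c * e" for p p'
  proof -
    have "p' \<in> ball (f (g p)) (c * e)" using that g(3) by simp
    then obtain z where "z \<in> ball (g p) e" "p' = f z"
      using locally_expanding_ball_subset(2)[where d = d, OF cont c expd e(1,2), where x = "g p"] by auto
    hence "dist (g p) (g p') < d" using gf e by auto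
    from expd[OF this] show ?thesis by (simp add: g(3))
  qed
  define D where "D = dist (f x) (f y)"
  \<comment> \<open>So many equal pieces of the segment from f x to f y that each is shorter than c
    e, where \<open>small\<close> applies.\<close>
  obtain n :: nat where n: "real n > D / (c * e)" using reals_Archimedean2 by blast
  have "D / (c * e) \<ge> 0" using c e by (simp add: D_def)
  hence n0: "n > 0" using n by (cases n) auto
  have nD: "D / real n < c * e" using n n0 c e by (simp add: field_simps)
  define p where "p = (\<lambda>i::nat. f x + (real i / real n) *\<^sub>R (f y - f x))"
  have step: "dist (p i) (p (Suc i)) = D / n" for i
  proof -
    have "p (Suc i) - p i = (1 / real n) *\<^sub>R (f y - f x)"
      by (simp add: p_def scaleR_left_diff_distrib[symmetric] diff_divide_distrib[symmetric])
    hence "norm (p (Suc i) - p i) = norm (f y - f x) / n" using n0 by simp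
    thus ?thesis by (simp add: dist_norm norm_minus_commute D_def)
  qed
  have "c * dist (g (p 0)) (g (p i)) \<le> real i * (D / n)" for i
  proof (induction i)
    case (Suc i)
    have "c * dist (g (p 0)) (g (p (Suc i))) \<le> c * (dist (g (p 0)) (g (p i)) + dist (g (p i)) (g (p (Suc i))))"
      using c by (intro mult_left_mono dist_triangle) auto
    also have "\<dots> \<le> real i * (D / n) + D / n"
      using Suc small[of "p i" "p (Suc i)"] step[of i] nD by (simp add: distrib_left)
    finally show ?case by (simp add: algebra_simps add_divide_distrib)
  qed simp
  from this[of n] have "c * dist (g (p 0)) (g (p n)) \<le> D" using n0 by simp
  moreover have "p 0 = f x" "p n = f y" using n0 by (auto simp: p_def)
  ultimately show ?thesis by (simp add: gf D_def)
qed

subsection \<open>The extension in logarithmic coordinates\<close>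

text \<open>Tested against a fixed direction, a curve obeys the real mean value theorem.
  Differentiability is asked only inside the interval, so that a segment may end on the imaginary
  axis, where \<open>log_ext\<close> has a kink.\<close>

lemma derivative_ge_imp_increment_ge:
  fixes X :: "real \<Rightarrow> complex"
  assumes "continuous_on {0..1} X"
    and "\<And>t. 0 < t \<Longrightarrow> t < 1 \<Longrightarrow> (X has_vector_derivative X' t) (at t)"
    and "\<And>t. 0 < t \<Longrightarrow> t < 1 \<Longrightarrow> B \<le> inner n (X' t)"
  shows "B \<le> inner n (X 1 - X 0)"
proof -
  define \<phi> where "\<phi> = (\<lambda>t. inner n (X t))"
  have d: "(\<phi> has_real_derivative inner n (X' t)) (at t)" if "0 < t" "t < 1" for t
    unfolding \<phi>_def has_real_derivative_iff_has_vector_derivative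
    by (rule bounded_linear.has_vector_derivative[OF bounded_linear_inner_right assms(2)[OF that]])
  have "continuous_on {0..1} \<phi>" unfolding \<phi>_def by (intro continuous_intros assms(1))
  then obtain l z where z: "0 < z" "z < 1" "(\<phi> has_real_derivative l) (at z)" "\<phi> 1 - \<phi> 0 = (1 - 0) * l"
    using MVT[of 0 1 \<phi>] d by (metis real_differentiable_def zero_less_one)
  have "l = inner n (X' z)" using DERIV_unique[OF z(3) d[OF z(1,2)]] .
  thus ?thesis using assms(3)[OF z(1,2)] z(4) by (simp add: \<phi>_def inner_diff_right)
qed

text \<open>In the coordinate log z this is the radial retraction of the plane onto the closed unit
  disc.\<close>

definition clip :: "complex \<Rightarrow> complex" where
  "clip \<zeta> = Complex (min (Re \<zeta>) 0) (Im \<zeta>)"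

lemma clip_le [simp]: "Re (clip \<zeta>) \<le> 0" by (simp add: clip_def)

lemma clip_eq: "Re \<zeta> \<le> 0 \<Longrightarrow> clip \<zeta> = \<zeta>" by (simp add: clip_def complex_eq_iff)

lemma clip_eq': "Re \<zeta> \<ge> 0 \<Longrightarrow> clip \<zeta> = \<i> * Im \<zeta>" by (simp add: clip_def complex_eq_iff)

lemma dist_clip_le: "norm (clip a - clip b) \<le> norm (a - b)"
proof -
  have "\<bar>Re (clip a - clip b)\<bar> \<le> \<bar>Re (a - b)\<bar>" by (auto simp: clip_def)
  moreover have "\<bar>Im (clip a - clip b)\<bar> \<le> \<bar>Im (a - b)\<bar>" by (auto simp: clip_def)
  ultimately show ?thesis unfolding cmod_def
    by (intro real_sqrt_le_mono add_mono) (simp_all add: abs_le_square_iff)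
qed

lemma norm_exp_diff_le:
  assumes "Re a \<le> 0" "Re b \<le> 0"
  shows "norm (exp a - exp b) \<le> norm (a - b)"
proof -
  have "norm (exp a - exp b) \<le> 1 * norm (a - b)"
  proof (rule field_differentiable_bound[where S = "{z. Re z \<le> 0}" and f' = exp])
    show "convex {z. Re z \<le> 0}" by (rule convex_halfspace_Re_le)
  qed (use assms in \<open>auto intro: has_field_derivative_at_within\<close>)
  thus ?thesis by simp
qed

text \<open>Here \<open>c = \<alpha> + \<i>\<beta>\<close>, \<open>exp l = (g/z)\<^sup>\<alpha>\<close>, \<open>q = \<i>\<beta> + \<alpha> z g'/g\<close>, and with
  \<open>G = g\<^sup>\<alpha> z\<^sup>\<i>\<^sup>\<beta>\<close> and \<open>\<Phi> = f\<^sup>c\<close> the function \<open>K\<close> is the single-valued quotient \<open>\<Phi> / (c G)\<close>.\<close>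

locale chain_data =
  fixes c :: complex and k :: real and l K h q :: "complex \<Rightarrow> complex"
  assumes Rec: "Re c > 0" and k: "0 \<le> k" "k < 1"
    and l_hol: "l holomorphic_on ball 0 1" and K_hol: "K holomorphic_on ball 0 1"
    and h_hol: "h holomorphic_on ball 0 1" and q_hol: "q holomorphic_on ball 0 1"
    and l0: "l 0 = 0" and K0: "K 0 = 1 / c"
    and l_ode: "\<And>z. z \<in> ball 0 1 \<Longrightarrow> z * deriv l z = q z - c"
    and K_ode: "\<And>z. z \<in> ball 0 1 \<Longrightarrow> z * deriv K z + q z * K z = h z"
    and hU: "\<And>z. z \<in> ball 0 1 \<Longrightarrow> h z \<in> U k"
    and qU: "\<And>z. z \<in> ball 0 1 \<Longrightarrow> q z \<in> U k"
    and l_cont: "continuous_on (cball 0 1) l" and K_cont: "continuous_on (cball 0 1) K"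
begin

section \<open>Bounds for K and for the factor kappa\<close>

definition "m = (1 - k) / (1 + k)"
definition "M = (1 + k) / (1 - k)"

lemma mM: "0 < m" "m \<le> 1" "1 \<le> M" "M = 1 / m"
  using k by (auto simp: m_def M_def field_simps)

lemma U_lower: "w \<in> U k \<Longrightarrow> m \<le> Re w" and U_upper: "w \<in> U k \<Longrightarrow> norm w \<le> M"
  using U_bounds[of k w] k by (auto simp: m_def M_def)

text \<open>At the origin the equation for l reads q 0 = c.\<close>

lemma c_in_U: "c \<in> U k"
  using l_ode[of 0] qU[of 0] by simp

lemma c_nz: "c \<noteq> 0" using Rec by auto

text \<open>The upper bound of |h| over the lower bound of Re q, as \<open>radial_norm_bound\<close>
  asks for.\<close>

definition "K_max = M / m"

lemma K_max: "K_max \<ge> 1"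
proof -
  have "m \<le> M" using mM(2,3) by linarith
  thus ?thesis using mM(1) by (simp add: K_max_def le_divide_eq)
qed

lemma K_bound:
  assumes "z \<in> cball 0 1"
  shows "norm (K z) \<le> K_max"
proof -
  have "norm (K z) \<le> K_max" if z: "z \<in> ball 0 1" for z
  proof (rule radial_norm_bound[OF K_hol _ _ _ K_ode z])
    have "m \<le> norm c" using U_lower[OF c_in_U] complex_Re_le_cmod[of c] by linarith
    hence "norm (K 0) \<le> 1 / m" using mM by (simp add: K0 norm_divide frac_le)
    also have "\<dots> \<le> K_max" using mM(1,3) by (simp add: K_max_def divide_right_mono)
    finally show "norm (K 0) \<le> K_max" .
    fix z :: complex assume z: "z \<in> ball 0 1"
    have "M = K_max * m" using mM(1) by (simp add: K_max_def)
    also have "\<dots> \<le> K_max * Re (q z)" using U_lower[OF qU[OF z]] K_max by (intro mult_left_mono) auto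
    finally have "M \<le> K_max * Re (q z)" .
    thus "norm (h z) \<le> K_max * Re (q z)" using U_upper[OF hU[OF z]] by linarith
    show "Re (q z) > 0" using U_lower[OF qU[OF z]] mM by linarith
  qed
  thus ?thesis
    using continuous_on_closure_norm_le[of "ball 0 1" K K_max z] K_cont assms by auto
qed

text \<open>For |\<mu>| < \<open>gap\<close> the first entry keeps Re (h - \<mu> q) \<ge> m / 2, and
  the second keeps the shifted initial value 1 / c - \<mu> in the right half-plane.\<close>

definition "gap = min (m / (2 * M)) (Re (1 / c) / 2)"

lemma gap_pos: "gap > 0"
proof -
  have "Re (1 / c) > 0" using Re_inverse_pos[OF Rec] by (simp only: inverse_eq_divide)
  thus ?thesis using mM unfolding gap_def by (simp only: min_less_iff_conj) simp
qed

text \<open>Shifting \<open>K\<close> by a small constant \<open>\<mu>\<close> only replaces \<open>h\<close> by \<open>h - \<mu> q\<close> in the differential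
  equation, so the slit is avoided with a definite margin.\<close>

lemma K_slit_dist:
  assumes z: "z \<in> cball 0 1" and t: "t \<ge> 0"
  shows "gap \<le> norm (K z + of_real t)"
proof -
  have *: "gap \<le> norm (K z + of_real t)" if z: "z \<in> ball 0 1" for z
  proof (rule ccontr)
    assume "\<not> ?thesis"
    \<comment> \<open>The shift that puts the value at z exactly on the slit, at -t.\<close>
    define \<mu> where "\<mu> = K z + of_real t"
    have \<mu>: "norm \<mu> < gap" using \<open>\<not> _\<close> by (simp add: \<mu>_def)
    have "(K z - \<mu>) \<notin> \<real>\<^sub>\<le>\<^sub>0"
    proof (rule slit_avoidance[where K = "\<lambda>z. K z - \<mu>" and h = "\<lambda>z. h z - \<mu> * q z" and q = q])
      show "(\<lambda>z. K z - \<mu>) holomorphic_on ball 0 1" by (intro holomorphic_intros K_hol)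
      have "Re \<mu> < Re (1 / c)"
      proof -
        have "Re \<mu> \<le> norm \<mu>" by (rule complex_Re_le_cmod)
        moreover have "gap \<le> Re (1 / c) / 2" by (simp add: gap_def)
        ultimately show ?thesis using \<mu> gap_pos by linarith
      qed
      hence "Re (1 / c - \<mu>) > 0" by simp
      thus "K 0 - \<mu> \<notin> \<real>\<^sub>\<le>\<^sub>0" unfolding K0 by (rule not_nonpos_Reals_if_Re_pos)
      show "z \<in> ball 0 1" by fact
      fix y :: complex assume y: "y \<in> ball 0 1"
      show "Re (q y) > 0" using U_lower[OF qU[OF y]] mM by linarith
      have "norm (\<mu> * q y) \<le> gap * M"
        unfolding norm_mult using \<mu> U_upper[OF qU[OF y]] by (intro mult_mono) (use gap_pos in auto)
      also have "\<dots> \<le> m / (2 * M) * M" using mM by (intro mult_right_mono) (auto simp: gap_def)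
      also have "\<dots> = m / 2" using mM by simp
      finally have "Re (\<mu> * q y) \<le> m / 2" using complex_Re_le_cmod order_trans by blast
      thus "Re (h y - \<mu> * q y) > 0" using U_lower[OF hU[OF y]] mM by simp
      have "deriv (\<lambda>z. K z - \<mu>) y = deriv K y"
        by (rule DERIV_imp_deriv) (use holomorphic_derivI[OF K_hol _ y] in \<open>auto intro!: derivative_eq_intros\<close>)
      thus "y * deriv (\<lambda>z. K z - \<mu>) y + q y * (K y - \<mu>) = h y - \<mu> * q y"
        using K_ode[OF y] by (simp add: algebra_simps)
    qed
    thus False using t by (simp add: \<mu>_def)
  qed
  have "continuous_on (closure (ball 0 1)) (\<lambda>z. norm (K z + of_real t))"
    using K_cont by (auto intro!: continuous_intros)
  from continuous_ge_on_closure[OF this, of z gap] * z show ?thesis by auto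
qed

text \<open>For s = 1 / \<rho> one has \<Phi> + c (\<rho> - 1) G = c \<rho> G kappa, and for s = 1,
  the inside of the disc, kappa is K. This is the origin of the summands of \<open>log_ext\<close>:
  log G contributes c log u + l, the factors c, \<rho> and kappa the rest.\<close>

definition kappa :: "complex \<Rightarrow> real \<Rightarrow> complex" where
  "kappa x s = 1 + (K x - 1) * of_real s"

text \<open>The number w of the overview, with s = 1 / \<rho>; at s = 1 it is h.\<close>

definition angular :: "complex \<Rightarrow> real \<Rightarrow> complex" where
  "angular x s = of_real s * h x + of_real (1 - s) * q x"

text \<open>Put s = 1 / (1 + t) and N = |K + t|. Then |kappa| = s N and 1 + t \<le> 1 +
  \<open>K_max\<close> + N, so |kappa| \<ge> N / (1 + \<open>K_max\<close> + N), which increases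
  with N \<ge> \<open>gap\<close>.\<close>

definition "kappa_min = gap / (1 + K_max + gap)"

lemma kappa_min: "0 < kappa_min" "kappa_min \<le> 1"
  using gap_pos K_max by (auto simp: kappa_min_def)

lemma kappa_eq: "s > 0 \<Longrightarrow> kappa x s = of_real s * (K x + of_real ((1 - s) / s))"
  by (simp add: kappa_def field_simps)

text \<open>For s > 0, kappa is s times K shifted by a nonnegative real number, so it inherits from
  K both the avoidance of the slit and a margin.\<close>

lemma kappa_bounds:
  assumes x: "x \<in> cball 0 1" and s: "0 \<le> s" "s \<le> 1"
  shows "kappa x s \<notin> \<real>\<^sub>\<le>\<^sub>0" "kappa_min \<le> norm (kappa x s)" "norm (kappa x s) \<le> 1 + K_max"
proof -
  show "kappa x s \<notin> \<real>\<^sub>\<le>\<^sub>0"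
  proof (cases "s = 0")
    case False
    hence s0: "s > 0" using s by simp
    show ?thesis
    proof
      assume "kappa x s \<in> \<real>\<^sub>\<le>\<^sub>0"
      then obtain t where t: "kappa x s = of_real t" "t \<le> 0" by (auto elim!: nonpos_Reals_cases)
      define u where "u = (1 - s) / s"
      have "of_real s * (K x + of_real u) = complex_of_real t"
        using t(1) unfolding kappa_eq[OF s0] u_def .
      hence "K x + of_real u = of_real (t / s)"
        using s0 by (simp add: eq_divide_eq mult.commute)
      hence "K x + of_real ((1 - s) / s + - (t / s)) = 0"
        unfolding u_def[symmetric] by (simp add: algebra_simps)
      moreover have "(1 - s) / s \<ge> 0" "- (t / s) \<ge> 0"
        using s s0 t by (auto simp: divide_nonpos_pos)
      hence "(1 - s) / s + - (t / s) \<ge> 0" by linarith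
      ultimately show False using K_slit_dist[OF x, of "(1 - s) / s + - (t / s)"] gap_pos by simp
    qed
  qed (simp add: kappa_def)
  show "kappa_min \<le> norm (kappa x s)"
  proof (cases "s = 0")
    case False
    hence s0: "s > 0" using s by simp
    define t where "t = (1 - s) / s"
    have t: "t \<ge> 0" "1 / s = 1 + t" using s s0 by (auto simp: t_def field_simps)
    define N where "N = norm (K x + of_real t)"
    have N: "N \<ge> gap" using K_slit_dist[OF x t(1)] by (simp add: N_def)
    have "t \<le> N + norm (K x)"
      using norm_triangle_ineq4[of "K x + of_real t" "K x"] t(1) by (simp add: N_def)
    hence "1 / s \<le> 1 + K_max + N" using t K_bound[OF x] by linarith
    hence "1 / (1 + K_max + N) \<le> s" using s0 K_max N gap_pos by (simp add: field_simps)
    hence "N * (1 / (1 + K_max + N)) \<le> N * s" using N gap_pos by (intro mult_left_mono) auto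
    moreover have "kappa_min \<le> N / (1 + K_max + N)"
    proof -
      have *: "gap * (1 + K_max) \<le> N * (1 + K_max)" using N K_max by (intro mult_right_mono) auto
      show ?thesis using N gap_pos K_max
        by (simp add: kappa_min_def divide_simps) (use * in \<open>simp add: algebra_simps\<close>)
    qed
    moreover have "norm (kappa x s) = N * s" using s0 by (simp add: kappa_eq N_def t_def norm_mult del: of_real_divide of_real_diff)
    ultimately show ?thesis by simp
  qed (use kappa_min in \<open>simp add: kappa_def\<close>)
  have "kappa x s = of_real (1 - s) + of_real s * K x" by (simp add: kappa_def algebra_simps)
  also have "norm \<dots> \<le> norm (complex_of_real (1 - s)) + norm (of_real s * K x)" by (rule norm_triangle_ineq)
  also have "norm (complex_of_real (1 - s)) = 1 - s" using s by (simp del: of_real_diff)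
  also have "norm (of_real s * K x) = s * norm (K x)" using s by (simp add: norm_mult)
  also have "s * norm (K x) \<le> 1 * K_max" using s K_bound[OF x] K_max by (intro mult_mono) auto
  finally show "norm (kappa x s) \<le> 1 + K_max" using s by simp
qed

lemma angular_U:
  assumes "x \<in> ball 0 1" "0 \<le> s" "s \<le> 1"
  shows "angular x s \<in> U k"
  using convexD_alt[OF convex_U[OF k] qU[OF assms(1)] hU[OF assms(1)] assms(2,3)]
  by (simp add: angular_def scaleR_conv_of_real add.commute)

definition log_pt :: "real \<Rightarrow> complex \<Rightarrow> complex" where "log_pt r \<zeta> = of_real r * exp (clip \<zeta>)"
definition log_scale :: "complex \<Rightarrow> real" where "log_scale \<zeta> = exp (- max (Re \<zeta>) 0)"

lemma log_scale: "0 < log_scale \<zeta>" "0 \<le> log_scale \<zeta>" "log_scale \<zeta> \<le> 1" by (auto simp: log_scale_def)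

lemma norm_log_pt_le: "0 \<le> r \<Longrightarrow> norm (log_pt r \<zeta>) \<le> r"
  by (simp add: log_pt_def norm_mult mult_left_le)

lemma log_pt_cball: "0 \<le> r \<Longrightarrow> r \<le> 1 \<Longrightarrow> log_pt r \<zeta> \<in> cball 0 1"
  using norm_log_pt_le[of r \<zeta>] by simp

lemma log_pt_ball: "0 \<le> r \<Longrightarrow> r < 1 \<Longrightarrow> log_pt r \<zeta> \<in> ball 0 1"
  using norm_log_pt_le[of r \<zeta>] by simp

text \<open>The logarithm of \<open>\<Phi>(u) + c (\<rho> - 1) G(u)\<close>, where \<open>u = r e\<^sup>\<zeta>\<close> for \<open>Re \<zeta> \<le> 0\<close> (and then \<open>\<rho> = 1\<close>), while
  \<open>u = r e\<^sup>\<i>\<^sup>\<theta>\<close> and \<open>\<rho> = e\<^sup>\<sigma>\<close> for \<open>\<zeta> = \<sigma> + \<i>\<theta>\<close> with \<open>\<sigma> > 0\<close>; up to normalisation it belongs to \<open>f(rz)/r\<close>.\<close>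

definition log_ext :: "real \<Rightarrow> complex \<Rightarrow> complex" where
  "log_ext r \<zeta> = c * clip \<zeta> + l (log_pt r \<zeta>) + Ln c + Ln (kappa (log_pt r \<zeta>) (log_scale \<zeta>)) + of_real (max (Re \<zeta>) 0)"

lemma continuous_log_ext: "0 \<le> r \<Longrightarrow> r \<le> 1 \<Longrightarrow> continuous_on UNIV (log_ext r)"
proof -
  assume r: "0 \<le> r" "r \<le> 1"
  have cl: "continuous_on UNIV clip"
    unfolding clip_def Complex_eq by (intro continuous_intros)
  have p: "continuous_on UNIV (log_pt r)"
    unfolding log_pt_def by (intro continuous_intros cl)
  have s: "continuous_on UNIV log_scale" unfolding log_scale_def by (intro continuous_intros)
  have lp: "continuous_on UNIV (\<lambda>z. l (log_pt r z))"
    by (rule continuous_on_compose2[OF l_cont p]) (use log_pt_cball r in auto)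
  have Kp: "continuous_on UNIV (\<lambda>z. K (log_pt r z))"
    by (rule continuous_on_compose2[OF K_cont p]) (use log_pt_cball r in auto)
  have gap: "continuous_on UNIV (\<lambda>z. kappa (log_pt r z) (log_scale z))"
    unfolding kappa_def by (intro continuous_intros Kp s)
  show ?thesis unfolding log_ext_def
    by (intro continuous_intros cl lp gap kappa_bounds(1) log_pt_cball r log_scale)
qed


section \<open>The differential on the two sides of the imaginary axis\<close>

definition "log_kappa r \<zeta> = kappa (log_pt r \<zeta>) (log_scale \<zeta>)"
definition "log_angular r \<zeta> = angular (log_pt r \<zeta>) (log_scale \<zeta>)"

text \<open>The real-linear differential of \<open>log_ext\<close>, with the coefficient e of
  d\<sigma> left open: it is 1 to the right of the imaginary axis and \<open>log_angular\<close> to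
  the left, where the map is holomorphic.\<close>

definition dlog_ext :: "real \<Rightarrow> complex \<Rightarrow> complex \<Rightarrow> complex \<Rightarrow> complex" where
  "dlog_ext r e \<zeta> v = (e * of_real (Re v) + \<i> * log_angular r \<zeta> * of_real (Im v)) / log_kappa r \<zeta>"

lemma log_kappa: 
  assumes "0 \<le> r" "r \<le> 1"
  shows "log_kappa r \<zeta> \<notin> \<real>\<^sub>\<le>\<^sub>0" "log_kappa r \<zeta> \<noteq> 0" "kappa_min \<le> norm (log_kappa r \<zeta>)" "norm (log_kappa r \<zeta>) \<le> 1 + K_max"
  using kappa_bounds[OF log_pt_cball[OF assms] log_scale(2,3), of \<zeta> \<zeta>] kappa_min by (auto simp: log_kappa_def)

lemma log_angular_U: "0 \<le> r \<Longrightarrow> r < 1 \<Longrightarrow> log_angular r \<zeta> \<in> U k"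
  unfolding log_angular_def by (intro angular_U log_pt_ball log_scale)

lemma l_deriv: "z \<in> ball 0 1 \<Longrightarrow> (l has_field_derivative deriv l z) (at z)"
  using holomorphic_derivI[OF l_hol] by auto

lemma K_deriv: "z \<in> ball 0 1 \<Longrightarrow> (K has_field_derivative deriv K z) (at z)"
  using holomorphic_derivI[OF K_hol] by auto

lemma K_slit: "z \<in> cball 0 1 \<Longrightarrow> K z \<notin> \<real>\<^sub>\<le>\<^sub>0"
  using kappa_bounds(1)[of z 1] by (simp add: kappa_def)

text \<open>Freed of \<open>clip\<close>, the left formula is holomorphic wherever |r exp \<zeta>| <
  1; for r < 1 it can thus be differentiated on the imaginary axis too.\<close>

definition log_ext_in :: "real \<Rightarrow> complex \<Rightarrow> complex" where
  "log_ext_in r \<zeta> = c * \<zeta> + l (of_real r * exp \<zeta>) + Ln c + Ln (K (of_real r * exp \<zeta>))"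

text \<open>Since x l' = q - c and x K' / K = h / K - q, the terms c and q cancel.\<close>

lemma log_ext_in_deriv:
  assumes "norm (of_real r * exp \<zeta>) < 1"
  shows "(log_ext_in r has_field_derivative h (of_real r * exp \<zeta>) / K (of_real r * exp \<zeta>)) (at \<zeta>)"
proof -
  define x where "x = of_real r * exp \<zeta>"
  have x: "x \<in> ball 0 1" using assms by (simp add: x_def)
  have Kx: "K x \<notin> \<real>\<^sub>\<le>\<^sub>0" using K_slit[of x] x by simp
  hence Kx0: "K x \<noteq> 0" by auto
  have dx: "((\<lambda>\<zeta>. of_real r * exp \<zeta>) has_field_derivative x) (at \<zeta>)"
    by (auto intro!: derivative_eq_intros simp: x_def)
  have dl: "((\<lambda>\<zeta>. l (of_real r * exp \<zeta>)) has_field_derivative deriv l x * x) (at \<zeta>)"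
    by (rule DERIV_chain2[OF _ dx]) (use l_deriv[OF x] in \<open>simp add: x_def\<close>)
  have dK: "((\<lambda>\<zeta>. K (of_real r * exp \<zeta>)) has_field_derivative deriv K x * x) (at \<zeta>)"
    by (rule DERIV_chain2[OF _ dx]) (use K_deriv[OF x] in \<open>simp add: x_def\<close>)
  have dLn: "((\<lambda>\<zeta>. Ln (K (of_real r * exp \<zeta>))) has_field_derivative inverse (K x) * (deriv K x * x)) (at \<zeta>)"
    by (rule DERIV_chain2[OF _ dK]) (use has_field_derivative_Ln[OF Kx] in \<open>simp add: x_def\<close>)
  have "(log_ext_in r has_field_derivative (c + deriv l x * x + 0 + inverse (K x) * (deriv K x * x))) (at \<zeta>)"
    unfolding log_ext_in_def by (intro DERIV_add dl dLn DERIV_const) (auto intro!: derivative_eq_intros)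
  also have "c + deriv l x * x + 0 + inverse (K x) * (deriv K x * x) = h x / K x"
  proof -
    have "deriv l x * x = q x - c" "deriv K x * x = h x - q x * K x"
      using l_ode[OF x] K_ode[OF x] by (simp_all add: algebra_simps)
    thus ?thesis using Kx0 by (simp add: field_simps)
  qed
  finally show ?thesis by (simp add: x_def)
qed

lemma log_ext_eq_log_ext_in: "Re \<zeta> \<le> 0 \<Longrightarrow> log_ext r \<zeta> = log_ext_in r \<zeta>"
  by (simp add: log_ext_def log_ext_in_def clip_eq log_pt_def log_scale_def kappa_def)

lemma left_eqs:
  assumes "Re \<zeta> \<le> 0"
  shows "log_kappa r \<zeta> = K (of_real r * exp \<zeta>)" "log_angular r \<zeta> = h (of_real r * exp \<zeta>)"
  using assms by (simp_all add: log_kappa_def log_angular_def kappa_def angular_def log_scale_def log_pt_def clip_eq)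

definition log_ext_out :: "real \<Rightarrow> complex \<Rightarrow> complex" where
  "log_ext_out r \<zeta> = c * (\<i> * of_real (Im \<zeta>)) + l (of_real r * exp (\<i> * of_real (Im \<zeta>))) + Ln c
     + Ln (kappa (of_real r * exp (\<i> * of_real (Im \<zeta>))) (exp (- Re \<zeta>))) + of_real (Re \<zeta>)"

lemma log_ext_eq_log_ext_out: "Re \<zeta> \<ge> 0 \<Longrightarrow> log_ext r \<zeta> = log_ext_out r \<zeta>"
  by (simp add: log_ext_def log_ext_out_def clip_eq' log_pt_def log_scale_def)

lemma log_ext_out_deriv:
  assumes r: "0 \<le> r" "r < 1" and \<zeta>: "Re \<zeta> \<ge> 0"
  shows "(log_ext_out r has_derivative dlog_ext r 1 \<zeta>) (at \<zeta>)"
proof -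
  define x where "x = of_real r * exp (\<i> * of_real (Im \<zeta>))"
  define s where "s = exp (- Re \<zeta>)"
  have log_pt: "log_pt r \<zeta> = x" and log_scale: "log_scale \<zeta> = s" using \<zeta> by (simp_all add: log_pt_def clip_eq' x_def log_scale_def s_def)
  have x: "x \<in> ball 0 1" using log_pt_ball[OF r, of \<zeta>] by (simp add: log_pt)
  define \<kappa> where "\<kappa> = kappa x s"
  have \<kappa>: "\<kappa> \<notin> \<real>\<^sub>\<le>\<^sub>0" "\<kappa> \<noteq> 0" using log_kappa[of r \<zeta>] r by (auto simp: \<kappa>_def log_kappa_def log_pt log_scale)
  have dIm: "((\<lambda>\<zeta>. complex_of_real (Im \<zeta>)) has_derivative (\<lambda>v. of_real (Im v))) (at \<zeta>)"
    and dRe: "((\<lambda>\<zeta>. complex_of_real (Re \<zeta>)) has_derivative (\<lambda>v. of_real (Re v))) (at \<zeta>)"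
    by (auto intro!: derivative_eq_intros has_derivative_of_real)
  have chain: "((\<lambda>\<zeta>. F (G \<zeta>)) has_derivative (\<lambda>v. F' * G' v)) (at \<zeta>)"
    if "(F has_field_derivative F') (at (G \<zeta>))" "(G has_derivative G') (at \<zeta>)" for F F' and G G' :: "complex \<Rightarrow> complex"
    using has_derivative_compose[OF that(2) that(1)[unfolded has_field_derivative_def]] .
  have d1: "((\<lambda>\<zeta>. of_real r * exp (\<i> * of_real (Im \<zeta>))) has_derivative (\<lambda>v. x * (\<i> * of_real (Im v)))) (at \<zeta>)"
    by (rule chain[of "\<lambda>u. of_real r * exp (\<i> * u)" "x * \<i>" "\<lambda>\<zeta>. of_real (Im \<zeta>)", OF _ dIm, unfolded mult.assoc])
       (auto intro!: derivative_eq_intros simp: x_def)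
  have d2: "((\<lambda>\<zeta>. l (of_real r * exp (\<i> * of_real (Im \<zeta>)))) has_derivative (\<lambda>v. deriv l x * (x * (\<i> * of_real (Im v))))) (at \<zeta>)"
    by (rule chain[OF _ d1]) (use l_deriv[OF x] in \<open>simp add: x_def\<close>)
  have d3: "((\<lambda>\<zeta>. K (of_real r * exp (\<i> * of_real (Im \<zeta>)))) has_derivative (\<lambda>v. deriv K x * (x * (\<i> * of_real (Im v))))) (at \<zeta>)"
    by (rule chain[OF _ d1]) (use K_deriv[OF x] in \<open>simp add: x_def\<close>)
  have d4: "((\<lambda>\<zeta>. of_real (exp (- Re \<zeta>))) has_derivative (\<lambda>v. - of_real s * of_real (Re v) :: complex)) (at \<zeta>)"
    unfolding exp_of_real[symmetric] of_real_minus
    by (rule chain[of "\<lambda>u. exp (- u)" "- of_real s" "\<lambda>\<zeta>. of_real (Re \<zeta>)", OF _ dRe])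
       (auto intro!: derivative_eq_intros simp: s_def exp_of_real[symmetric])
  have d5: "((\<lambda>\<zeta>. kappa (of_real r * exp (\<i> * of_real (Im \<zeta>))) (exp (- Re \<zeta>))) has_derivative
     (\<lambda>v. (K x - 1) * (- of_real s * of_real (Re v)) + (deriv K x * (x * (\<i> * of_real (Im v)))) * of_real s)) (at \<zeta>)"
    unfolding kappa_def
    by (rule derivative_eq_intros d3 d4 refl)+ (simp add: x_def s_def)
  have d6: "((\<lambda>\<zeta>. Ln (kappa (of_real r * exp (\<i> * of_real (Im \<zeta>))) (exp (- Re \<zeta>)))) has_derivative
     (\<lambda>v. inverse \<kappa> * ((K x - 1) * (- of_real s * of_real (Re v)) + (deriv K x * (x * (\<i> * of_real (Im v)))) * of_real s))) (at \<zeta>)"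
    by (rule chain[OF _ d5]) (use has_field_derivative_Ln[OF \<kappa>(1)] in \<open>simp add: \<kappa>_def x_def s_def\<close>)
  have d0: "((\<lambda>\<zeta>. c * (\<i> * of_real (Im \<zeta>))) has_derivative (\<lambda>v. c * (\<i> * of_real (Im v)))) (at \<zeta>)"
    by (intro has_derivative_mult_right dIm)
  have "(log_ext_out r has_derivative (\<lambda>v. c * (\<i> * of_real (Im v)) + deriv l x * (x * (\<i> * of_real (Im v))) + 0
      + inverse \<kappa> * ((K x - 1) * (- of_real s * of_real (Re v)) + (deriv K x * (x * (\<i> * of_real (Im v)))) * of_real s)
      + of_real (Re v))) (at \<zeta>)"
    unfolding log_ext_out_def by (intro has_derivative_add d0 d2 d6 dRe has_derivative_const)
  also have "(\<lambda>v. c * (\<i> * of_real (Im v)) + deriv l x * (x * (\<i> * of_real (Im v))) + 0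
      + inverse \<kappa> * ((K x - 1) * (- of_real s * of_real (Re v)) + (deriv K x * (x * (\<i> * of_real (Im v)))) * of_real s)
      + of_real (Re v)) = dlog_ext r 1 \<zeta>"
  proof
    fix v
    have e1: "deriv l x * x = q x - c" and e2: "deriv K x * x = h x - q x * K x"
      using l_ode[OF x] K_ode[OF x] by (simp_all add: algebra_simps)
    define a b S where "a = complex_of_real (Re v)" and "b = complex_of_real (Im v)" and "S = complex_of_real s"
    have \<kappa>S: "\<kappa> = 1 + (K x - 1) * S" by (simp add: \<kappa>_def kappa_def S_def)
    have "c * (\<i> * b) + deriv l x * (x * (\<i> * b)) + 0
      + inverse \<kappa> * ((K x - 1) * (- S * a) + (deriv K x * (x * (\<i> * b))) * S) + a
      = c * (\<i> * b) + (deriv l x * x) * (\<i> * b)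
      + inverse \<kappa> * ((K x - 1) * (- S * a) + ((deriv K x * x) * (\<i> * b)) * S) + a"
      by (simp add: mult.assoc)
    also have "\<dots> = q x * (\<i> * b) + ((K x - 1) * (- S * a) + (h x - q x * K x) * (\<i> * b) * S) / \<kappa> + a"
      unfolding e1 e2 by (simp add: algebra_simps divide_inverse)
    also have "\<dots> = (q x * (\<i> * b) * \<kappa> + ((K x - 1) * (- S * a) + (h x - q x * K x) * (\<i> * b) * S) + a * \<kappa>) / \<kappa>"
      using \<kappa>(2) by (simp add: add_divide_distrib)
    \<comment> \<open>By \<kappa> = 1 + (K - 1) S the coefficient of a collapses to 1 and that of
      \<i> b to S h + (1 - S) q.\<close>
    also have "q x * (\<i> * b) * \<kappa> + ((K x - 1) * (- S * a) + (h x - q x * K x) * (\<i> * b) * S) + a * \<kappa>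
       = 1 * a + \<i> * (S * h x + (1 - S) * q x) * b"
      unfolding \<kappa>S by (simp add: algebra_simps)
    also have "\<dots> / \<kappa> = dlog_ext r 1 \<zeta> v"
      by (simp add: dlog_ext_def log_kappa_def log_angular_def log_pt log_scale \<kappa>_def angular_def a_def b_def S_def)
    finally show "c * (\<i> * of_real (Im v)) + deriv l x * (x * (\<i> * of_real (Im v))) + 0
      + inverse \<kappa> * ((K x - 1) * (- of_real s * of_real (Re v)) + (deriv K x * (x * (\<i> * of_real (Im v)))) * of_real s)
      + of_real (Re v) = dlog_ext r 1 \<zeta> v" by (simp only: a_def b_def S_def)
  qed
  finally show ?thesis .
qed

section \<open>Increments along segments that may cross the imaginary axis\<close>

lemma dlog_ext_scale: "dlog_ext r e \<zeta> (of_real t * v) = of_real t * dlog_ext r e \<zeta> v"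
  by (simp add: dlog_ext_def algebra_simps)

lemma seg_point: "0 \<le> t \<Longrightarrow> t \<le> 1 \<Longrightarrow> a + of_real t * (b - a) \<in> closed_segment a (b::complex)"
  unfolding closed_segment_def by (auto intro!: exI[of _ t] simp: scaleR_conv_of_real algebra_simps)

lemma increment_left:
  assumes r: "0 \<le> r" "r < 1" and re: "Re a \<le> 0" "Re b \<le> 0"
    and B: "\<And>\<zeta>. \<zeta> \<in> closed_segment a b \<Longrightarrow> B \<le> inner n (dlog_ext r (log_angular r \<zeta>) \<zeta> (b - a))"
  shows "B \<le> inner n (log_ext r b - log_ext r a)"
proof -
  define p where "p = (\<lambda>t::real. a + of_real t * (b - a))"
  have p: "p t \<in> closed_segment a b" if "0 \<le> t" "t \<le> 1" for t
    unfolding p_def by (rule seg_point[OF that])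
  have rp: "Re (p t) \<le> 0" if "0 \<le> t" "t \<le> 1" for t
  proof -
    have "closed_segment a b \<subseteq> {z. Re z \<le> 0}"
      by (rule closed_segment_subset) (use re in \<open>auto intro: convex_halfspace_Re_le\<close>)
    thus ?thesis using p[OF that] by auto
  qed
  have cont: "continuous_on {0..1} (\<lambda>t. log_ext r (p t))"
    by (rule continuous_on_compose2[OF continuous_log_ext, of r])
       (use r in \<open>auto simp: p_def intro!: continuous_intros\<close>)
  have der: "((\<lambda>t. log_ext r (p t)) has_vector_derivative dlog_ext r (log_angular r (p t)) (p t) (b - a)) (at t)"
    if t: "0 < t" "t < 1" for t
  proof -
    have x: "norm (of_real r * exp (p t)) < 1"
      using log_pt_ball[OF r, of "p t"] rp[of t] t by (simp add: log_pt_def clip_eq)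
    have "((\<lambda>u. log_ext_in r (a + u * (b - a))) has_field_derivative
        h (of_real r * exp (p t)) / K (of_real r * exp (p t)) * (b - a)) (at (of_real t))"
      by (rule DERIV_chain2[where f = "log_ext_in r"])
         (use log_ext_in_deriv[OF x] in \<open>auto simp: p_def intro!: derivative_eq_intros\<close>)
    from has_vector_derivative_real_field[OF this]
    have "((\<lambda>t. log_ext_in r (p t)) has_vector_derivative h (of_real r * exp (p t)) / K (of_real r * exp (p t)) * (b - a)) (at t)"
      by (simp add: p_def)
    also have "h (of_real r * exp (p t)) / K (of_real r * exp (p t)) * (b - a) = dlog_ext r (log_angular r (p t)) (p t) (b - a)"
    proof -
      have "b - a = of_real (Re (b - a)) + \<i> * of_real (Im (b - a))" by (rule complex_eq)
      thus ?thesis using rp[of t] t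
        by (simp add: dlog_ext_def left_eqs) (metis distrib_left mult.assoc mult.left_commute)
    qed
    finally show ?thesis
    proof (rule has_vector_derivative_transform_within_open[where S = "{0<..<1}"])
      fix u :: real assume "u \<in> {0<..<1}"
      thus "log_ext_in r (p u) = log_ext r (p u)" using rp[of u] by (simp add: log_ext_eq_log_ext_in)
    qed (use t in auto)
  qed
  have "B \<le> inner n (log_ext r (p 1) - log_ext r (p 0))"
    by (rule derivative_ge_imp_increment_ge[OF cont der]) (auto intro!: B p)
  thus ?thesis by (simp add: p_def)
qed

lemma increment_right:
  assumes r: "0 \<le> r" "r < 1" and re: "Re a \<ge> 0" "Re b \<ge> 0" "Re a > 0 \<or> Re b > 0"
    and B: "\<And>\<zeta>. \<zeta> \<in> closed_segment a b \<Longrightarrow> B \<le> inner n (dlog_ext r 1 \<zeta> (b - a))"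
  shows "B \<le> inner n (log_ext r b - log_ext r a)"
proof -
  define p where "p = (\<lambda>t::real. a + of_real t * (b - a))"
  have p: "p t \<in> closed_segment a b" if "0 \<le> t" "t \<le> 1" for t
    unfolding p_def by (rule seg_point[OF that])
  have rp: "Re (p t) > 0" if "0 < t" "t < 1" for t
  proof -
    have "Re (p t) = (1 - t) * Re a + t * Re b" by (simp add: p_def algebra_simps)
    moreover have "(1 - t) * Re a \<ge> 0" "t * Re b \<ge> 0" using re that by auto
    moreover have "(1 - t) * Re a > 0 \<or> t * Re b > 0" using re that by auto
    ultimately show ?thesis by linarith
  qed
  have cont: "continuous_on {0..1} (\<lambda>t. log_ext r (p t))"
    by (rule continuous_on_compose2[OF continuous_log_ext, of r])
       (use r in \<open>auto simp: p_def intro!: continuous_intros\<close>)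
  have der: "((\<lambda>t. log_ext r (p t)) has_vector_derivative dlog_ext r 1 (p t) (b - a)) (at t)"
    if t: "0 < t" "t < 1" for t
  proof -
    have dp: "(p has_derivative (\<lambda>s. of_real s * (b - a))) (at t)"
      unfolding p_def by (auto intro!: derivative_eq_intros has_derivative_of_real)
    have "((\<lambda>t. log_ext_out r (p t)) has_derivative (\<lambda>s. dlog_ext r 1 (p t) (of_real s * (b - a)))) (at t)"
      using has_derivative_compose[OF dp log_ext_out_deriv[OF r]] rp[OF t] by simp
    hence "((\<lambda>t. log_ext_out r (p t)) has_vector_derivative dlog_ext r 1 (p t) (b - a)) (at t)"
      unfolding has_vector_derivative_def by (simp only: dlog_ext_scale scaleR_conv_of_real)
    thus ?thesis
    proof (rule has_vector_derivative_transform_within_open[where S = "{0<..<1}"])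
      fix u :: real assume "u \<in> {0<..<1}"
      thus "log_ext_out r (p u) = log_ext r (p u)" using rp[of u] by (simp add: log_ext_eq_log_ext_out)
    qed (use t in auto)
  qed
  have "B \<le> inner n (log_ext r (p 1) - log_ext r (p 0))"
    by (rule derivative_ge_imp_increment_ge[OF cont der]) (auto intro!: B p)
  thus ?thesis by (simp add: p_def)
qed

text \<open>The segment is cut where it crosses the axis. As the bound is demanded for both values
  of e at every point, it applies to either part, and the shares t B and (1 - t) B add up to
  B.\<close>

lemma increment:
  assumes r: "0 \<le> r" "r < 1"
    and B: "\<And>\<zeta> e. \<zeta> \<in> closed_segment a b \<Longrightarrow> e = 1 \<or> e = log_angular r \<zeta> \<Longrightarrow> B \<le> inner n (dlog_ext r e \<zeta> (b - a))"
  shows "B \<le> inner n (log_ext r b - log_ext r a)"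
proof -
  have half: "t * B \<le> inner n (log_ext r y - log_ext r x)"
    if "0 \<le> t" "y - x = of_real t * (b - a)" "closed_segment x y \<subseteq> closed_segment a b"
       "Re x \<le> 0 \<and> Re y \<le> 0 \<or> Re x \<ge> 0 \<and> Re y \<ge> 0 \<and> (Re x > 0 \<or> Re y > 0)" for x y t
  proof -
    have *: "t * B \<le> inner n (dlog_ext r e \<zeta> (y - x))"
      if "\<zeta> \<in> closed_segment x y" "e = 1 \<or> e = log_angular r \<zeta>" for \<zeta> e
    proof -
      have "t * B \<le> t * inner n (dlog_ext r e \<zeta> (b - a))"
        using B[of \<zeta> e] that \<open>0 \<le> t\<close> \<open>closed_segment x y \<subseteq> _\<close> by (intro mult_left_mono) auto
      also have "\<dots> = inner n (dlog_ext r e \<zeta> (y - x))"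
        unfolding \<open>y - x = _\<close> dlog_ext_scale by (simp add: scaleR_conv_of_real[symmetric])
      finally show ?thesis .
    qed
    from that(4) show ?thesis
      using increment_left[OF r, of x y "t * B" n] increment_right[OF r, of x y "t * B" n] * by blast
  qed
  consider "Re a \<le> 0 \<and> Re b \<le> 0 \<or> Re a \<ge> 0 \<and> Re b \<ge> 0 \<and> (Re a > 0 \<or> Re b > 0)"
    | "Re a * Re b < 0"
    by (metis linorder_not_less mult_neg_pos mult_pos_neg order_less_imp_le)
  thus ?thesis
  proof cases
    case 1
    thus ?thesis using half[of 1 b a] by simp
  next
    case 2
    \<comment> \<open>The parameter at which the segment meets the imaginary axis.\<close>
    define t where "t = Re a / (Re a - Re b)"
    have t: "0 \<le> t" "t \<le> 1" using 2 by (auto simp: t_def divide_simps mult_less_0_iff)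
    define y where "y = a + of_real t * (b - a)"
    have y: "y \<in> closed_segment a b" unfolding y_def by (rule seg_point[OF t])
    have "Re a - Re b \<noteq> 0" using 2 by (auto simp: mult_less_0_iff)
    have "Re y = Re a - t * (Re a - Re b)" by (simp add: y_def algebra_simps)
    also have "t * (Re a - Re b) = Re a" using \<open>Re a - Re b \<noteq> 0\<close> by (simp add: t_def)
    finally have Rey: "Re y = 0" by simp
    have "t * B \<le> inner n (log_ext r y - log_ext r a)"
      by (rule half) (use t y Rey 2 in \<open>auto simp: y_def mult_less_0_iff subset_closed_segment\<close>)
    moreover have "(1 - t) * B \<le> inner n (log_ext r b - log_ext r y)"
      by (rule half) (use t y Rey 2 in \<open>auto simp: y_def mult_less_0_iff subset_closed_segment algebra_simps\<close>)
    ultimately have "t * B + (1 - t) * B \<le> inner n (log_ext r y - log_ext r a) + inner n (log_ext r b - log_ext r y)"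
      by (rule add_mono)
    moreover have "inner n (log_ext r y - log_ext r a) + inner n (log_ext r b - log_ext r y) = inner n (log_ext r b - log_ext r a)"
      by (simp add: inner_diff_right)
    moreover have "t * B + (1 - t) * B = B" by (simp add: algebra_simps)
    ultimately show ?thesis by simp
  qed
qed


lemma dlog_ext_norm_le:
  assumes r: "0 \<le> r" "r < 1" and e: "norm e \<le> M"
  shows "norm (dlog_ext r e \<zeta> v) \<le> 2 * M / kappa_min * norm v"
proof -
  have "norm (e * of_real (Re v) + \<i> * log_angular r \<zeta> * of_real (Im v)) \<le> M * norm v + M * norm v"
  proof (rule norm_triangle_le, rule add_mono)
    show "norm (e * of_real (Re v)) \<le> M * norm v"
      unfolding norm_mult using e mM abs_Re_le_cmod[of v] by (intro mult_mono) auto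
    show "norm (\<i> * log_angular r \<zeta> * of_real (Im v)) \<le> M * norm v"
    proof -
      have "norm (\<i> * log_angular r \<zeta> * of_real (Im v)) = norm (log_angular r \<zeta>) * \<bar>Im v\<bar>" by (simp add: norm_mult)
      also have "\<dots> \<le> M * norm v"
        using U_upper[OF log_angular_U[OF r]] mM(3) abs_Im_le_cmod[of v] by (intro mult_mono) auto
      finally show ?thesis .
    qed
  qed
  hence "norm (dlog_ext r e \<zeta> v) \<le> (M * norm v + M * norm v) / norm (log_kappa r \<zeta>)"
    unfolding dlog_ext_def norm_divide by (rule divide_right_mono) auto
  also have "\<dots> \<le> (M * norm v + M * norm v) / kappa_min"
    using log_kappa(3)[of r \<zeta>] r kappa_min mM by (intro divide_left_mono) (auto intro!: mult_pos_pos)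
  also have "\<dots> = 2 * M / kappa_min * norm v" by (simp add: algebra_simps)
  finally show ?thesis .
qed

text \<open>The test direction is the increment itself, up to sign, so the lower bound from
  \<open>increment\<close> becomes an upper bound for its norm.\<close>

lemma Lipschitz_log_ext_aux:
  assumes r: "0 \<le> r" "r < 1"
  shows "norm (log_ext r a - log_ext r b) \<le> 2 * M / kappa_min * norm (a - b)"
proof -
  define n where "n = log_ext r a - log_ext r b"
  define L where "L = 2 * M / kappa_min * norm (b - a)"
  have "- (norm n * L) \<le> inner n (log_ext r b - log_ext r a)"
  proof (rule increment[OF r])
    fix \<zeta> e assume "e = 1 \<or> e = log_angular r \<zeta>"
    hence "norm e \<le> M" using mM U_upper[OF log_angular_U[OF r]] by auto
    from dlog_ext_norm_le[OF r this, of \<zeta> "b - a"] have "norm (dlog_ext r e \<zeta> (b - a)) \<le> L" by (simp add: L_def)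
    hence "norm n * norm (dlog_ext r e \<zeta> (b - a)) \<le> norm n * L" by (intro mult_left_mono) auto
    moreover have "\<bar>inner n (dlog_ext r e \<zeta> (b - a))\<bar> \<le> norm n * norm (dlog_ext r e \<zeta> (b - a))"
      by (rule Cauchy_Schwarz_ineq2)
    ultimately show "- (norm n * L) \<le> inner n (dlog_ext r e \<zeta> (b - a))" by linarith
  qed
  also have "log_ext r b - log_ext r a = - n" by (simp add: n_def)
  also have "inner n (- n) = - (norm n * norm n)" by (simp add: dot_square_norm power2_eq_square)
  finally have "norm n * norm n \<le> norm n * L" by simp
  hence "norm n \<le> L \<or> norm n = 0" by (metis mult_le_cancel_left norm_ge_zero order_less_le)
  moreover have "L \<ge> 0" using mM kappa_min by (simp add: L_def)
  ultimately show ?thesis by (auto simp: n_def L_def norm_minus_commute)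
qed

section \<open>Expansion by means of a weighted test direction\<close>

definition "weight = (M\<^sup>2 / 2 + 1 / 2) / m ^ 3"
definition "ratio_min = m / (1 + K_max)"
text \<open>An oscillation of w / \<kappa> by at most \<open>eta\<close> costs at most a quarter of
  |G|^2 |v|^2 in \<open>local_expansion\<close>, half of what \<open>weighted_positive\<close>
  provides.\<close>

definition "eta = ratio_min / (4 * (weight + 1) * (M + 1))"
text \<open>The remaining quarter, with \<open>ratio_min\<close> in place of |G|, divided by the
  bound \<open>weight\<close> + 1 for |y| / |v|. Nothing here depends on r.\<close>

definition "expansion_const = ratio_min / (4 * (weight + 1))"

lemma const_pos: "weight > 0" "ratio_min > 0" "eta > 0" "expansion_const > 0"
proof -
  show "weight > 0" using mM by (simp add: weight_def add_nonneg_pos)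
  moreover show "ratio_min > 0" using mM(1) K_max by (simp add: ratio_min_def)
  ultimately show "eta > 0" "expansion_const > 0" using mM(3) by (simp_all add: eta_def expansion_const_def)
qed

text \<open>Up to the factor \<i> this is the coefficient of d\<theta>. It is given by one
  continuous expression on both sides of the axis when r < 1; only the coefficient of d\<sigma>
  jumps.\<close>

definition "log_ratio r \<zeta> = log_angular r \<zeta> / log_kappa r \<zeta>"

lemma ratio_min_le: 
  assumes r: "0 \<le> r" "r < 1"
  shows "ratio_min \<le> norm (log_ratio r \<zeta>)"
proof -
  have "m \<le> norm (log_angular r \<zeta>)"
    using U_lower[OF log_angular_U[OF r]] complex_Re_le_cmod order_trans by blast
  thus ?thesis unfolding log_ratio_def ratio_min_def norm_divide
    using log_kappa[of r \<zeta>] r mM by (intro frac_le) auto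
qed

text \<open>On the two sides of the imaginary axis the differential is \<open>g (a + \<i> b)\<close> and
  \<open>g (a / w + \<i> b)\<close>; weighting the first coordinate by the large constant \<open>weight\<close>
  makes both, and hence all their averages, positive definite in the sense below.\<close>

lemma weighted_positive:
  fixes a b :: real
  assumes "m ^ 3 \<le> Re u" "norm u \<le> M"
  shows "1 / 2 * (a\<^sup>2 + b\<^sup>2) \<le> Re ((of_real (weight * a) - \<i> * of_real b) * (u * of_real a + \<i> * of_real b))"
proof -
  have "Re ((of_real (weight * a) - \<i> * of_real b) * (u * of_real a + \<i> * of_real b)) =
      weight * a\<^sup>2 * Re u + b\<^sup>2 + (Im u * a) * b"
    by (simp add: algebra_simps power2_eq_square)
  moreover have "- (M\<^sup>2 * a\<^sup>2 / 2) - b\<^sup>2 / 2 \<le> (Im u * a) * b"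
  proof -
    have "0 \<le> (Im u * a + b)\<^sup>2" by simp
    hence "- ((Im u)\<^sup>2 * a\<^sup>2) - b\<^sup>2 \<le> 2 * ((Im u * a) * b)"
      by (simp add: power2_eq_square algebra_simps)
    moreover have "(Im u)\<^sup>2 * a\<^sup>2 \<le> M\<^sup>2 * a\<^sup>2"
    proof (rule mult_right_mono)
      have "\<bar>Im u\<bar> \<le> \<bar>M\<bar>" using assms(2) abs_Im_le_cmod[of u] by linarith
      thus "(Im u)\<^sup>2 \<le> M\<^sup>2" by (simp only: abs_le_square_iff)
    qed simp
    ultimately show ?thesis by linarith
  qed
  moreover have "(M\<^sup>2 / 2 + 1 / 2) * a\<^sup>2 \<le> weight * a\<^sup>2 * Re u"
  proof -
    have "(M\<^sup>2 / 2 + 1 / 2) = weight * m ^ 3" using mM by (simp add: weight_def)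
    also have "\<dots> \<le> weight * Re u" using assms const_pos by (intro mult_left_mono) auto
    finally have "(M\<^sup>2 / 2 + 1 / 2) * a\<^sup>2 \<le> (weight * Re u) * a\<^sup>2" by (intro mult_right_mono) auto
    thus ?thesis by (simp add: mult_ac)
  qed
  ultimately show ?thesis by (simp add: algebra_simps)
qed

text \<open>With G = w / \<kappa> frozen at a, the one test direction G y serves every point of the
  segment and both values of e. Here y is v with its real part multiplied by
  \<open>weight\<close>.\<close>

lemma local_expansion:
  assumes r: "0 \<le> r" "r < 1"
    and g: "\<And>\<zeta>. \<zeta> \<in> closed_segment a b \<Longrightarrow> norm (log_ratio r \<zeta> - log_ratio r a) \<le> eta"
  shows "expansion_const * norm (b - a) \<le> norm (log_ext r b - log_ext r a)"
proof (cases "b = a")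
  case False
  define v where "v = b - a"
  define y where "y = of_real (weight * Re v) + \<i> * of_real (Im v)"
  define G where "G = log_ratio r a"
  define n where "n = G * y"
  have v0: "norm v > 0" using False by (simp add: v_def)
  have y_le: "norm y \<le> (weight + 1) * norm v"
  proof -
    have "norm y \<le> norm (complex_of_real (weight * Re v)) + norm (\<i> * complex_of_real (Im v))"
      unfolding y_def by (rule norm_triangle_ineq)
    also have "\<dots> = weight * \<bar>Re v\<bar> + \<bar>Im v\<bar>" using const_pos(1) by (simp add: norm_mult abs_mult)
    also have "\<dots> \<le> weight * norm v + norm v"
      using const_pos(1) abs_Re_le_cmod[of v] abs_Im_le_cmod[of v] by (intro add_mono mult_left_mono) auto
    finally show ?thesis by (simp add: algebra_simps)
  qed
  have G: "ratio_min \<le> norm G" unfolding G_def by (rule ratio_min_le[OF r])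
  hence G0: "norm G > 0" using const_pos by linarith
  have main: "1 / 4 * (norm G)\<^sup>2 * (norm v)\<^sup>2 \<le> inner n (dlog_ext r e \<zeta> v)"
    if \<zeta>: "\<zeta> \<in> closed_segment a b" and e: "e = 1 \<or> e = log_angular r \<zeta>" for \<zeta> e
  proof -
    define w where "w = log_angular r \<zeta>"
    have w: "m \<le> Re w" "norm w \<le> M" using U_lower U_upper log_angular_U[OF r, of \<zeta>] by (auto simp: w_def)
    have w0: "w \<noteq> 0" using w mM by auto
    \<comment> \<open>Pulling out w leaves u = 1 for the left differential and u = 1 / w for the
      right one, with the common factor \<open>log_ratio\<close> in front.\<close>
    define u where "u = e / w"
    \<comment> \<open>The cube arises as m / M^2 with M = 1 / m.\<close>
    have Re_inv: "m ^ 3 \<le> Re (1 / w)"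
    proof -
      have "Re (1 / w) = Re w / (norm w)\<^sup>2" by (simp add: Re_divide cmod_power2)
      moreover have "m / M\<^sup>2 \<le> Re w / (norm w)\<^sup>2"
        using w w0 mM by (intro frac_le power_mono) auto
      moreover have "m / M\<^sup>2 = m ^ 3" using mM by (simp add: power_divide power3_eq_cube power2_eq_square)
      ultimately show ?thesis by simp
    qed
    have inv_M: "norm (1 / w) \<le> M"
    proof -
      have "m \<le> norm w" using w complex_Re_le_cmod[of w] by linarith
      thus ?thesis using mM by (simp add: norm_divide frac_le)
    qed
    have "m ^ 3 \<le> 1" using mM by (simp add: power_le_one)
    hence u: "m ^ 3 \<le> Re u" "norm u \<le> M"
      using e Re_inv inv_M mM w0 by (auto simp: u_def w_def[symmetric])
    define X where "X = u * of_real (Re v) + \<i> * of_real (Im v)"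
    have DDX: "dlog_ext r e \<zeta> v = log_ratio r \<zeta> * X"
      using w0 by (simp add: dlog_ext_def log_ratio_def X_def u_def w_def[symmetric] algebra_simps add_divide_distrib)
    have X_le: "norm X \<le> (M + 1) * norm v"
    proof -
      have "norm X \<le> norm u * \<bar>Re v\<bar> + \<bar>Im v\<bar>"
        unfolding X_def by (rule order_trans[OF norm_triangle_ineq]) (simp add: norm_mult)
      also have "\<dots> \<le> M * norm v + norm v"
        using u mM abs_Re_le_cmod[of v] abs_Im_le_cmod[of v] by (intro add_mono mult_mono) auto
      finally show ?thesis by (simp add: algebra_simps)
    qed
    have yX: "1 / 2 * (norm v)\<^sup>2 \<le> Re (cnj y * X)"
      using weighted_positive[OF u, of "Re v" "Im v"] by (simp add: y_def X_def cmod_power2)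
    have inner_Re: "inner p s = Re (cnj p * s)" for p s by (simp add: inner_complex_def)
    have "dlog_ext r e \<zeta> v = G * X + (log_ratio r \<zeta> - G) * X" by (simp add: DDX algebra_simps)
    hence "inner n (dlog_ext r e \<zeta> v) = inner n (G * X) + inner n ((log_ratio r \<zeta> - G) * X)"
      by (simp add: inner_add_right)
    moreover have "inner n (G * X) = (norm G)\<^sup>2 * Re (cnj y * X)"
    proof -
      have "cnj n * (G * X) = (G * cnj G) * (cnj y * X)" by (simp add: n_def)
      also have "G * cnj G = of_real ((norm G)\<^sup>2)" by (rule complex_norm_square[symmetric])
      finally show ?thesis unfolding inner_Re by (simp only: Re_complex_of_real Im_complex_of_real times_complex.sel(1))
    qed
    moreover have "(norm G)\<^sup>2 * (1 / 2 * (norm v)\<^sup>2) \<le> (norm G)\<^sup>2 * Re (cnj y * X)"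
      using yX by (intro mult_left_mono) auto
    moreover have "\<bar>inner n ((log_ratio r \<zeta> - G) * X)\<bar> \<le> 1 / 4 * (norm G)\<^sup>2 * (norm v)\<^sup>2"
    proof -
      have "\<bar>inner n ((log_ratio r \<zeta> - G) * X)\<bar> \<le> norm n * norm ((log_ratio r \<zeta> - G) * X)"
        by (rule Cauchy_Schwarz_ineq2)
      also have "\<dots> = (norm G * norm y) * (norm (log_ratio r \<zeta> - G) * norm X)" by (simp add: n_def norm_mult)
      also have "\<dots> \<le> (norm G * ((weight + 1) * norm v)) * (eta * ((M + 1) * norm v))"
        using g[OF \<zeta>] y_le X_le const_pos mM by (intro mult_mono) (auto simp: G_def)
      also have "\<dots> = norm G * (norm v)\<^sup>2 * (eta * (weight + 1) * (M + 1))"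
        by (simp add: power2_eq_square algebra_simps)
      also have "eta * (weight + 1) * (M + 1) = ratio_min / 4"
      proof -
        have "weight + 1 \<noteq> 0" "M + 1 \<noteq> 0" using const_pos(1) mM(3) by auto
        thus ?thesis by (simp add: eta_def divide_simps)
      qed
      also have "norm G * (norm v)\<^sup>2 * (ratio_min / 4) \<le> norm G * (norm v)\<^sup>2 * (norm G / 4)"
        using G by (intro mult_left_mono) auto
      also have "norm G * (norm v)\<^sup>2 * (norm G / 4) = 1 / 4 * (norm G)\<^sup>2 * (norm v)\<^sup>2"
        by (simp add: power2_eq_square)
      finally show ?thesis .
    qed
    ultimately show ?thesis by argo
  qed
  have "1 / 4 * (norm G)\<^sup>2 * (norm v)\<^sup>2 \<le> inner n (log_ext r b - log_ext r a)"
    by (rule increment[OF r]) (use main in \<open>auto simp: v_def\<close>)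
  also have "\<dots> \<le> norm n * norm (log_ext r b - log_ext r a)" by (rule norm_cauchy_schwarz)
  also have "norm n * norm (log_ext r b - log_ext r a) \<le> (norm G * ((weight + 1) * norm v)) * norm (log_ext r b - log_ext r a)"
    unfolding n_def norm_mult using y_le by (intro mult_right_mono mult_left_mono) auto
  finally have "(norm G * norm v) * (1 / 4 * norm G * norm v) \<le> (norm G * norm v) * ((weight + 1) * norm (log_ext r b - log_ext r a))"
    by (simp add: power2_eq_square algebra_simps)
  hence "1 / 4 * norm G * norm v \<le> (weight + 1) * norm (log_ext r b - log_ext r a)"
    using G0 v0 by (simp add: mult_le_cancel_left_pos)
  moreover have "1 / 4 * ratio_min * norm v \<le> 1 / 4 * norm G * norm v" using G by (intro mult_right_mono) auto
  ultimately have "1 / 4 * ratio_min * norm v \<le> (weight + 1) * norm (log_ext r b - log_ext r a)" by linarith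
  thus ?thesis using const_pos by (simp add: expansion_const_def v_def field_simps)
qed simp

lemma expansion_lt_1:
  assumes r: "0 \<le> r" "r < 1"
  shows "expansion_const * dist a b \<le> dist (log_ext r a) (log_ext r b)"
proof -
  \<comment> \<open>\<open>log_ratio\<close> factors through this compact set and is therefore
    uniformly continuous on the whole plane. Here r < 1 matters, since h and q are continuous only
    inside the open disc.\<close>
  define S where "S = cball (0::complex) r \<times> {0..1::real}"
  have sub: "cball (0::complex) r \<subseteq> ball 0 1" using r by auto
  have f: "continuous_on S fst" "fst ` S \<subseteq> ball 0 1"
    using sub by (auto simp: S_def intro!: continuous_intros)
  note ch = continuous_on_compose2[OF holomorphic_on_imp_continuous_on[OF h_hol] f]
    continuous_on_compose2[OF holomorphic_on_imp_continuous_on[OF q_hol] f]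
    continuous_on_compose2[OF holomorphic_on_imp_continuous_on[OF K_hol] f]
  have "continuous_on S (\<lambda>p. angular (fst p) (snd p) / kappa (fst p) (snd p))"
  proof (rule continuous_on_divide)
    show "continuous_on S (\<lambda>p. angular (fst p) (snd p))" unfolding angular_def by (intro continuous_intros ch)
    show "continuous_on S (\<lambda>p. kappa (fst p) (snd p))" unfolding kappa_def by (intro continuous_intros ch)
    show "\<forall>p\<in>S. kappa (fst p) (snd p) \<noteq> 0"
    proof
      fix p assume "p \<in> S"
      hence "fst p \<in> cball 0 1" "0 \<le> snd p" "snd p \<le> 1" using sub by (auto simp: S_def)
      from kappa_bounds(1)[OF this] show "kappa (fst p) (snd p) \<noteq> 0" by auto
    qed
  qed
  moreover have "compact S" unfolding S_def by (intro compact_Times) auto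
  ultimately have "uniformly_continuous_on S (\<lambda>p. angular (fst p) (snd p) / kappa (fst p) (snd p))"
    by (rule compact_uniformly_continuous)
  then obtain d where d: "d > 0" "\<And>p p'. p \<in> S \<Longrightarrow> p' \<in> S \<Longrightarrow> dist p' p < d \<Longrightarrow>
      dist (angular (fst p') (snd p') / kappa (fst p') (snd p')) (angular (fst p) (snd p) / kappa (fst p) (snd p)) < eta"
    unfolding uniformly_continuous_on_def using const_pos(3) by blast
  \<comment> \<open>Base point and scale each move by at most |\<zeta> - \<xi>|, whence the half of
    d.\<close>
  have gd: "norm (log_ratio r \<zeta> - log_ratio r \<xi>) \<le> eta" if "norm (\<zeta> - \<xi>) < d / 2" for \<zeta> \<xi>
  proof -
    have "dist (log_pt r \<zeta>, log_scale \<zeta>) (log_pt r \<xi>, log_scale \<xi>) \<le> dist (log_pt r \<zeta>) (log_pt r \<xi>) + dist (log_scale \<zeta>) (log_scale \<xi>)"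
      unfolding dist_Pair_Pair by (rule sqrt_sum_squares_le_sum) auto
    also have "dist (log_pt r \<zeta>) (log_pt r \<xi>) \<le> norm (\<zeta> - \<xi>)"
    proof -
      have "dist (log_pt r \<zeta>) (log_pt r \<xi>) = r * norm (exp (clip \<zeta>) - exp (clip \<xi>))"
        using r by (simp add: log_pt_def dist_norm right_diff_distrib[symmetric] norm_mult)
      also have "\<dots> \<le> 1 * norm (clip \<zeta> - clip \<xi>)"
        using r by (intro mult_mono norm_exp_diff_le) auto
      finally show ?thesis using dist_clip_le[of \<zeta> \<xi>] by simp
    qed
    also have "dist (log_scale \<zeta>) (log_scale \<xi>) \<le> norm (\<zeta> - \<xi>)"
    proof -
      have "dist (log_scale \<zeta>) (log_scale \<xi>) = norm (exp (complex_of_real (- max (Re \<zeta>) 0)) - exp (complex_of_real (- max (Re \<xi>) 0)))"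
        by (simp only: log_scale_def exp_of_real of_real_diff[symmetric] norm_of_real dist_real_def)
      also have "\<dots> \<le> norm (complex_of_real (- max (Re \<zeta>) 0) - complex_of_real (- max (Re \<xi>) 0))"
        by (rule norm_exp_diff_le) auto
      also have "\<dots> = \<bar>max (Re \<xi>) 0 - max (Re \<zeta>) 0\<bar>"
        by (simp only: of_real_diff[symmetric] norm_of_real)
      also have "\<dots> \<le> \<bar>Re (\<zeta> - \<xi>)\<bar>" by auto
      also have "\<dots> \<le> norm (\<zeta> - \<xi>)" by (rule abs_Re_le_cmod)
      finally show ?thesis .
    qed
    finally have "dist (log_pt r \<zeta>, log_scale \<zeta>) (log_pt r \<xi>, log_scale \<xi>) < d" using that by simp
    from d(2)[OF _ _ this] show ?thesis
      using norm_log_pt_le[OF r(1)] log_scale by (simp add: S_def log_ratio_def log_angular_def log_kappa_def dist_norm)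
  qed
  show ?thesis
  proof (rule locally_expanding_imp_expanding[of "log_ext r" expansion_const "d / 2"])
    show "continuous_on UNIV (log_ext r)" using r by (intro continuous_log_ext) auto
    show "expansion_const > 0" "d / 2 > 0" using const_pos d by auto
    fix x y :: complex assume xy: "dist x y < d / 2"
    have "expansion_const * norm (y - x) \<le> norm (log_ext r y - log_ext r x)"
    proof (rule local_expansion[OF r])
      fix \<zeta> assume "\<zeta> \<in> closed_segment x y"
      hence "norm (\<zeta> - x) \<le> norm (y - x)" by (rule segment_bound1)
      thus "norm (log_ratio r \<zeta> - log_ratio r x) \<le> eta" using gd[of \<zeta> x] xy by (simp add: dist_norm norm_minus_commute)
    qed
    thus "expansion_const * dist x y \<le> dist (log_ext r x) (log_ext r y)" by (simp add: dist_norm norm_minus_commute)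
  qed
qed

section \<open>Passage to r = 1 in logarithmic coordinates\<close>

lemma log_ext_tendsto:
  assumes s: "s \<longlonglongrightarrow> 1" "\<And>n. 0 \<le> s n" "\<And>n. s n \<le> 1"
  shows "(\<lambda>n. log_ext (s n) \<zeta>) \<longlonglongrightarrow> log_ext 1 \<zeta>"
proof -
  have p: "(\<lambda>n. log_pt (s n) \<zeta>) \<longlonglongrightarrow> log_pt 1 \<zeta>"
    unfolding log_pt_def by (intro tendsto_intros s)
  have lp: "(\<lambda>n. l (log_pt (s n) \<zeta>)) \<longlonglongrightarrow> l (log_pt 1 \<zeta>)"
    by (rule continuous_on_tendsto_compose[OF l_cont p]) (use log_pt_cball s in auto)
  have Kp: "(\<lambda>n. K (log_pt (s n) \<zeta>)) \<longlonglongrightarrow> K (log_pt 1 \<zeta>)"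
    by (rule continuous_on_tendsto_compose[OF K_cont p]) (use log_pt_cball s in auto)
  have gap: "(\<lambda>n. kappa (log_pt (s n) \<zeta>) (log_scale \<zeta>)) \<longlonglongrightarrow> kappa (log_pt 1 \<zeta>) (log_scale \<zeta>)"
    unfolding kappa_def by (intro tendsto_intros Kp)
  show ?thesis unfolding log_ext_def
    by (intro tendsto_intros lp gap kappa_bounds(1) log_pt_cball log_scale) auto
qed

lemma approx_seq: 
  defines "s \<equiv> \<lambda>n::nat. 1 - 1 / real (Suc n)"
  shows "s \<longlonglongrightarrow> 1" "0 \<le> s n" "s n < 1"
proof -
  have "(\<lambda>n. 1 - 1 / real (Suc n)) \<longlonglongrightarrow> 1 - 0"
    by (intro tendsto_diff tendsto_const LIMSEQ_Suc lim_1_over_n)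
  thus "s \<longlonglongrightarrow> 1" by (simp add: s_def)
qed (auto simp: s_def)

lemma expansion:
  assumes r: "0 \<le> r" "r \<le> 1"
  shows "expansion_const * dist a b \<le> dist (log_ext r a) (log_ext r b)"
proof (cases "r = 1")
  case True
  have "(\<lambda>n. dist (log_ext (1 - 1 / real (Suc n)) a) (log_ext (1 - 1 / real (Suc n)) b)) \<longlonglongrightarrow> dist (log_ext 1 a) (log_ext 1 b)"
    by (intro tendsto_dist log_ext_tendsto approx_seq less_imp_le[OF approx_seq(3)])
  thus ?thesis unfolding True
    by (rule LIMSEQ_le_const) (use expansion_lt_1 approx_seq(2,3) in blast)
qed (use expansion_lt_1 r in auto)

lemma Lipschitz_log_ext:
  assumes r: "0 \<le> r" "r \<le> 1"
  shows "dist (log_ext r a) (log_ext r b) \<le> 2 * M / kappa_min * dist a b"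
proof (cases "r = 1")
  case True
  have "(\<lambda>n. dist (log_ext (1 - 1 / real (Suc n)) a) (log_ext (1 - 1 / real (Suc n)) b)) \<longlonglongrightarrow> dist (log_ext 1 a) (log_ext 1 b)"
    by (intro tendsto_dist log_ext_tendsto approx_seq less_imp_le[OF approx_seq(3)])
  thus ?thesis unfolding True
    by (rule LIMSEQ_le_const2) (use Lipschitz_log_ext_aux[folded dist_norm] approx_seq(2,3) in blast)
qed (use Lipschitz_log_ext_aux[folded dist_norm] r in auto)

text \<open>Global expansion is local expansion with any radius, here 1, so the covering argument
  applies at r = 1 as well.\<close>

lemma log_ext_surj:
  assumes r: "0 \<le> r" "r \<le> 1"
  shows "range (log_ext r) = UNIV"
  using locally_expanding_imp_covering[OF continuous_log_ext[OF r] const_pos(4) zero_less_one expansion[OF r]]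
  by (rule covering_space_imp_surjective)

lemma log_ext_inj:
  assumes r: "0 \<le> r" "r \<le> 1"
  shows "inj (log_ext r)"
proof (rule injI)
  fix x y assume "log_ext r x = log_ext r y"
  thus "x = y" using expansion[OF r, of x y] const_pos(4) by (simp add: mult_le_0_iff)
qed

end

subsection \<open>The extension in the plane\<close>

text \<open>Shifting both exponents by the larger real part moves them into the left
  half-plane.\<close>

lemma norm_exp_diff_le':
  fixes a b :: complex
  assumes "norm (exp a) \<le> B" "norm (exp b) \<le> B"
  shows "norm (exp a - exp b) \<le> B * norm (a - b)"
proof -
  define s where "s = max (Re a) (Re b)"
  have "exp a - exp b = exp (of_real s) * (exp (a - of_real s) - exp (b - of_real s))"
    by (simp add: exp_diff right_diff_distrib)
  also have "norm \<dots> = exp s * norm (exp (a - of_real s) - exp (b - of_real s))"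
    by (simp add: norm_mult)
  also have "\<dots> \<le> exp s * norm (a - b)"
    using norm_exp_diff_le[of "a - of_real s" "b - of_real s"] by (intro mult_left_mono) (auto simp: s_def)
  also have "\<dots> \<le> B * norm (a - b)"
    using assms by (intro mult_right_mono) (auto simp: s_def max_def)
  finally show ?thesis .
qed

text \<open>This and \<open>scale\<close> are the planar counterparts of \<open>log_pt\<close> and
  \<open>log_scale\<close>, defined also at the origin.\<close>

definition disc_pt :: "real \<Rightarrow> complex \<Rightarrow> complex" where
  "disc_pt r z = of_real r * (z / of_real (max 1 (norm z)))"

definition scale :: "complex \<Rightarrow> real" where "scale z = 1 / max 1 (norm z)"

lemma scale: "0 < scale z" "0 \<le> scale z" "scale z \<le> 1"
  by (auto simp: scale_def divide_simps)

lemma norm_disc_pt_le: "0 \<le> r \<Longrightarrow> norm (disc_pt r z) \<le> r"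
proof -
  assume r: "0 \<le> r"
  have "norm (z / of_real (max 1 (norm z))) = norm z / max 1 (norm z)"
    unfolding norm_divide norm_of_real by (subst abs_of_nonneg) auto
  also have "\<dots> \<le> 1" by (simp add: divide_le_eq)
  finally have "r * norm (z / of_real (max 1 (norm z))) \<le> r" using r by (simp add: mult_left_le)
  moreover have "norm (disc_pt r z) = r * norm (z / of_real (max 1 (norm z)))"
    unfolding disc_pt_def norm_mult using r by simp
  ultimately show ?thesis by simp
qed

lemma disc_pt_ball: "0 \<le> r \<Longrightarrow> r < 1 \<Longrightarrow> disc_pt r z \<in> ball 0 1"
  and disc_pt_cball: "0 \<le> r \<Longrightarrow> r \<le> 1 \<Longrightarrow> disc_pt r z \<in> cball 0 1"
  using norm_disc_pt_le[of r z] by auto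

lemma continuous_disc_pt: "continuous_on UNIV (disc_pt r)"
  unfolding disc_pt_def by (intro continuous_intros) (auto simp: max_def)

lemma continuous_scale: "continuous_on UNIV scale"
  unfolding scale_def by (intro continuous_intros) (auto simp: max_def)

context chain_data begin

lemma log_pt_Ln: "z \<noteq> 0 \<Longrightarrow> log_pt r (Ln z) = disc_pt r z" and log_scale_Ln: "z \<noteq> 0 \<Longrightarrow> log_scale (Ln z) = scale z"
proof -
  assume z: "z \<noteq> 0"
  have ln: "max 1 (norm z) = exp (max (ln (norm z)) 0)"
    using z by (auto simp: max_def not_le ln_less_zero)
  have "exp (clip (Ln z)) = exp (Ln z - of_real (max (Re (Ln z)) 0))"
    by (rule arg_cong[of _ _ exp]) (auto simp: clip_def complex_eq_iff)
  also have "\<dots> = z / of_real (max 1 (norm z))"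
    unfolding ln using z by (simp add: exp_diff exp_of_real)
  finally show "log_pt r (Ln z) = disc_pt r z" by (simp add: log_pt_def disc_pt_def)
  show "log_scale (Ln z) = scale z"
    unfolding log_scale_def scale_def ln using z by (simp add: exp_minus inverse_eq_divide)
qed

text \<open>The principal logarithm is only one choice: by \<open>log_ext_periodic\<close> another
  one changes \<open>log_ext\<close> by c times a period of \<open>exp\<close>, which the division
  by c makes harmless.\<close>

definition qc_ext :: "real \<Rightarrow> complex \<Rightarrow> complex" where
  "qc_ext r z = (if z = 0 then 0 else exp (log_ext r (Ln z) / c))"

lemma log_ext_periodic: "log_ext r (\<zeta> + of_int (2 * n) * (of_real pi * \<i>)) = log_ext r \<zeta> + c * (of_int (2 * n) * (of_real pi * \<i>))"
proof -
  define p where "p = of_int (2 * n) * (complex_of_real pi * \<i>)"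
  have p: "Re p = 0" "exp p = 1" by (simp add: p_def) (auto simp: p_def exp_eq_1 mult_ac)
  have "clip (\<zeta> + p) = clip \<zeta> + p" using p by (simp add: clip_def complex_eq_iff)
  moreover from this have "log_pt r (\<zeta> + p) = log_pt r \<zeta>" using p by (simp add: log_pt_def exp_add)
  moreover have "log_scale (\<zeta> + p) = log_scale \<zeta>" using p by (simp add: log_scale_def)
  ultimately have "log_ext r (\<zeta> + p) = log_ext r \<zeta> + c * p" using p by (simp add: log_ext_def algebra_simps)
  thus ?thesis by (simp add: p_def)
qed

lemma qc_ext_exp: "qc_ext r (exp \<zeta>) = exp (log_ext r \<zeta> / c)"
proof -
  have "exp (Ln (exp \<zeta>)) = exp \<zeta>" by simp
  then obtain n where n: "Ln (exp \<zeta>) = \<zeta> + of_int (2 * n) * (of_real pi * \<i>)"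
    unfolding exp_eq by (auto simp: mult_ac)
  have "qc_ext r (exp \<zeta>) = exp (log_ext r \<zeta> / c + of_int (2 * n) * (of_real pi * \<i>))"
    unfolding qc_ext_def n log_ext_periodic using c_nz by (simp add: add_divide_distrib)
  also have "\<dots> = exp (log_ext r \<zeta> / c)" unfolding exp_eq by (auto simp: mult_ac)
  finally show ?thesis .
qed

section \<open>Growth and Lipschitz bounds uniform in r\<close>

lemma log_ext_left_bound:
  obtains B where "\<And>r \<zeta>. 0 \<le> r \<Longrightarrow> r \<le> 1 \<Longrightarrow> Re \<zeta> \<le> 0 \<Longrightarrow> norm (log_ext r \<zeta> - c * \<zeta>) \<le> B"
proof -
  have "continuous_on (cball 0 1) (\<lambda>x. l x + Ln c + Ln (K x))"
    by (intro continuous_intros l_cont K_cont K_slit)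
  hence "compact ((\<lambda>x. l x + Ln c + Ln (K x)) ` cball 0 1)"
    by (rule compact_continuous_image) simp
  then obtain B where B: "\<And>x. x \<in> cball 0 1 \<Longrightarrow> norm (l x + Ln c + Ln (K x)) \<le> B"
    using compact_imp_bounded by (force simp: bounded_iff)
  show ?thesis
  proof (rule that)
    fix r \<zeta> assume r: "0 \<le> (r::real)" "r \<le> 1" and \<zeta>: "Re \<zeta> \<le> 0"
    have "log_ext r \<zeta> - c * \<zeta> = l (log_pt r \<zeta>) + Ln c + Ln (K (log_pt r \<zeta>))"
      using \<zeta> by (simp add: log_ext_eq_log_ext_in log_ext_in_def log_pt_def clip_eq)
    thus "norm (log_ext r \<zeta> - c * \<zeta>) \<le> B" using B[OF log_pt_cball[OF r]] by simp
  qed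
qed

text \<open>On the left half-plane \<open>log_ext\<close> differs from c \<zeta> by a bounded
  amount; on the right the Lipschitz bound compares \<zeta> with its retraction. So log |F| exceeds
  log |z| by at most a constant.\<close>

lemma qc_ext_bound:
  obtains C where "C > 0" "\<And>r z. 0 \<le> r \<Longrightarrow> r \<le> 1 \<Longrightarrow> norm z \<le> R \<Longrightarrow> norm (qc_ext r z) \<le> C * norm z"
proof -
  obtain B where B: "\<And>r \<zeta>. 0 \<le> r \<Longrightarrow> r \<le> 1 \<Longrightarrow> Re \<zeta> \<le> 0 \<Longrightarrow> norm (log_ext r \<zeta> - c * \<zeta>) \<le> B"
    by (rule log_ext_left_bound) blast
  define L where "L = 2 * M / kappa_min"
  have L: "L \<ge> 0" using mM kappa_min by (simp add: L_def)
  define S where "S = max (ln (max R 1)) 0"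
  define C where "C = exp ((B + L * S) / norm c)"
  show ?thesis
  proof (rule that[of C])
    show "C > 0" by (simp add: C_def)
    fix r z assume r: "0 \<le> (r::real)" "r \<le> 1" and zR: "norm (z::complex) \<le> R"
    show "norm (qc_ext r z) \<le> C * norm z"
    proof (cases "z = 0")
      case False
      define \<zeta> where "\<zeta> = Ln z"
      have Re\<zeta>: "Re \<zeta> = ln (norm z)" using False by (simp add: \<zeta>_def)
      have d: "dist \<zeta> (clip \<zeta>) \<le> S"
      proof -
        have "\<zeta> - clip \<zeta> = of_real (max (Re \<zeta>) 0)" by (auto simp: clip_def complex_eq_iff)
        hence "dist \<zeta> (clip \<zeta>) = max (Re \<zeta>) 0" by (simp add: dist_norm)
        also have "Re \<zeta> \<le> ln (max R 1)" unfolding Re\<zeta> using False zR by (subst ln_le_cancel_iff) auto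
        hence "max (Re \<zeta>) 0 \<le> S" by (auto simp: S_def)
        finally show ?thesis .
      qed
      have "norm (log_ext r \<zeta> - c * clip \<zeta>) \<le> dist (log_ext r \<zeta>) (log_ext r (clip \<zeta>)) + norm (log_ext r (clip \<zeta>) - c * clip \<zeta>)"
        unfolding dist_norm by (metis diff_add_cancel norm_triangle_ineq add_diff_eq)
      also have "\<dots> \<le> L * dist \<zeta> (clip \<zeta>) + B"
        using Lipschitz_log_ext[OF r] B[OF r clip_le] unfolding L_def by (rule add_mono)
      also have "\<dots> \<le> L * S + B" using d L by (intro add_right_mono mult_left_mono) auto
      finally have "norm (log_ext r \<zeta> - c * clip \<zeta>) / norm c \<le> (B + L * S) / norm c"
        by (simp add: add.commute divide_right_mono)
      moreover have "log_ext r \<zeta> / c - clip \<zeta> = (log_ext r \<zeta> - c * clip \<zeta>) / c"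
        using c_nz by (simp add: field_simps)
      ultimately have "norm (log_ext r \<zeta> / c - clip \<zeta>) \<le> (B + L * S) / norm c"
        by (simp only: norm_divide)
      hence "Re (log_ext r \<zeta> / c - clip \<zeta>) \<le> (B + L * S) / norm c"
        using complex_Re_le_cmod order_trans by blast
      moreover have "Re (clip \<zeta>) \<le> ln (norm z)" by (simp add: clip_def Re\<zeta>)
      ultimately have "Re (log_ext r \<zeta> / c) \<le> (B + L * S) / norm c + ln (norm z)" by simp
      hence "exp (Re (log_ext r \<zeta> / c)) \<le> C * norm z"
        using False by (metis C_def exp_add exp_le_cancel_iff exp_ln zero_less_norm_iff)
      thus ?thesis using False by (simp add: qc_ext_def \<zeta>_def[symmetric])
    qed (simp add: qc_ext_def)
  qed
qed

text \<open>Points whose distance is comparable to |z| are handled by the linear growth bound. For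
  closer points w = z (1 + u) the logarithms differ by at most 2 |u|, and the factor |z| from the
  growth bound cancels the denominator of u.\<close>

lemma qc_ext_Lipschitz:
  obtains C where "C > 0" "\<And>r z w. 0 \<le> r \<Longrightarrow> r \<le> 1 \<Longrightarrow> norm z \<le> R \<Longrightarrow> norm w \<le> R \<Longrightarrow>
    norm (qc_ext r z - qc_ext r w) \<le> C * norm (z - w)"
proof -
  obtain C where C: "C > 0" "\<And>r z. 0 \<le> r \<Longrightarrow> r \<le> 1 \<Longrightarrow> norm z \<le> R \<Longrightarrow> norm (qc_ext r z) \<le> C * norm z"
    by (rule qc_ext_bound[of R]) blast
  define L where "L = 2 * M / kappa_min"
  have L: "L > 0" using mM kappa_min by (simp add: L_def)
  define D where "D = max (4 * C) (2 * C * L / norm c)"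
  have ord: "norm (qc_ext r z - qc_ext r w) \<le> D * norm (z - w)"
    if r: "0 \<le> r" "r \<le> 1" and z: "norm z \<le> R" and w: "norm w \<le> R" "norm w \<le> norm z" for r z w
  proof (cases "norm (z - w) < norm z / 2")
    case False
    have "norm (qc_ext r z - qc_ext r w) \<le> norm (qc_ext r z) + norm (qc_ext r w)" by (rule norm_triangle_ineq4)
    also have "\<dots> \<le> C * norm z + C * norm z"
      using C(2)[OF r z] C(2)[OF r w(1)] mult_left_mono[OF w(2), of C] C(1) by linarith
    also have "\<dots> \<le> 4 * C * norm (z - w)" using False C(1) by simp
    also have "\<dots> \<le> D * norm (z - w)" by (intro mult_right_mono) (auto simp: D_def)
    finally show ?thesis .
  next
    case True
    have z0: "z \<noteq> 0" using True by auto
    define u where "u = (w - z) / z"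
    have u: "norm u < 1 / 2" using True z0 by (simp add: u_def norm_divide divide_simps norm_minus_commute)
    define \<delta> where "\<delta> = Ln (1 + u)"
    have "norm \<delta> \<le> 2 * norm u" unfolding \<delta>_def by (rule norm_Ln_le[OF u])
    have "1 + u \<noteq> 0" using u by (metis add_eq_0_iff norm_minus_cancel norm_one less_divide_eq_1_pos not_less_iff_gr_or_eq one_less_numeral_iff semiring_norm(76) zero_less_numeral)
    hence "exp (Ln z + \<delta>) = z * (1 + u)" using z0 by (simp add: exp_add \<delta>_def)
    also have "\<dots> = w" using z0 by (simp add: u_def field_simps)
    finally have ew: "w = exp (Ln z + \<delta>)" by simp
    have ez: "z = exp (Ln z)" using z0 by simp
    have Fw: "qc_ext r w = exp (log_ext r (Ln z + \<delta>) / c)" by (subst ew) (rule qc_ext_exp)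
    have Fz: "qc_ext r z = exp (log_ext r (Ln z) / c)" using z0 by (simp add: qc_ext_def)
    have "norm (qc_ext r z - qc_ext r w) \<le> (C * norm z) * norm (log_ext r (Ln z) / c - log_ext r (Ln z + \<delta>) / c)"
      unfolding Fw Fz
    proof (rule norm_exp_diff_le')
      show "norm (exp (log_ext r (Ln z) / c)) \<le> C * norm z" using C(2)[OF r z] by (simp add: Fz)
      have "norm (qc_ext r w) \<le> C * norm z"
        using C(2)[OF r w(1)] mult_left_mono[OF w(2), of C] C(1) by linarith
      thus "norm (exp (log_ext r (Ln z + \<delta>) / c)) \<le> C * norm z" by (simp only: Fw)
    qed
    also have "norm (log_ext r (Ln z) / c - log_ext r (Ln z + \<delta>) / c) = norm (log_ext r (Ln z) - log_ext r (Ln z + \<delta>)) / norm c"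
      by (simp only: diff_divide_distrib[symmetric] norm_divide)
    also have "\<dots> \<le> L * norm \<delta> / norm c"
      using Lipschitz_log_ext[OF r, of "Ln z" "Ln z + \<delta>"]
      by (intro divide_right_mono) (auto simp: dist_norm L_def)
    also have "L * norm \<delta> / norm c \<le> L * (2 * norm u) / norm c"
      using \<open>norm \<delta> \<le> _\<close> L by (intro divide_right_mono mult_left_mono) auto
    also have "(C * norm z) * (L * (2 * norm u) / norm c) = (2 * C * L / norm c) * (norm z * norm u)"
      by simp
    also have "norm z * norm u = norm (z - w)" using z0 by (simp add: u_def norm_divide norm_minus_commute)
    also have "(2 * C * L / norm c) * norm (z - w) \<le> D * norm (z - w)"
      by (intro mult_right_mono) (auto simp: D_def)
    finally show ?thesis using C(1) by (simp add: mult_left_mono)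
  qed
  show ?thesis
  proof (rule that[of D])
    show "D > 0" using C(1) by (simp add: D_def)
    fix r :: real and z w :: complex
    assume "0 \<le> r" "r \<le> 1" "norm z \<le> R" "norm w \<le> R"
    thus "norm (qc_ext r z - qc_ext r w) \<le> D * norm (z - w)"
      using ord[of r z w] ord[of r w z] by (cases "norm w \<le> norm z") (auto simp: norm_minus_commute)
  qed
qed

lemma continuous_qc_ext:
  assumes r: "0 \<le> r" "r \<le> 1"
  shows "continuous_on UNIV (qc_ext r)"
proof (rule continuous_at_imp_continuous_on, rule ballI)
  fix z :: complex
  obtain C where C: "C > 0" "\<And>r y w. 0 \<le> r \<Longrightarrow> r \<le> 1 \<Longrightarrow> norm y \<le> norm z + 1 \<Longrightarrow> norm w \<le> norm z + 1 \<Longrightarrow>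
      norm (qc_ext r y - qc_ext r w) \<le> C * norm (y - w)"
    by (rule qc_ext_Lipschitz[of "norm z + 1"]) blast
  have "continuous_on (ball z 1) (qc_ext r)"
  proof (rule lipschitz_on_continuous_on[of C], rule lipschitz_onI)
    fix x y assume "x \<in> ball z 1" "y \<in> ball z 1"
    hence "norm x \<le> norm z + 1" "norm y \<le> norm z + 1"
      using norm_triangle_ineq2[of x z] norm_triangle_ineq2[of y z] by (auto simp: dist_norm norm_minus_commute)
    from C(2)[OF r this] show "dist (qc_ext r x) (qc_ext r y) \<le> C * dist x y" by (simp add: dist_norm)
  qed (use C in auto)
  thus "isCont (qc_ext r) z" by (simp add: continuous_on_eq_continuous_at)
qed

lemma qc_ext_tendsto:
  assumes s: "s \<longlonglongrightarrow> 1" "\<And>n. 0 \<le> s n" "\<And>n. s n \<le> 1"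
  shows "(\<lambda>n. qc_ext (s n) z) \<longlonglongrightarrow> qc_ext 1 z"
  using log_ext_tendsto[OF s] c_nz by (auto simp: qc_ext_def intro!: tendsto_intros)

text \<open>Equal exponentials mean that two values of \<open>log_ext\<close> differ by c times a
  period; the period moves into the argument, where injectivity is known.\<close>

lemma qc_ext_inj: "inj (qc_ext 1)"
proof (rule injI)
  fix x y assume xy: "qc_ext 1 x = qc_ext 1 y"
  show "x = y"
  proof (cases "x = 0 \<or> y = 0")
    case True
    thus ?thesis using xy by (auto simp: qc_ext_def split: if_splits)
  next
    case False
    then obtain n :: int where "log_ext 1 (Ln x) / c = log_ext 1 (Ln y) / c + (of_int (2 * n) * pi) * \<i>"
      using xy by (auto simp: qc_ext_def exp_eq)
    hence "log_ext 1 (Ln x) = log_ext 1 (Ln y) + c * (of_int (2 * n) * (of_real pi * \<i>))"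
      using c_nz by (simp add: field_simps)
    hence "log_ext 1 (Ln x) = log_ext 1 (Ln y + of_int (2 * n) * (of_real pi * \<i>))" by (simp only: log_ext_periodic)
    hence "Ln x = Ln y + of_int (2 * n) * (of_real pi * \<i>)" using log_ext_inj[of 1] by (simp add: inj_eq)
    hence "exp (Ln x) = exp (Ln y)" unfolding exp_eq by (auto simp: mult_ac)
    thus ?thesis using False by simp
  qed
qed

lemma qc_ext_surj: "range (qc_ext 1) = UNIV"
proof -
  have "\<exists>x. qc_ext 1 x = y" for y
  proof (cases "y = 0")
    case True
    thus ?thesis by (intro exI[of _ 0]) (simp add: qc_ext_def)
  next
    case False
    obtain \<zeta> where "log_ext 1 \<zeta> = c * Ln y" using log_ext_surj[of 1] by (metis order_refl surjE zero_le_one)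
    hence "qc_ext 1 (exp \<zeta>) = y" using False c_nz by (simp add: qc_ext_exp)
    thus ?thesis by blast
  qed
  thus ?thesis by (metis surj_def)
qed

lemma qc_ext_disc: "norm z < 1 \<Longrightarrow> qc_ext 1 z = z * exp ((l z + Ln c + Ln (K z)) / c)"
proof (cases "z = 0")
  case False
  assume z: "norm z < 1"
  hence "Re (Ln z) \<le> 0" using False by (simp add: ln_le_zero_iff less_imp_le)
  hence "log_ext 1 (Ln z) = c * Ln z + (l z + Ln c + Ln (K z))"
    using False by (simp add: log_ext_eq_log_ext_in log_ext_in_def)
  thus ?thesis using False c_nz by (simp add: qc_ext_def add_divide_distrib exp_add)
qed (simp add: qc_ext_def)

section \<open>The Wirtinger derivatives of the extension\<close>

definition radial :: "real \<Rightarrow> complex \<Rightarrow> complex" where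
  "radial r z = (if norm z < 1 then angular (disc_pt r z) (scale z) else 1)"

text \<open>With u = v / z, the numerator e Re u + \<i> w Im u of the differential equals (e + w) /
  2 times u plus (e - w) / 2 times the conjugate of u. This gives the half sums here and in
  \<open>ext_zbar\<close>, and the factors 1 / z and \<open>1 / cnj z\<close>.\<close>

definition ext_z :: "real \<Rightarrow> complex \<Rightarrow> complex" where
  "ext_z r z = qc_ext r z / z / (c * kappa (disc_pt r z) (scale z)) * ((radial r z + angular (disc_pt r z) (scale z)) / 2)"

definition ext_zbar :: "real \<Rightarrow> complex \<Rightarrow> complex" where
  "ext_zbar r z = qc_ext r z / cnj z / (c * kappa (disc_pt r z) (scale z)) * ((radial r z - angular (disc_pt r z) (scale z)) / 2)"

text \<open>The excluded points are the cut of \<open>Ln\<close> and the circle on which the two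
  formulas meet, together a null set.\<close>

lemma qc_ext_derivative:
  assumes r: "0 \<le> r" "r < 1" and z: "z \<notin> \<real>\<^sub>\<le>\<^sub>0" "norm z \<noteq> 1"
  shows "(qc_ext r has_derivative (\<lambda>v. ext_z r z * v + ext_zbar r z * cnj v)) (at z)"
proof -
  have z0: "z \<noteq> 0" using z by auto
  define \<zeta> where "\<zeta> = Ln z"
  have Re: "Re \<zeta> = ln (norm z)" using z0 by (simp add: \<zeta>_def)
  have wk: "log_angular r \<zeta> = angular (disc_pt r z) (scale z)" "log_kappa r \<zeta> = kappa (disc_pt r z) (scale z)"
    using z0 by (simp_all add: log_angular_def log_kappa_def \<zeta>_def log_pt_Ln log_scale_Ln)
  have dE: "(log_ext r has_derivative dlog_ext r (radial r z) \<zeta>) (at \<zeta>)"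
  proof (cases "norm z < 1")
    case True
    hence neg: "Re \<zeta> < 0" using z0 by (simp add: Re ln_less_zero)
    have "norm (of_real r * exp \<zeta>) < 1" using log_pt_ball[OF r, of \<zeta>] neg by (simp add: log_pt_def clip_eq)
    from log_ext_in_deriv[OF this, unfolded has_field_derivative_def]
    have "(log_ext_in r has_derivative (*) (h (of_real r * exp \<zeta>) / K (of_real r * exp \<zeta>))) (at \<zeta>)" .
    also have "(*) (h (of_real r * exp \<zeta>) / K (of_real r * exp \<zeta>)) = dlog_ext r (radial r z) \<zeta>"
    proof
      fix v
      have "v = of_real (Re v) + \<i> * of_real (Im v)" by (rule complex_eq)
      moreover have "radial r z = log_angular r \<zeta>" using True by (simp add: radial_def wk)
      ultimately show "h (of_real r * exp \<zeta>) / K (of_real r * exp \<zeta>) * v = dlog_ext r (radial r z) \<zeta> v"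
        using neg by (simp add: dlog_ext_def left_eqs) (metis distrib_left mult.assoc mult.left_commute)
    qed
    finally show ?thesis
    proof (rule has_derivative_transform_within_open[where s = "{x. Re x < 0}"])
      show "open {x. Re x < 0}" by (rule open_halfspace_Re_lt)
    qed (use neg log_ext_eq_log_ext_in in auto)
  next
    case False
    hence pos: "Re \<zeta> > 0" using z by (simp add: Re ln_gt_zero)
    have "(log_ext_out r has_derivative dlog_ext r (radial r z) \<zeta>) (at \<zeta>)"
      using log_ext_out_deriv[OF r, of \<zeta>] pos False by (simp add: radial_def)
    thus ?thesis
    proof (rule has_derivative_transform_within_open[where s = "{x. Re x > 0}"])
      show "open {x. Re x > 0}" by (rule open_halfspace_Re_gt)
    qed (use pos log_ext_eq_log_ext_out in auto)
  qed
  have "(Ln has_derivative (*) (inverse z)) (at z)"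
    using has_field_derivative_Ln[OF z(1)] by (simp add: has_field_derivative_def)
  from has_derivative_compose[OF this, folded \<zeta>_def, OF dE]
  have d1: "((\<lambda>z. log_ext r (Ln z)) has_derivative (\<lambda>v. dlog_ext r (radial r z) \<zeta> (inverse z * v))) (at z)" .
  have "((\<lambda>u. exp (u / c)) has_field_derivative (exp (log_ext r (Ln z) / c) / c)) (at (log_ext r (Ln z)))"
    using c_nz by (auto intro!: derivative_eq_intros)
  from has_derivative_compose[OF d1 this[unfolded has_field_derivative_def]]
  have "((\<lambda>z. exp (log_ext r (Ln z) / c)) has_derivative (\<lambda>v. qc_ext r z / c * dlog_ext r (radial r z) \<zeta> (inverse z * v))) (at z)"
    using z0 by (simp add: qc_ext_def)
  also have "(\<lambda>v. qc_ext r z / c * dlog_ext r (radial r z) \<zeta> (inverse z * v)) = (\<lambda>v. ext_z r z * v + ext_zbar r z * cnj v)"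
  proof
    fix v
    define u where "u = inverse z * v"
    have u: "of_real (Re u) = (u + cnj u) / 2" "\<i> * of_real (Im u) = (u - cnj u) / 2"
      by (simp_all add: complex_eq_iff)
    define e w where "e = radial r z" and "w = log_angular r \<zeta>"
    have "e * of_real (Re u) + \<i> * w * of_real (Im u) = e * of_real (Re u) + w * (\<i> * of_real (Im u))"
      by (simp add: mult_ac)
    also have "\<dots> = (e + w) / 2 * u + (e - w) / 2 * cnj u"
      unfolding u by (simp add: field_simps)
    finally have "qc_ext r z / c * dlog_ext r e \<zeta> u = qc_ext r z / c * (((e + w) / 2 * u + (e - w) / 2 * cnj u) / log_kappa r \<zeta>)"
      by (simp add: dlog_ext_def w_def)
    also have "\<dots> = ext_z r z * v + ext_zbar r z * cnj v"
      using z0 c_nz by (simp add: ext_z_def ext_zbar_def wk u_def e_def w_def divide_simps) (simp add: algebra_simps)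
    finally show "qc_ext r z / c * dlog_ext r (radial r z) \<zeta> (inverse z * v) = ext_z r z * v + ext_zbar r z * cnj v"
      by (simp add: e_def u_def)
  qed
  finally show ?thesis
  proof (rule has_derivative_transform_within_open[where s = "- \<real>\<^sub>\<le>\<^sub>0"])
    fix x :: complex assume "x \<in> - \<real>\<^sub>\<le>\<^sub>0"
    hence "x \<noteq> 0" by auto
    thus "exp (log_ext r (Ln x) / c) = qc_ext r x" by (simp add: qc_ext_def)
  qed (use z in \<open>auto intro: open_Compl\<close>)
qed

lemma angular_disc_pt_U: "0 \<le> r \<Longrightarrow> r < 1 \<Longrightarrow> angular (disc_pt r z) (scale z) \<in> U k"
  by (intro angular_U disc_pt_ball scale)

text \<open>Inside the disc \<open>radial\<close> equals w and the left side vanishes; elsewhere it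
  is 1 and the claim is \<open>U_norm_le\<close>.\<close>

lemma ext_zbar_le_ext_z:
  assumes r: "0 \<le> r" "r < 1"
  shows "norm (ext_zbar r z) \<le> k * norm (ext_z r z)"
proof -
  define w where "w = angular (disc_pt r z) (scale z)"
  have w: "w \<in> U k" unfolding w_def by (rule angular_disc_pt_U[OF r])
  have *: "norm (radial r z - w) \<le> k * norm (radial r z + w)"
    using U_norm_le[OF w] k by (auto simp: radial_def w_def)
  define X where "X = norm (qc_ext r z) / norm z / (norm c * norm (kappa (disc_pt r z) (scale z))) / 2"
  have "norm (ext_zbar r z) = X * norm (radial r z - w)" "norm (ext_z r z) = X * norm (radial r z + w)"
    by (simp_all add: ext_z_def ext_zbar_def X_def norm_mult norm_divide w_def)
  moreover have "X * norm (radial r z - w) \<le> X * (k * norm (radial r z + w))"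
    using * by (intro mult_left_mono) (auto simp: X_def)
  ultimately show ?thesis by (simp add: mult_ac)
qed

text \<open>The linear growth bound cancels the factor 1 / z, so the bound holds up to the origin
  and uniformly in r, as dominated convergence will require.\<close>

lemma ext_z_bound:
  obtains C where "\<And>r z. 0 \<le> r \<Longrightarrow> r < 1 \<Longrightarrow> norm z \<le> R \<Longrightarrow> norm (ext_z r z) \<le> C"
proof -
  obtain C where C: "C > 0" "\<And>r z. 0 \<le> r \<Longrightarrow> r \<le> 1 \<Longrightarrow> norm z \<le> R \<Longrightarrow> norm (qc_ext r z) \<le> C * norm z"
    by (rule qc_ext_bound[of R]) blast
  show ?thesis
  proof (rule that)
    fix r z assume r: "0 \<le> (r::real)" "r < 1" and z: "norm (z::complex) \<le> R"
    define w where "w = angular (disc_pt r z) (scale z)"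
    have w: "norm w \<le> M" unfolding w_def by (rule U_upper[OF angular_disc_pt_U[OF r]])
    have e: "norm (radial r z) \<le> M" using w mM(3) by (simp add: radial_def w_def)
    have kk: "kappa_min \<le> norm (kappa (disc_pt r z) (scale z))" using r by (intro kappa_bounds(2) disc_pt_cball scale) auto
    have "norm (ext_z r z) = norm (qc_ext r z / z) / (norm c * norm (kappa (disc_pt r z) (scale z))) * (norm (radial r z + w) / 2)"
      by (simp add: ext_z_def norm_mult norm_divide w_def)
    also have "\<dots> \<le> C / (norm c * kappa_min) * ((M + M) / 2)"
    proof (intro mult_mono frac_le divide_right_mono)
      show "norm (qc_ext r z / z) \<le> C" using C(2)[of r z] r z C(1) by (cases "z = 0") (auto simp: norm_divide divide_simps)
      show "norm (radial r z + w) \<le> M + M" using e w norm_triangle_ineq[of "radial r z" w] by linarith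
    qed (use C kappa_min c_nz kk mM(3) in auto)
    finally show "norm (ext_z r z) \<le> C / (norm c * kappa_min) * ((M + M) / 2)" .
  qed
qed

end

subsection \<open>Weak derivatives of locally Lipschitz maps\<close>

lemma continuous_bounded_on_cball:
  fixes f :: "complex \<Rightarrow> complex"
  assumes "continuous_on UNIV f"
  obtains B where "B \<ge> 0" "\<And>z. norm z \<le> R \<Longrightarrow> norm (f z) \<le> B"
proof -
  have "bounded (f ` cball 0 R)"
    by (rule compact_imp_bounded[OF
          compact_continuous_image[OF continuous_on_subset[OF assms subset_UNIV] compact_cball]])
  then obtain B where B: "\<forall>y\<in>f ` cball 0 R. norm y \<le> B"
    unfolding bounded_iff by blast
  show ?thesis by (rule that[of "max B 0"]) (use B in \<open>force simp: le_max_iff_disj\<close>)+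
qed

lemma test_function_facts:
  assumes "test_function G \<phi>"
  obtains R C where "R > 0" "C \<ge> 0"
    "\<And>z. norm z > R \<Longrightarrow> \<phi> z = 0 \<and> partial_x \<phi> z = 0 \<and> partial_y \<phi> z = 0"
    "continuous_on UNIV \<phi>" "continuous_on UNIV (partial_x \<phi>)" "continuous_on UNIV (partial_y \<phi>)"
    "\<And>z. (\<phi> has_derivative (\<lambda>v. of_real (Re v) * partial_x \<phi> z + of_real (Im v) * partial_y \<phi> z)) (at z)"
    "\<And>z w. norm (\<phi> z - \<phi> w) \<le> C * norm (z - w)"
proof -
  have Ck: "\<And>n. C_k n \<phi>" and cs: "compact (closure {z. \<phi> z \<noteq> 0})"
    using assms by (auto simp: test_function_def)
  have cont: "continuous_on UNIV \<phi>" using Ck[of 0] by simp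
  have px: "continuous_on UNIV (partial_x \<phi>)" and py: "continuous_on UNIV (partial_y \<phi>)"
    and diff: "\<And>z. \<phi> differentiable (at z)"
    using Ck[of "Suc 0"] by simp_all
  obtain R where R: "R > 0" "closure {z. \<phi> z \<noteq> 0} \<subseteq> ball 0 R"
    using bounded_subset_ballD[OF compact_imp_bounded[OF cs]] by blast
  have zero: "\<phi> z = 0" if "norm z \<ge> R" for z
    using R(2) that closure_subset[of "{z. \<phi> z \<noteq> 0}"] by force
  have der: "(\<phi> has_derivative (\<lambda>v. of_real (Re v) * partial_x \<phi> z + of_real (Im v) * partial_y \<phi> z)) (at z)" for z
  proof -
    have d: "(\<phi> has_derivative frechet_derivative \<phi> (at z)) (at z)"
      using diff frechet_derivative_works by blast
    then interpret bounded_linear "frechet_derivative \<phi> (at z)" by (rule has_derivative_bounded_linear)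
    have "frechet_derivative \<phi> (at z) v = of_real (Re v) * partial_x \<phi> z + of_real (Im v) * partial_y \<phi> z" for v
    proof -
      have "v = Re v *\<^sub>R 1 + Im v *\<^sub>R \<i>" by (simp add: complex_eq_iff)
      hence "frechet_derivative \<phi> (at z) v = frechet_derivative \<phi> (at z) (Re v *\<^sub>R 1 + Im v *\<^sub>R \<i>)" by simp
      also have "\<dots> = Re v *\<^sub>R partial_x \<phi> z + Im v *\<^sub>R partial_y \<phi> z"
        unfolding partial_x_def partial_y_def by (simp only: add scaleR)
      finally show ?thesis by (simp add: scaleR_conv_of_real)
    qed
    thus ?thesis using d by presburger
  qed
  have dzero: "partial_x \<phi> z = 0 \<and> partial_y \<phi> z = 0" if "norm z > R" for z
  proof -
    have "(\<phi> has_derivative (\<lambda>v. 0)) (at z)"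
    proof (rule has_derivative_transform_within_open[where s = "- cball 0 R" and f = "\<lambda>_. 0"])
      show "0 = \<phi> x" if "x \<in> - cball 0 R" for x using zero[of x] that by auto
    qed (use that in auto)
    hence "frechet_derivative \<phi> (at z) = (\<lambda>v. 0)" by (metis frechet_derivative_at)
    thus ?thesis by (simp add: partial_x_def partial_y_def)
  qed
  obtain B1 where B1: "B1 \<ge> 0" "\<And>z. norm z \<le> R + 1 \<Longrightarrow> norm (partial_x \<phi> z) \<le> B1"
    by (rule continuous_bounded_on_cball[OF px, of "R + 1"]) blast
  obtain B2 where B2: "B2 \<ge> 0" "\<And>z. norm z \<le> R + 1 \<Longrightarrow> norm (partial_y \<phi> z) \<le> B2"
    by (rule continuous_bounded_on_cball[OF py, of "R + 1"]) blast
  note B12 = B1(1) B2(1)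
  have op: "onorm (\<lambda>v. of_real (Re v) * partial_x \<phi> z + of_real (Im v) * partial_y \<phi> z) \<le> B1 + B2" for z
  proof (rule onorm_le)
    fix v
    have px: "norm (partial_x \<phi> z) \<le> B1" using B1(2)[of z] dzero[of z] B12 R by (cases "norm z > R") auto
    have py: "norm (partial_y \<phi> z) \<le> B2" using B2(2)[of z] dzero[of z] B12 R by (cases "norm z > R") auto
    have "norm (of_real (Re v) * partial_x \<phi> z + of_real (Im v) * partial_y \<phi> z)
       \<le> \<bar>Re v\<bar> * norm (partial_x \<phi> z) + \<bar>Im v\<bar> * norm (partial_y \<phi> z)"
      by (rule order_trans[OF norm_triangle_ineq]) (simp add: norm_mult)
    also have "\<dots> \<le> norm v * B1 + norm v * B2"
      using px py B12 abs_Re_le_cmod[of v] abs_Im_le_cmod[of v] by (intro add_mono mult_mono) auto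
    finally show "norm (of_real (Re v) * partial_x \<phi> z + of_real (Im v) * partial_y \<phi> z) \<le> (B1 + B2) * norm v"
      by (simp add: algebra_simps)
  qed
  have lip: "norm (\<phi> z - \<phi> w) \<le> (B1 + B2) * norm (z - w)" for z w
    by (rule differentiable_bound[where S = UNIV, OF convex_UNIV _ op]) (use der in auto)
  show ?thesis
    by (rule that[of R "B1 + B2"]) (use R zero dzero cont px py der lip B12 in auto)
qed

lemma integrable_continuous_compact_support:
  fixes f :: "complex \<Rightarrow> complex"
  assumes "continuous_on UNIV f" "\<And>z. norm z > R \<Longrightarrow> f z = 0"
  shows "integrable lborel f"
proof -
  have "integrable lborel (\<lambda>x. indicator (cball 0 R) x *\<^sub>R f x)"
    by (rule borel_integrable_compact) (use continuous_on_subset[OF assms(1) subset_UNIV] in auto)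
  also have "(\<lambda>x. indicator (cball 0 R) x *\<^sub>R f x) = f"
    using assms(2) by (auto simp: indicator_def fun_eq_iff not_le)
  finally show ?thesis .
qed

lemma lborel_integral_translate:
  fixes f :: "complex \<Rightarrow> complex"
  assumes "f \<in> borel_measurable borel"
  shows "(LINT x|lborel. f (a + x)) = (LINT x|lborel. f x)"
proof -
  have "(LINT x|lborel. f x) = (LINT x|distr lborel borel ((+) a). f x)"
    by (simp add: lborel_distr_plus)
  also have "\<dots> = (LINT x|lborel. f (a + x))"
    by (rule integral_distr) (use assms in auto)
  finally show ?thesis ..
qed

lemma continuous_borel: "continuous_on UNIV (f :: complex \<Rightarrow> complex) \<Longrightarrow> f \<in> borel_measurable borel"
  by (rule borel_measurable_continuous_onI)

lemma integrable_indicator_cball: "integrable lborel (\<lambda>z::complex. B * indicator (cball 0 R) z :: real)"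
  by (intro integrable_mult_right integrable_real_indicator emeasure_bounded_finite bounded_cball) simp

text \<open>The difference quotient is moved from the test function to \<open>F\<close> by translation invariance,
  and dominated convergence applies on both sides because \<open>F\<close> is locally Lipschitz.\<close>

lemma weak_directional_derivative:
  fixes F D :: "complex \<Rightarrow> complex"
  assumes Lip: "\<And>R. \<exists>C. \<forall>z w. norm z \<le> R \<longrightarrow> norm w \<le> R \<longrightarrow> norm (F z - F w) \<le> C * norm (z - w)"
    and cont: "continuous_on UNIV F"
    and D: "D \<in> borel_measurable borel"
    and der: "AE z in lborel. ((\<lambda>t::real. F (z + of_real t * e)) has_vector_derivative D z) (at 0)"
    and e: "norm e = 1" and test: "test_function G \<phi>"
  shows "(LINT z|lborel. D z * \<phi> z) = - (LINT z|lborel. F z * (of_real (Re e) * partial_x \<phi> z + of_real (Im e) * partial_y \<phi> z))"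
proof -
  obtain R C where RC: "R > 0" "C \<ge> 0"
    and zero: "\<And>z. norm z > R \<Longrightarrow> \<phi> z = 0 \<and> partial_x \<phi> z = 0 \<and> partial_y \<phi> z = 0"
    and c\<phi>: "continuous_on UNIV \<phi>" "continuous_on UNIV (partial_x \<phi>)" "continuous_on UNIV (partial_y \<phi>)"
    and d\<phi>: "\<And>z. (\<phi> has_derivative (\<lambda>v. of_real (Re v) * partial_x \<phi> z + of_real (Im v) * partial_y \<phi> z)) (at z)"
    and L\<phi>: "\<And>z w. norm (\<phi> z - \<phi> w) \<le> C * norm (z - w)"
    by (rule test_function_facts[OF test]) blast
  define d where "d = (\<lambda>n::nat. 1 / real (Suc n))"
  have d: "d n > 0" "d n \<le> 1" for n by (auto simp: d_def)
  have d0: "d \<longlonglongrightarrow> 0" unfolding d_def by (intro LIMSEQ_Suc lim_1_over_n)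
  define P where "P = (\<lambda>z. of_real (Re e) * partial_x \<phi> z + of_real (Im e) * partial_y \<phi> z)"
  \<comment> \<open>The forward quotient of \<phi> here is matched with the backward quotient of F
    in S; a translation identifies the two integrals.\<close>
  define Q where "Q = (\<lambda>n z. F z * ((\<phi> (z + of_real (d n) * e) - \<phi> z) / of_real (d n)))"
  define S where "S = (\<lambda>n z. ((F (z - of_real (d n) * e) - F z) / of_real (d n)) * \<phi> z)"
  note cts = continuous_on_compose2[OF cont] continuous_on_compose2[OF c\<phi>(1)]
  have dn0: "complex_of_real (d n) \<noteq> 0" for n using d[of n] by simp
  have cQ: "continuous_on UNIV (Q n)" and cS: "continuous_on UNIV (S n)" for n
    unfolding Q_def S_def by (intro continuous_intros cts cont c\<phi> ballI dn0 subset_UNIV)+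
  have QS: "(LINT z|lborel. Q n z) = (LINT z|lborel. S n z)" for n
  proof -
    define a where "a = of_real (d n) * e"
    have na: "norm a \<le> 1" using d[of n] e by (simp add: a_def norm_mult)
    have int1: "integrable lborel (\<lambda>z. F z * \<phi> (z + a))"
    proof (rule integrable_continuous_compact_support[where R = "R + 1"])
      show "continuous_on UNIV (\<lambda>z. F z * \<phi> (z + a))" by (intro continuous_intros cts cont) auto
      fix z :: complex assume "norm z > R + 1"
      hence "norm (z + a) > R" using norm_triangle_ineq4[of "z + a" a] na by simp
      thus "F z * \<phi> (z + a) = 0" using zero by simp
    qed
    have int2: "integrable lborel (\<lambda>z. F z * \<phi> z)"
      by (rule integrable_continuous_compact_support[where R = R])
         (use zero in \<open>auto intro!: continuous_intros cont c\<phi>\<close>)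
    have int3: "integrable lborel (\<lambda>z. F (z - a) * \<phi> z)"
      by (rule integrable_continuous_compact_support[where R = R])
         (use zero in \<open>auto intro!: continuous_intros cts c\<phi>\<close>)
    have "(LINT z|lborel. Q n z) = (LINT z|lborel. (F z * \<phi> (z + a) - F z * \<phi> z) / of_real (d n))"
      unfolding Q_def a_def by (simp add: algebra_simps)
    also have "\<dots> = ((LINT z|lborel. F z * \<phi> (z + a)) - (LINT z|lborel. F z * \<phi> z)) / of_real (d n)"
      using int1 int2 by simp
    also have "(LINT z|lborel. F z * \<phi> (z + a)) = (LINT z|lborel. F (z - a) * \<phi> z)"
    proof -
      have "(\<lambda>z. F (z - a) * \<phi> z) \<in> borel_measurable borel"
        by (rule continuous_borel) (auto intro!: continuous_intros cts c\<phi>)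
      from lborel_integral_translate[OF this, of a] show ?thesis by (simp add: add.commute)
    qed
    also have "((LINT z|lborel. F (z - a) * \<phi> z) - (LINT z|lborel. F z * \<phi> z)) / of_real (d n) =
       (LINT z|lborel. (F (z - a) * \<phi> z - F z * \<phi> z) / of_real (d n))"
      using int3 int2 by simp
    also have "\<dots> = (LINT z|lborel. S n z)"
      unfolding S_def a_def by (simp add: algebra_simps)
    finally show ?thesis .
  qed
  obtain BF where BF: "BF \<ge> 0" "\<And>z. norm z \<le> R + 1 \<Longrightarrow> norm (F z) \<le> BF"
    by (rule continuous_bounded_on_cball[OF cont, of "R + 1"]) blast
  obtain B\<phi> where B\<phi>: "B\<phi> \<ge> 0" "\<And>z. norm z \<le> R + 1 \<Longrightarrow> norm (\<phi> z) \<le> B\<phi>"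
    by (rule continuous_bounded_on_cball[OF c\<phi>(1), of "R + 1"]) blast
  obtain CF0 where CF0: "\<And>z w. norm z \<le> R + 1 \<Longrightarrow> norm w \<le> R + 1 \<Longrightarrow> norm (F z - F w) \<le> CF0 * norm (z - w)"
    using Lip[of "R + 1"] by blast
  define CF where "CF = \<bar>CF0\<bar>"
  have CF_pos: "CF \<ge> 0" by (simp add: CF_def)
  have CF: "norm (F z - F w) \<le> CF * norm (z - w)" if "norm z \<le> R + 1" "norm w \<le> R + 1" for z w
  proof -
    have "CF0 * norm (z - w) \<le> CF * norm (z - w)" by (intro mult_right_mono) (auto simp: CF_def)
    thus ?thesis using CF0[OF that] by linarith
  qed
  have seq: "filterlim d (at 0) sequentially"
    using d0 d(1) by (intro filterlim_atI) (auto simp: less_le)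
  have vd: "((\<lambda>t::real. \<phi> (z + of_real t * e)) has_vector_derivative P z) (at 0)" for z
  proof -
    have "((\<lambda>t::real. z + of_real t * e) has_derivative (\<lambda>t. of_real t * e)) (at 0)"
      by (auto intro!: derivative_eq_intros has_derivative_of_real)
    from has_derivative_compose[OF this d\<phi>[of "z + of_real 0 * e"]]
    show ?thesis unfolding has_vector_derivative_def P_def
      by (simp add: scaleR_conv_of_real algebra_simps)
  qed
  have quot: "(\<lambda>n. (f (u n) - f 0) / of_real (u n)) \<longlonglongrightarrow> D'"
    if "(f has_vector_derivative D') (at 0)" "filterlim u (at 0) sequentially" for f :: "real \<Rightarrow> complex" and D' u
  proof -
    have "((\<lambda>t. (f t - f 0) / of_real t) \<longlongrightarrow> D') (at 0)"
    proof -
      have "((\<lambda>t. norm (f t - f 0 - t *\<^sub>R D') / norm t) \<longlongrightarrow> 0) (at 0)"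
        using that(1) unfolding has_vector_derivative_def has_derivative_at by simp
      moreover have "\<forall>\<^sub>F t in at (0::real). norm (f t - f 0 - t *\<^sub>R D') / norm t = norm ((f t - f 0) / of_real t - D')"
        using eventually_neq_at_within[of 0 0 UNIV]
      proof eventually_elim
        case (elim t)
        hence "(f t - f 0) / of_real t - D' = (f t - f 0 - t *\<^sub>R D') / of_real t"
          by (simp add: diff_divide_distrib scaleR_conv_of_real)
        thus ?case by (simp add: norm_divide)
      qed
      ultimately have "((\<lambda>t. norm ((f t - f 0) / of_real t - D')) \<longlongrightarrow> 0) (at 0)"
        by (rule Lim_transform_eventually)
      thus ?thesis by (simp only: tendsto_norm_zero_iff LIM_zero_iff)
    qed
    from filterlim_compose[OF this that(2)] show ?thesis .
  qed
  have limQ: "(\<lambda>n. LINT z|lborel. Q n z) \<longlonglongrightarrow> (LINT z|lborel. F z * P z)"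
  proof (rule integral_dominated_convergence[where w = "\<lambda>z. (BF * C) * indicator (cball 0 (R + 1)) z"])
    show "(\<lambda>z. F z * P z) \<in> borel_measurable lborel"
    proof -
      have "continuous_on UNIV (\<lambda>z. F z * P z)"
        unfolding P_def by (intro continuous_intros cont c\<phi>)
      from continuous_borel[OF this] show ?thesis by simp
    qed
    show "Q n \<in> borel_measurable lborel" for n
      using continuous_borel[OF cQ] by simp
    show "AE z in lborel. (\<lambda>n. Q n z) \<longlonglongrightarrow> F z * P z"
      unfolding Q_def using quot[OF vd seq] by (intro AE_I2 tendsto_mult tendsto_const) simp
    show "AE z in lborel. norm (Q n z) \<le> BF * C * indicator (cball 0 (R + 1)) z" for n
    proof (rule AE_I2)
      fix z :: complex
      define a where "a = of_real (d n) * e"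
      have na: "norm a = d n" using d[of n] e by (simp add: a_def norm_mult)
      show "norm (Q n z) \<le> BF * C * indicator (cball 0 (R + 1)) z"
      proof (cases "norm z \<le> R + 1")
        case True
        have "norm (\<phi> (z + a) - \<phi> z) \<le> C * d n" using L\<phi>[of "z + a" z] by (simp add: na)
        hence "norm ((\<phi> (z + a) - \<phi> z) / of_real (d n)) \<le> C"
          using d[of n] by (simp add: norm_divide divide_le_eq)
        hence "norm (Q n z) \<le> BF * C"
          unfolding Q_def norm_mult a_def using BF True by (intro mult_mono) auto
        thus ?thesis using True by simp
      next
        case False
        hence "norm (z + a) > R" using norm_triangle_ineq4[of "z + a" a] na d[of n] by simp
        hence "Q n z = 0" using zero[of "z + a"] zero[of z] False RC by (simp add: Q_def a_def)
        thus ?thesis using False by simp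
      qed
    qed
  qed (rule integrable_indicator_cball)
  have limS: "(\<lambda>n. LINT z|lborel. S n z) \<longlonglongrightarrow> (LINT z|lborel. - D z * \<phi> z)"
  proof (rule integral_dominated_convergence[where w = "\<lambda>z. (CF * B\<phi>) * indicator (cball 0 (R + 1)) z"])
    show "(\<lambda>z. - D z * \<phi> z) \<in> borel_measurable lborel"
      using D continuous_borel[OF c\<phi>(1)] by simp
    show "S n \<in> borel_measurable lborel" for n
      using continuous_borel[OF cS] by simp
    show "AE z in lborel. (\<lambda>n. S n z) \<longlonglongrightarrow> - D z * \<phi> z"
      using der
    proof eventually_elim
      case (elim z)
      \<comment> \<open>S divides the increment over the step -d n by +d n, hence the minus sign in
        its limit.\<close>
      have "filterlim (\<lambda>n. - d n) (at 0) sequentially"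
        using tendsto_minus[OF d0] d(1) by (intro filterlim_atI) (auto simp: less_le)
      from tendsto_minus[OF quot[OF elim this]]
      have "(\<lambda>n. (F (z - of_real (d n) * e) - F z) / of_real (d n)) \<longlonglongrightarrow> - D z" by simp
      thus ?case unfolding S_def by (intro tendsto_mult tendsto_const)
    qed
    show "AE z in lborel. norm (S n z) \<le> CF * B\<phi> * indicator (cball 0 (R + 1)) z" for n
    proof (rule AE_I2)
      fix z :: complex
      define a where "a = of_real (d n) * e"
      have na: "norm a = d n" using d[of n] e by (simp add: a_def norm_mult)
      show "norm (S n z) \<le> CF * B\<phi> * indicator (cball 0 (R + 1)) z"
      proof (cases "norm z \<le> R")
        case True
        have "norm (z - a) \<le> R + 1" using norm_triangle_ineq4[of z a] na d[of n] True by linarith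
        hence "norm (F (z - a) - F z) \<le> CF * d n" using CF[of "z - a" z] True by (simp add: na)
        hence q: "norm ((F (z - a) - F z) / of_real (d n)) \<le> CF"
          using d[of n] by (simp add: norm_divide divide_le_eq)
        have "norm (S n z) \<le> CF * B\<phi>"
          unfolding S_def norm_mult a_def[symmetric] using q B\<phi> CF_pos True
          by (intro mult_mono) auto
        thus ?thesis using True by simp
      next
        case False
        have "S n z = 0" using zero[of z] False by (simp add: S_def)
        thus ?thesis using B\<phi> CF_pos by simp
      qed
    qed
  qed (rule integrable_indicator_cball)
  have "(LINT z|lborel. F z * P z) = (LINT z|lborel. - D z * \<phi> z)"
    using LIMSEQ_unique[OF limQ] limS unfolding QS by blast
  also have "\<dots> = - (LINT z|lborel. D z * \<phi> z)" by simp
  finally show ?thesis by (simp add: P_def)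
qed

lemma integrable_bounded_compact_support:
  fixes f :: "complex \<Rightarrow> complex"
  assumes "f \<in> borel_measurable borel" "\<And>z. norm z \<le> R \<Longrightarrow> norm (f z) \<le> B" "\<And>z. norm z > R \<Longrightarrow> f z = 0"
  shows "integrable lborel f"
proof (rule Bochner_Integration.integrable_bound[OF integrable_indicator_cball[of B R]])
  show "AE z in lborel. norm (f z) \<le> norm (B * indicator (cball 0 R) z)"
    using assms(2,3) by (intro AE_I2) (force simp: indicator_def)
qed (use assms in auto)

text \<open>The directions 1 and \<i> yield A1 + B1 = -X1 and \<i> (A1 - B1) = -Y1; the two claims
  are the solutions of this system.\<close>

lemma weak_wirtinger_derivatives:
  fixes F a b :: "complex \<Rightarrow> complex"
  assumes Lip: "\<And>R. \<exists>C. \<forall>z w. norm z \<le> R \<longrightarrow> norm w \<le> R \<longrightarrow> norm (F z - F w) \<le> C * norm (z - w)"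
    and cont: "continuous_on UNIV F"
    and meas: "a \<in> borel_measurable borel" "b \<in> borel_measurable borel"
    and bound: "\<And>R. \<exists>C. \<forall>z. norm z \<le> R \<longrightarrow> norm (a z) \<le> C" "\<And>R. \<exists>C. \<forall>z. norm z \<le> R \<longrightarrow> norm (b z) \<le> C"
    and der: "AE z in lborel. (F has_derivative (\<lambda>v. a z * v + b z * cnj v)) (at z)"
    and test: "test_function G \<phi>"
  shows "(LINT z|lborel. a z * \<phi> z) = - (LINT z|lborel. F z * wirtinger \<phi> z)"
    and "(LINT z|lborel. b z * \<phi> z) = - (LINT z|lborel. F z * wirtinger_bar \<phi> z)"
proof -
  obtain R C where RC: "R > 0" "C \<ge> 0"
    and zero: "\<And>z. norm z > R \<Longrightarrow> \<phi> z = 0 \<and> partial_x \<phi> z = 0 \<and> partial_y \<phi> z = 0"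
    and c\<phi>: "continuous_on UNIV \<phi>" "continuous_on UNIV (partial_x \<phi>)" "continuous_on UNIV (partial_y \<phi>)"
    and d\<phi>: "\<And>z. (\<phi> has_derivative (\<lambda>v. of_real (Re v) * partial_x \<phi> z + of_real (Im v) * partial_y \<phi> z)) (at z)"
    and L\<phi>: "\<And>z w. norm (\<phi> z - \<phi> w) \<le> C * norm (z - w)"
    by (rule test_function_facts[OF test]) blast
  obtain B where B: "B \<ge> 0" "\<And>z. norm z \<le> R \<Longrightarrow> norm (\<phi> z) \<le> B"
    by (rule continuous_bounded_on_cball[OF c\<phi>(1), of R]) blast
  have int\<phi>: "integrable lborel (\<lambda>z. u z * \<phi> z)"
    if u: "u \<in> borel_measurable borel" "\<exists>C. \<forall>z. norm z \<le> R \<longrightarrow> norm (u z) \<le> C" for u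
  proof -
    obtain C where C: "\<forall>z. norm z \<le> R \<longrightarrow> norm (u z) \<le> C" using u(2) by blast
    show ?thesis
    proof (rule integrable_bounded_compact_support[where R = R and B = "C * B"])
      show "(\<lambda>z. u z * \<phi> z) \<in> borel_measurable borel" using u(1) continuous_borel[OF c\<phi>(1)] by simp
      fix z :: complex assume z: "norm z \<le> R"
      have "0 \<le> C" using C z norm_ge_zero order_trans by blast
      thus "norm (u z * \<phi> z) \<le> C * B" unfolding norm_mult using B C z by (intro mult_mono) auto
    qed (use zero in auto)
  qed
  have int: "integrable lborel (\<lambda>z. a z * \<phi> z)" "integrable lborel (\<lambda>z. b z * \<phi> z)"
    by (intro int\<phi> meas bound)+
  have intF: "integrable lborel (\<lambda>z. F z * partial_x \<phi> z)" "integrable lborel (\<lambda>z. F z * partial_y \<phi> z)"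
    by (rule integrable_continuous_compact_support[where R = R], (auto intro!: continuous_intros cont c\<phi> simp: zero)[2])+
  have dir: "AE z in lborel. ((\<lambda>t::real. F (z + of_real t * e)) has_vector_derivative (a z * e + b z * cnj e)) (at 0)" for e
    using der
  proof eventually_elim
    case (elim z)
    have "((\<lambda>t::real. z + of_real t * e) has_derivative (\<lambda>t. of_real t * e)) (at 0)"
      by (auto intro!: derivative_eq_intros has_derivative_of_real)
    moreover have "(F has_derivative (\<lambda>v. a z * v + b z * cnj v)) (at (z + of_real 0 * e))"
      using elim by simp
    ultimately
    have "((\<lambda>t::real. F (z + of_real t * e)) has_derivative (\<lambda>t. a z * (of_real t * e) + b z * cnj (of_real t * e))) (at 0)"
      by (rule has_derivative_compose)
    thus ?case unfolding has_vector_derivative_def by (simp add: scaleR_conv_of_real algebra_simps)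
  qed
  have X: "(LINT z|lborel. (a z * 1 + b z * cnj 1) * \<phi> z) =
     - (LINT z|lborel. F z * (of_real (Re 1) * partial_x \<phi> z + of_real (Im 1) * partial_y \<phi> z))"
    by (rule weak_directional_derivative[OF Lip cont _ dir _ test]) (use meas in auto)
  have Y: "(LINT z|lborel. (a z * \<i> + b z * cnj \<i>) * \<phi> z) =
     - (LINT z|lborel. F z * (of_real (Re \<i>) * partial_x \<phi> z + of_real (Im \<i>) * partial_y \<phi> z))"
    by (rule weak_directional_derivative[OF Lip cont _ dir _ test]) (use meas in auto)
  define A1 B1 X1 Y1 where "A1 = (LINT z|lborel. a z * \<phi> z)" and "B1 = (LINT z|lborel. b z * \<phi> z)"
    and "X1 = (LINT z|lborel. F z * partial_x \<phi> z)" and "Y1 = (LINT z|lborel. F z * partial_y \<phi> z)"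
  have "(LINT z|lborel. (a z * 1 + b z * cnj 1) * \<phi> z) = (LINT z|lborel. a z * \<phi> z + b z * \<phi> z)"
    by (simp add: algebra_simps)
  also have "\<dots> = A1 + B1" using int by (simp add: A1_def B1_def)
  finally have X': "A1 + B1 = - X1" using X by (simp add: X1_def)
  have "(LINT z|lborel. (a z * \<i> + b z * cnj \<i>) * \<phi> z) = (LINT z|lborel. \<i> * (a z * \<phi> z - b z * \<phi> z))"
    by (simp add: algebra_simps)
  also have "\<dots> = \<i> * (A1 - B1)" using int by (simp add: A1_def B1_def)
  finally have Y': "\<i> * (A1 - B1) = - Y1" using Y by (simp add: Y1_def)
  have "(LINT z|lborel. F z * wirtinger \<phi> z) = (LINT z|lborel. (F z * partial_x \<phi> z - \<i> * (F z * partial_y \<phi> z)) / 2)"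
    unfolding wirtinger_def by (simp add: algebra_simps)
  also have "\<dots> = (X1 - \<i> * Y1) / 2" using intF by (simp add: X1_def Y1_def)
  also have "\<dots> = - A1"
  proof -
    have XY: "X1 = - (A1 + B1)" "Y1 = - (\<i> * (A1 - B1))" using X' Y' by (simp_all add: minus_equation_iff)
    show ?thesis unfolding XY by (simp add: algebra_simps)
  qed
  finally show "(LINT z|lborel. a z * \<phi> z) = - (LINT z|lborel. F z * wirtinger \<phi> z)" by (simp add: A1_def)
  have "(LINT z|lborel. F z * wirtinger_bar \<phi> z) = (LINT z|lborel. (F z * partial_x \<phi> z + \<i> * (F z * partial_y \<phi> z)) / 2)"
    unfolding wirtinger_bar_def by (simp add: algebra_simps)
  also have "\<dots> = (X1 + \<i> * Y1) / 2" using intF by (simp add: X1_def Y1_def)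
  also have "\<dots> = - B1"
  proof -
    have XY: "X1 = - (A1 + B1)" "Y1 = - (\<i> * (A1 - B1))" using X' Y' by (simp_all add: minus_equation_iff)
    show ?thesis unfolding XY by (simp add: algebra_simps)
  qed
  finally show "(LINT z|lborel. b z * \<phi> z) = - (LINT z|lborel. F z * wirtinger_bar \<phi> z)" by (simp add: B1_def)
qed

lemma integral_mult_tendsto:
  fixes u :: "nat \<Rightarrow> complex \<Rightarrow> complex"
  assumes \<phi>: "continuous_on UNIV \<phi>" "\<And>z. norm z > R \<Longrightarrow> \<phi> z = 0"
    and meas: "\<And>n. u n \<in> borel_measurable borel" "v \<in> borel_measurable borel"
    and lim: "AE z in lborel. (\<lambda>n. u n z) \<longlonglongrightarrow> v z"
    and bound: "\<And>n z. norm z \<le> R \<Longrightarrow> norm (u n z) \<le> C"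
  shows "(\<lambda>n. LINT z|lborel. u n z * \<phi> z) \<longlonglongrightarrow> (LINT z|lborel. v z * \<phi> z)"
proof -
  obtain B where B: "B \<ge> 0" "\<And>z. norm z \<le> R \<Longrightarrow> norm (\<phi> z) \<le> B"
    by (rule continuous_bounded_on_cball[OF \<phi>(1), of R]) blast
  show ?thesis
  proof (rule integral_dominated_convergence[where w = "\<lambda>z. (C * B) * indicator (cball 0 R) z"])
    show "(\<lambda>z. v z * \<phi> z) \<in> borel_measurable lborel" "\<And>n. (\<lambda>z. u n z * \<phi> z) \<in> borel_measurable lborel"
      using meas continuous_borel[OF \<phi>(1)] by simp_all
    show "AE z in lborel. (\<lambda>n. u n z * \<phi> z) \<longlonglongrightarrow> v z * \<phi> z"
      using lim by eventually_elim (intro tendsto_mult tendsto_const)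
    show "AE z in lborel. norm (u n z * \<phi> z) \<le> C * B * indicator (cball 0 R) z" for n
    proof (rule AE_I2)
      fix z :: complex
      show "norm (u n z * \<phi> z) \<le> C * B * indicator (cball 0 R) z"
      proof (cases "norm z \<le> R")
        case True
        have "0 \<le> C" using bound[OF True] norm_ge_zero order_trans by blast
        hence "norm (u n z * \<phi> z) \<le> C * B" unfolding norm_mult using B bound True by (intro mult_mono) auto
        thus ?thesis using True by simp
      qed (use \<phi>(2) in auto)
    qed
  qed (rule integrable_indicator_cball)
qed

subsection \<open>Radial limits almost everywhere\<close>

definition circle :: "real measure" where "circle = restrict_space lborel {0..2 * pi}"

lemma finite_measure_circle: "finite_measure circle"
proof
  show "emeasure circle (space circle) \<noteq> \<infinity>"
    by (simp add: circle_def space_restrict_space emeasure_restrict_space)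
qed

lemma measurable_circle: "continuous_on UNIV f \<Longrightarrow> f \<in> borel_measurable circle"
  unfolding circle_def by (intro measurable_restrict_space1) (simp add: borel_measurable_continuous_onI)

lemma integrable_circle:
  fixes f :: "real \<Rightarrow> 'a::{banach, second_countable_topology}"
  assumes "continuous_on UNIV f" "\<And>t. norm (f t) \<le> B"
  shows "integrable circle f"
  by (rule finite_measure.integrable_const_bound[OF finite_measure_circle, of _ B])
     (use assms measurable_circle in auto)

lemma integral_const_circle: "(LINT t|circle. (c::real)) = 2 * pi * c"
  by (simp add: circle_def space_restrict_space measure_restrict_space)

definition cexp :: "real \<Rightarrow> complex" where "cexp t = exp (\<i> * of_real t)"

lemma norm_cexp [simp]: "norm (cexp t) = 1" by (simp add: cexp_def)

lemma continuous_cexp: "continuous_on S cexp" unfolding cexp_def by (intro continuous_intros)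

lemma integral_cexp_power:
  "(LINT t|circle. cexp t ^ n * cnj (cexp t ^ m)) = (if n = m then of_real (2 * pi) else 0)"
proof (cases "n = m")
  case True
  have "cexp t ^ n * cnj (cexp t ^ m) = 1" for t
    unfolding True complex_norm_square[symmetric] by (simp add: norm_power)
  thus ?thesis using True
    by (simp add: circle_def space_restrict_space measure_restrict_space scaleR_conv_of_real)
next
  case False
  define k where "k = complex_of_real (real n - real m)"
  have k: "k \<noteq> 0" using False by (simp add: k_def)
  have e: "cexp t ^ n * cnj (cexp t ^ m) = exp (\<i> * k * of_real t)" for t
    by (simp add: cexp_def k_def exp_of_nat_mult[symmetric] exp_cnj exp_add[symmetric] algebra_simps)
  have "(LINT t|circle. cexp t ^ n * cnj (cexp t ^ m)) = (LINT t|lborel. indicator {0..2 * pi} t *\<^sub>R exp (\<i> * k * of_real t))"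
    unfolding e circle_def by (rule integral_restrict_space) auto
  also have "\<dots> = exp (\<i> * k * of_real (2 * pi)) / (\<i> * k) - exp (\<i> * k * of_real 0) / (\<i> * k)"
  proof (rule integral_FTC_atLeastAtMost)
    fix t :: real
    have "((\<lambda>x. exp (\<i> * k * x) / (\<i> * k)) has_field_derivative exp (\<i> * k * of_real t)) (at (of_real t))"
      using k by (auto intro!: derivative_eq_intros)
    from has_vector_derivative_real_field[OF this]
    show "((\<lambda>t. exp (\<i> * k * of_real t) / (\<i> * k)) has_vector_derivative exp (\<i> * k * of_real t)) (at t within {0..2 * pi})"
      by (rule has_vector_derivative_at_within)
  qed (auto intro!: continuous_intros)
  also have "exp (\<i> * k * of_real (2 * pi)) = 1"
    unfolding exp_eq_1 by (auto simp: k_def intro!: exI[of _ "int n - int m"])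
  finally show ?thesis using False by simp
qed

lemma parseval_polynomial:
  "(LINT t|circle. (norm (\<Sum>n<N. b n * cexp t ^ n))\<^sup>2) = 2 * pi * (\<Sum>n<N. (norm (b n))\<^sup>2)"
proof -
  have int: "integrable circle (\<lambda>t. b n * cnj (b m) * (cexp t ^ n * cnj (cexp t ^ m)))" for n m
    by (rule integrable_circle[where B = "norm (b n * cnj (b m))"])
       (auto intro!: continuous_intros continuous_cexp simp: norm_mult norm_power)
  have "complex_of_real (LINT t|circle. (norm (\<Sum>n<N. b n * cexp t ^ n))\<^sup>2) =
      (LINT t|circle. (\<Sum>n<N. b n * cexp t ^ n) * cnj (\<Sum>n<N. b n * cexp t ^ n))"
    by (simp only: integral_complex_of_real[symmetric] complex_norm_square)
  also have "\<dots> = (LINT t|circle. (\<Sum>n<N. \<Sum>m<N. b n * cnj (b m) * (cexp t ^ n * cnj (cexp t ^ m))))"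
    by (simp add: sum_product mult_ac)
  also have "\<dots> = (\<Sum>n<N. \<Sum>m<N. (LINT t|circle. b n * cnj (b m) * (cexp t ^ n * cnj (cexp t ^ m))))"
    using int by (simp add: Bochner_Integration.integral_sum Bochner_Integration.integrable_sum)
  also have "\<dots> = (\<Sum>n<N. \<Sum>m<N. b n * cnj (b m) * (if n = m then of_real (2 * pi) else 0))"
    by (simp only: integral_mult_right_zero integral_cexp_power)
  also have "\<dots> = (\<Sum>n<N. b n * cnj (b n) * of_real (2 * pi))"
    by (intro sum.cong refl) (simp add: if_distrib[of "\<lambda>x. _ * x"] cong: if_cong)
  also have "\<dots> = complex_of_real (2 * pi * (\<Sum>n<N. (norm (b n))\<^sup>2))"
    by (simp add: complex_norm_square[symmetric] sum_distrib_left mult.commute)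
  finally show ?thesis using of_real_eq_iff by blast
qed

text \<open>Absolute convergence bounds the partial sums uniformly, so the polynomial identity
  passes to the limit.\<close>

lemma parseval:
  assumes b: "summable (\<lambda>n. norm (b n))" and S: "\<And>t. (\<lambda>n. b n * cexp t ^ n) sums S t"
  shows "(\<lambda>n. (norm (b n))\<^sup>2) sums ((LINT t|circle. (norm (S t))\<^sup>2) / (2 * pi))"
    and "S \<in> borel_measurable circle"
proof -
  define B where "B = (\<Sum>n. norm (b n))"
  have bd: "norm (\<Sum>n<N. b n * cexp t ^ n) \<le> B" for N t
  proof -
    have "norm (\<Sum>n<N. b n * cexp t ^ n) \<le> (\<Sum>n<N. norm (b n))"
      by (rule sum_norm_le) (simp add: norm_mult norm_power)
    also have "\<dots> \<le> B" unfolding B_def by (rule sum_le_suminf[OF b]) auto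
    finally show ?thesis .
  qed
  have meas: "(\<lambda>t. \<Sum>n<N. b n * cexp t ^ n) \<in> borel_measurable circle" for N
    by (rule measurable_circle) (intro continuous_intros continuous_cexp)
  show Sm: "S \<in> borel_measurable circle"
    by (rule borel_measurable_LIMSEQ_metric[OF meas]) (use S in \<open>auto simp: sums_def\<close>)
  have "(\<lambda>N. LINT t|circle. (norm (\<Sum>n<N. b n * cexp t ^ n))\<^sup>2) \<longlonglongrightarrow> (LINT t|circle. (norm (S t))\<^sup>2)"
  proof (rule integral_dominated_convergence[where w = "\<lambda>_. B\<^sup>2"])
    show "integrable circle (\<lambda>_. B\<^sup>2)" by (rule integrable_circle[where B = "B\<^sup>2"]) auto
    show "AE t in circle. (\<lambda>N. (norm (\<Sum>n<N. b n * cexp t ^ n))\<^sup>2) \<longlonglongrightarrow> (norm (S t))\<^sup>2"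
      using S unfolding sums_def by (intro AE_I2 tendsto_intros) auto
    show "AE t in circle. norm ((norm (\<Sum>n<N. b n * cexp t ^ n))\<^sup>2) \<le> B\<^sup>2" for N
      using bd by (intro AE_I2) (simp add: power_mono)
  qed (use meas Sm in \<open>auto intro!: borel_measurable_power borel_measurable_norm\<close>)
  hence "(\<lambda>N. (2 * pi * (\<Sum>n<N. (norm (b n))\<^sup>2)) / (2 * pi)) \<longlonglongrightarrow> (LINT t|circle. (norm (S t))\<^sup>2) / (2 * pi)"
    unfolding parseval_polynomial by (intro tendsto_divide tendsto_const) auto
  thus "(\<lambda>n. (norm (b n))\<^sup>2) sums ((LINT t|circle. (norm (S t))\<^sup>2) / (2 * pi))"
    by (simp add: sums_def)
qed

section \<open>Dilations of a bounded holomorphic function\<close>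

locale bounded_disc_fun =
  fixes p :: "complex \<Rightarrow> complex" and M :: real
  assumes hol: "p holomorphic_on ball 0 1" and bd: "\<And>z. z \<in> ball 0 1 \<Longrightarrow> norm (p z) \<le> M"
begin

definition a :: "nat \<Rightarrow> complex" where "a n = (deriv ^^ n) p 0 / fact n"

lemma sums_p: "norm z < 1 \<Longrightarrow> (\<lambda>n. a n * z ^ n) sums p z"
  using holomorphic_power_series[OF hol, of z] by (simp add: a_def)

lemma summable_a:
  assumes "0 \<le> r" "r < 1"
  shows "summable (\<lambda>n. norm (a n * of_real r ^ n))"
proof -
  obtain \<rho> where "r < \<rho>" "\<rho> < 1" using dense[OF assms(2)] by blast
  thus ?thesis
    using powser_insidea[of a "of_real \<rho>" "of_real r"] sums_p[of "of_real \<rho>"] assms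
    by (auto simp: sums_iff)
qed

lemma sums_circle:
  assumes "0 \<le> r" "r < 1"
  shows "(\<lambda>n. (a n * of_real r ^ n) * cexp t ^ n) sums p (of_real r * cexp t)"
  using sums_p[of "of_real r * cexp t"] assms by (simp add: norm_mult power_mult_distrib mult.assoc)

text \<open>At radius r < 1 the sum of squares is a mean of |p|^2, hence at most M^2; on a finite
  section r may tend to 1.\<close>

lemma summable_square: "summable (\<lambda>n. (norm (a n))\<^sup>2)"
proof (rule summableI_nonneg_bounded)
  fix N
  have *: "(\<Sum>n<N. (norm (a n * of_real r ^ n))\<^sup>2) \<le> M\<^sup>2" if r: "0 \<le> r" "r < 1" for r :: real
  proof -
    note P = parseval[OF summable_a[OF r] sums_circle[OF r]]
    have "(\<Sum>n<N. (norm (a n * of_real r ^ n))\<^sup>2) \<le> (LINT t|circle. (norm (p (of_real r * cexp t)))\<^sup>2) / (2 * pi)"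
      using sum_le_suminf[of "\<lambda>n. (norm (a n * of_real r ^ n))\<^sup>2" "{..<N}"] P(1) by (simp add: sums_iff)
    also have "(LINT t|circle. (norm (p (of_real r * cexp t)))\<^sup>2) \<le> (LINT t|circle. M\<^sup>2)"
    proof (rule integral_mono')
      show "integrable circle (\<lambda>t. M\<^sup>2)" by (rule integrable_circle[where B = "M\<^sup>2"]) auto
      fix t show "(norm (p (of_real r * cexp t)))\<^sup>2 \<le> M\<^sup>2"
        using bd[of "of_real r * cexp t"] r by (intro power_mono) (auto simp: norm_mult)
    qed auto
    also have "(LINT t|circle. M\<^sup>2) = 2 * pi * M\<^sup>2" by (rule integral_const_circle)
    finally show ?thesis by (simp add: divide_right_mono)
  qed
  have "(\<lambda>j. (\<Sum>n<N. (norm (a n * of_real (1 - 1 / real (Suc j)) ^ n))\<^sup>2)) \<longlonglongrightarrow> (\<Sum>n<N. (norm (a n * of_real (1 - 0) ^ n))\<^sup>2)"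
    by (intro tendsto_intros LIMSEQ_Suc lim_1_over_n)
  moreover have "(\<Sum>n<N. (norm (a n * of_real (1 - 1 / real (Suc j)) ^ n))\<^sup>2) \<le> M\<^sup>2" for j
    by (rule *) auto
  ultimately have "(\<Sum>n<N. (norm (a n * of_real (1 - 0) ^ n))\<^sup>2) \<le> M\<^sup>2"
    by (intro LIMSEQ_le_const2) auto
  thus "(\<Sum>n<N. (norm (a n))\<^sup>2) \<le> M\<^sup>2" by simp
qed auto

text \<open>In terms of Fourier coefficients, the squared L2 distance from the dilation p(r z) to
  the boundary function, which thus need not be constructed.\<close>

definition defect :: "real \<Rightarrow> real" where "defect r = (\<Sum>n. (norm (a n))\<^sup>2 * (1 - r ^ n)\<^sup>2)"

lemma one_minus_power: "0 \<le> r \<Longrightarrow> r < 1 \<Longrightarrow> 0 \<le> 1 - r ^ n \<and> 1 - r ^ n \<le> (1::real)"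
  by (simp add: power_le_one)

lemma summable_defect:
  assumes "0 \<le> r" "r < 1"
  shows "summable (\<lambda>n. (norm (a n))\<^sup>2 * (1 - r ^ n)\<^sup>2)"
proof (rule summable_comparison_test'[OF summable_square, of 0])
  fix n :: nat
  have "(1 - r ^ n)\<^sup>2 \<le> 1" using one_minus_power[OF assms, of n] by (simp add: power_le_one)
  thus "norm ((norm (a n))\<^sup>2 * (1 - r ^ n)\<^sup>2) \<le> (norm (a n))\<^sup>2" by (simp add: mult_left_le)
qed

lemma defect_nonneg: "0 \<le> r \<Longrightarrow> r < 1 \<Longrightarrow> 0 \<le> defect r"
  unfolding defect_def by (intro suminf_nonneg summable_defect) auto

text \<open>The factors (1 - r^n)^2 are at most 1, so the tail is small uniformly in r, while each
  of the finitely many other terms tends to 0.\<close>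

lemma defect_tendsto: "(defect \<longlongrightarrow> 0) (at_left 1)"
proof (rule tendstoI)
  fix e :: real assume e: "e > 0"
  define f where "f = (\<lambda>n. (norm (a n))\<^sup>2)"
  have f: "summable f" using summable_square by (simp add: f_def)
  obtain N where N: "\<And>m. m \<ge> N \<Longrightarrow> norm (\<Sum>i. f (i + m)) < e / 2"
    using suminf_exist_split[OF _ f, of "e / 2"] e by auto
  have "((\<lambda>r. \<Sum>n<N. f n * (1 - r ^ n)\<^sup>2) \<longlongrightarrow> (\<Sum>n<N. f n * (1 - 1 ^ n)\<^sup>2)) (at_left 1)"
    by (intro tendsto_intros)
  hence "((\<lambda>r. \<Sum>n<N. f n * (1 - r ^ n)\<^sup>2) \<longlongrightarrow> 0) (at_left 1)" by simp
  hence "\<forall>\<^sub>F r in at_left 1. (\<Sum>n<N. f n * (1 - r ^ n)\<^sup>2) < e / 2"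
    using e by (intro order_tendstoD(2)) auto
  moreover have "\<forall>\<^sub>F r in at_left 1. 0 < r \<and> r < (1::real)"
    using eventually_at_left_real[of 0 1] by auto
  ultimately show "\<forall>\<^sub>F r in at_left 1. dist (defect r) 0 < e"
  proof eventually_elim
    case (elim r)
    hence r: "0 \<le> r" "r < 1" by auto
    have "defect r = (\<Sum>i. f (i + N) * (1 - r ^ (i + N))\<^sup>2) + (\<Sum>n<N. f n * (1 - r ^ n)\<^sup>2)"
      unfolding defect_def f_def by (rule suminf_split_initial_segment[OF summable_defect[OF r]])
    also have "(\<Sum>i. f (i + N) * (1 - r ^ (i + N))\<^sup>2) \<le> (\<Sum>i. f (i + N))"
    proof (rule suminf_le)
      show "f (n + N) * (1 - r ^ (n + N))\<^sup>2 \<le> f (n + N)" for n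
        using one_minus_power[OF r, of "n + N"] by (simp add: mult_left_le power_le_one f_def)
    qed (use summable_ignore_initial_segment[OF summable_defect[OF r], of N] summable_ignore_initial_segment[OF f, of N]
         in \<open>auto simp: f_def\<close>)
    also have "(\<Sum>i. f (i + N)) < e / 2" using N[of N] by auto
    finally show ?case using elim defect_nonneg[OF r] by simp
  qed
qed

text \<open>Writing r^n - s^n as a difference of 1 - s^n and 1 - r^n bounds the L2 distance of two
  dilations by their defects; the free parameter \<mu> trades L2 for L1.\<close>

lemma L1_diff:
  assumes r: "0 \<le> r" "r < 1" and s: "0 \<le> s" "s < 1" and lam: "\<mu> > 0"
  shows "integrable circle (\<lambda>t. norm (p (of_real r * cexp t) - p (of_real s * cexp t)))"
    and "(LINT t|circle. norm (p (of_real r * cexp t) - p (of_real s * cexp t)))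
       \<le> 2 * pi * (\<mu> * (2 * defect r + 2 * defect s) + 1 / \<mu>)"
proof -
  define d where "d = (\<lambda>t. p (of_real r * cexp t) - p (of_real s * cexp t))"
  define b where "b = (\<lambda>n. a n * of_real r ^ n - a n * of_real s ^ n)"
  have sb: "summable (\<lambda>n. norm (b n))"
    by (rule summable_comparison_test'[OF summable_add[OF summable_a[OF r] summable_a[OF s]], of 0])
       (simp add: b_def norm_triangle_ineq4)
  have sd: "(\<lambda>n. b n * cexp t ^ n) sums d t" for t
    using sums_diff[OF sums_circle[OF r] sums_circle[OF s], of t t] by (simp add: b_def d_def left_diff_distrib)
  note P = parseval[OF sb sd]
  have db: "norm (d t) \<le> 2 * M" for t
  proof -
    have "norm (p (of_real r * cexp t)) \<le> M" "norm (p (of_real s * cexp t)) \<le> M"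
      using r s by (auto intro!: bd simp: norm_mult)
    thus ?thesis unfolding d_def using norm_triangle_ineq4[of "p (of_real r * cexp t)" "p (of_real s * cexp t)"] by linarith
  qed
  have "integrable circle d"
    by (rule finite_measure.integrable_const_bound[OF finite_measure_circle, of _ "2 * M"]) (use db P in auto)
  thus int: "integrable circle (\<lambda>t. norm (p (of_real r * cexp t) - p (of_real s * cexp t)))"
    by (simp add: d_def)
  have int2: "integrable circle (\<lambda>t. (norm (d t))\<^sup>2)"
  proof (rule finite_measure.integrable_const_bound[OF finite_measure_circle, of _ "(2 * M)\<^sup>2"])
    have "(norm (d t))\<^sup>2 \<le> (2 * M)\<^sup>2" for t using db by (intro power_mono) auto
    thus "AE t in circle. norm ((norm (d t))\<^sup>2) \<le> (2 * M)\<^sup>2" by (intro AE_I2) simp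
  qed (use P(2) in auto)
  have L2: "(LINT t|circle. (norm (d t))\<^sup>2) \<le> 2 * pi * (2 * defect r + 2 * defect s)"
  proof -
    have up: "(\<lambda>n. 2 * ((norm (a n))\<^sup>2 * (1 - r ^ n)\<^sup>2) + 2 * ((norm (a n))\<^sup>2 * (1 - s ^ n)\<^sup>2)) sums (2 * defect r + 2 * defect s)"
      unfolding defect_def by (intro sums_add sums_mult summable_sums summable_defect r s)
    have le: "(norm (b n))\<^sup>2 \<le> 2 * ((norm (a n))\<^sup>2 * (1 - r ^ n)\<^sup>2) + 2 * ((norm (a n))\<^sup>2 * (1 - s ^ n)\<^sup>2)" for n
    proof -
      have "b n = a n * of_real (r ^ n - s ^ n)" by (simp add: b_def algebra_simps)
      hence "(norm (b n))\<^sup>2 = (norm (a n))\<^sup>2 * (r ^ n - s ^ n)\<^sup>2"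
        by (simp add: norm_mult power_mult_distrib del: of_real_diff of_real_power)
      also have "(r ^ n - s ^ n)\<^sup>2 \<le> 2 * (1 - r ^ n)\<^sup>2 + 2 * (1 - s ^ n)\<^sup>2"
      proof -
        have "0 \<le> ((1 - r ^ n) + (1 - s ^ n))\<^sup>2" by simp
        thus ?thesis by (simp add: power2_eq_square algebra_simps)
      qed
      hence "(norm (a n))\<^sup>2 * (r ^ n - s ^ n)\<^sup>2 \<le> (norm (a n))\<^sup>2 * (2 * (1 - r ^ n)\<^sup>2 + 2 * (1 - s ^ n)\<^sup>2)"
        by (rule mult_left_mono) simp
      finally show ?thesis by (simp add: algebra_simps)
    qed
    have "(LINT t|circle. (norm (d t))\<^sup>2) / (2 * pi) \<le> 2 * defect r + 2 * defect s"
      by (rule sums_le[OF le P(1) up])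
    thus ?thesis by (simp add: divide_le_eq mult.commute)
  qed
  have "(LINT t|circle. norm (d t)) \<le> (LINT t|circle. \<mu> * (norm (d t))\<^sup>2 + 1 / \<mu>)"
  proof (rule integral_mono)
    show "integrable circle (\<lambda>t. norm (d t))" using int by (simp add: d_def)
    show "integrable circle (\<lambda>t. \<mu> * (norm (d t))\<^sup>2 + 1 / \<mu>)"
      using int2 integrable_circle[of "\<lambda>_. 1 / \<mu>" "\<bar>1 / \<mu>\<bar>"] by (intro Bochner_Integration.integrable_add) auto
    fix t
    \<comment> \<open>This yields x \<le> \<mu> x^2 + 1 / \<mu>, a substitute for the Cauchy-Schwarz
      inequality.\<close>
    have "0 \<le> (\<mu> * norm (d t) - 1)\<^sup>2 + \<mu> * norm (d t)" using lam by (intro add_nonneg_nonneg) auto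
    hence "\<mu> * norm (d t) \<le> \<mu> * (\<mu> * (norm (d t))\<^sup>2 + 1 / \<mu>)"
      using lam by (simp add: power2_eq_square algebra_simps)
    thus "norm (d t) \<le> \<mu> * (norm (d t))\<^sup>2 + 1 / \<mu>" using lam by (simp only: mult_le_cancel_left_pos)
  qed
  also have "\<dots> = \<mu> * (LINT t|circle. (norm (d t))\<^sup>2) + 2 * pi * (1 / \<mu>)"
    using int2 integrable_circle[of "\<lambda>_. 1 / \<mu>" "\<bar>1 / \<mu>\<bar>"]
    by (simp add: Bochner_Integration.integral_add integral_const_circle del: lebesgue_integral_const)
  also have "\<dots> \<le> \<mu> * (2 * pi * (2 * defect r + 2 * defect s)) + 2 * pi * (1 / \<mu>)"
    using L2 lam by (intro add_right_mono mult_left_mono) auto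
  finally show "(LINT t|circle. norm (p (of_real r * cexp t) - p (of_real s * cexp t)))
       \<le> 2 * pi * (\<mu> * (2 * defect r + 2 * defect s) + 1 / \<mu>)"
    by (simp add: d_def algebra_simps)
qed

text \<open>Consecutive differences have summable L1 norms, so for almost every t the telescoping
  series converges absolutely.\<close>

lemma AE_circle_convergent:
  assumes s: "\<And>j. 0 \<le> s j" "\<And>j. s j < 1" and fast: "\<And>j. defect (s j) \<le> (1 / 4) ^ j"
  shows "AE t in circle. convergent (\<lambda>j. p (of_real (s j) * cexp t))"
proof -
  define D where "D = (\<lambda>j t. norm (p (of_real (s (Suc j)) * cexp t) - p (of_real (s j) * cexp t)))"
  have int: "integrable circle (D j)" for j unfolding D_def by (rule L1_diff(1)[where \<mu> = 1]) (use s in auto)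
  have le: "(LINT t|circle. D j t) \<le> (10 * pi) * (1 / 2) ^ j" for j
  proof -
    \<comment> \<open>The choice \<mu> = 2^j balances the defects, of order 4^(-j), against 1 /
      \<mu>; the sum is 2 \<pi> (4 + 1) 2^(-j).\<close>
    have "(LINT t|circle. D j t) \<le> 2 * pi * (2 ^ j * (2 * defect (s (Suc j)) + 2 * defect (s j)) + 1 / 2 ^ j)"
      unfolding D_def by (rule L1_diff(2)) (use s in auto)
    also have "\<dots> \<le> 2 * pi * (2 ^ j * (2 * (1 / 4) ^ j + 2 * (1 / 4) ^ j) + 1 / 2 ^ j)"
    proof -
      have "defect (s (Suc j)) \<le> (1 / 4) ^ j"
        using fast[of "Suc j"] defect_nonneg[OF s(1)[of "Suc j"] s(2)] by simp
      thus ?thesis using fast[of j] by (intro mult_left_mono add_right_mono) auto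
    qed
    also have "\<dots> = (10 * pi) * (1 / 2) ^ j"
    proof -
      have *: "(2::real) ^ j * (1 / 4) ^ j = (1 / 2) ^ j" by (simp add: power_mult_distrib[symmetric])
      have "2 * pi * (2 ^ j * (2 * (1 / 4) ^ j + 2 * (1 / 4) ^ j) + 1 / 2 ^ j) =
          8 * pi * (2 ^ j * (1 / 4) ^ j) + 2 * pi * (1 / 2 ^ j)"
        by (simp add: algebra_simps)
      also have "\<dots> = (10 * pi) * (1 / 2) ^ j" unfolding * by (simp add: power_one_over)
      finally show ?thesis .
    qed
    finally show ?thesis .
  qed
  have "(\<integral>\<^sup>+ t. (\<Sum>j. ennreal (D j t)) \<partial>circle) = (\<Sum>j. (\<integral>\<^sup>+ t. ennreal (D j t) \<partial>circle))"
    by (intro nn_integral_suminf measurable_compose[OF borel_measurable_integrable[OF int] measurable_ennreal])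
  also have "\<dots> = (\<Sum>j. ennreal (LINT t|circle. D j t))"
    by (intro suminf_cong nn_integral_eq_integral int) (auto simp: D_def)
  also have "\<dots> \<le> (\<Sum>j. ennreal ((10 * pi) * (1 / 2) ^ j))"
    using le by (intro suminf_le) (auto intro: ennreal_leI)
  also have "\<dots> = ennreal (\<Sum>j. (10 * pi) * (1 / 2) ^ j)"
    by (rule suminf_ennreal2) (auto intro!: summable_mult summable_geometric)
  also have "\<dots> < \<infinity>" by simp
  finally have "(\<integral>\<^sup>+ t. (\<Sum>j. ennreal (D j t)) \<partial>circle) \<noteq> \<infinity>" by simp
  hence "AE t in circle. (\<Sum>j. ennreal (D j t)) \<noteq> \<infinity>"
    by (intro nn_integral_noteq_infinite borel_measurable_suminf_order
          measurable_compose[OF borel_measurable_integrable[OF int] measurable_ennreal])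
  thus ?thesis
  proof eventually_elim
    case (elim t)
    have "summable (\<lambda>j. D j t)"
      by (rule summable_suminf_not_top) (use elim in \<open>auto simp: D_def\<close>)
    hence "summable (\<lambda>j. p (of_real (s (Suc j)) * cexp t) - p (of_real (s j) * cexp t))"
      unfolding D_def by (rule summable_norm_cancel)
    hence "convergent (\<lambda>n. \<Sum>j<n. p (of_real (s (Suc j)) * cexp t) - p (of_real (s j) * cexp t))"
      by (simp only: summable_iff_convergent)
    hence "convergent (\<lambda>n. p (of_real (s n) * cexp t) - p (of_real (s 0) * cexp t))"
      by (simp only: sum_lessThan_telescope[where f = "\<lambda>n. p (of_real (s n) * cexp t)"])
    from convergent_add[OF this convergent_const[of "p (of_real (s 0) * cexp t)"]]
    show ?case by simp
  qed
qed

end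

text \<open>The union of the exceptional rays is the smooth image of a null set of the form \<open>\<real> \<times> N\<close>.\<close>

lemma AE_circle_imp_AE_plane:
  assumes "AE t in circle. P (cexp t)"
  shows "AE z in lborel. z \<noteq> 0 \<longrightarrow> P (sgn z)"
proof -
  have "AE t in lborel. t \<in> {0..2 * pi} \<longrightarrow> P (cexp t)"
    using assms unfolding circle_def by (subst (asm) AE_restrict_space_iff) auto
  then obtain N where N: "N \<in> null_sets lborel" "{t. \<not> (t \<in> {0..2 * pi} \<longrightarrow> P (cexp t))} \<subseteq> N"
    unfolding eventually_ae_filter by auto
  have "UNIV \<times> N \<in> null_sets (lborel \<Otimes>\<^sub>M lborel)"
  proof (rule null_setsI)
    show "emeasure (lborel \<Otimes>\<^sub>M lborel) (UNIV \<times> N) = 0"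
      using N by (subst lborel.emeasure_pair_measure_Times) (auto simp: null_sets_def)
    show "UNIV \<times> N \<in> sets (lborel \<Otimes>\<^sub>M lborel)"
      using N by (intro pair_measureI) (auto simp: null_sets_def)
  qed
  hence "negligible ((UNIV :: real set) \<times> N)"
    unfolding lborel_prod negligible_iff_null_sets by (rule null_sets_completionI)
  moreover have "(\<lambda>(x, t). of_real x * cexp t) differentiable_on (UNIV \<times> N)"
  proof (intro differentiable_at_imp_differentiable_on)
    fix x :: "real \<times> real"
    have d: "((\<lambda>p. complex_of_real (fst p)) has_derivative (\<lambda>v. of_real (fst v))) (at x)"
      "((\<lambda>p. complex_of_real (snd p)) has_derivative (\<lambda>v. of_real (snd v))) (at x)"
      by (auto intro!: has_derivative_of_real derivative_intros)
    have "((\<lambda>p. cexp (snd p)) has_derivative (\<lambda>v. exp (\<i> * of_real (snd x)) * (\<i> * of_real (snd v)))) (at x)"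
      unfolding cexp_def
      using has_derivative_compose[OF has_derivative_mult_right[OF d(2)] DERIV_exp[unfolded has_field_derivative_def], of \<i>] .
    from has_derivative_mult[OF d(1) this]
    show "(\<lambda>(x, t). of_real x * cexp t) differentiable at x"
      unfolding case_prod_beta differentiable_def by blast
  qed
  ultimately have "negligible ((\<lambda>(x, t). of_real x * cexp t) ` (UNIV \<times> N))"
    by (intro negligible_differentiable_image_negligible) auto
  hence "(\<lambda>(x, t). of_real x * cexp t) ` (UNIV \<times> N) \<in> null_sets lebesgue"
    by (simp add: negligible_iff_null_sets)
  hence "AE z in lebesgue. z \<notin> (\<lambda>(x, t). of_real x * cexp t) ` (UNIV \<times> N)"
    by (rule AE_not_in)
  hence "AE z in lborel. z \<notin> (\<lambda>(x, t). of_real x * cexp t) ` (UNIV \<times> N)"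
    by (simp only: AE_completion_iff)
  thus ?thesis
  proof eventually_elim
    case (elim z)
    show ?case
    proof
      assume z: "z \<noteq> 0"
      define t where "t = Arg2pi z"
      have zt: "z = of_real (norm z) * cexp t" unfolding t_def cexp_def by (rule Arg2pi_eq)
      have t: "t \<in> {0..2 * pi}" using Arg2pi[of z] by (simp add: t_def)
      have "sgn z = cexp t"
      proof -
        have "sgn z = z / of_real (norm z)" by (simp add: sgn_div_norm scaleR_conv_of_real divide_inverse mult.commute)
        also have "\<dots> = cexp t" using z by (subst zt) simp
        finally show ?thesis .
      qed
      moreover have "t \<notin> N" using elim zt by force
      ultimately show "P (sgn z)" using N(2) t by auto
    qed
  qed
qed

text \<open>A single sequence has to serve both functions, because the coefficients of the extension
  combine h and q at the same point. So each s j is taken close enough to 1 for both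
  defects.\<close>

lemma AE_radial_convergent:
  assumes "bounded_disc_fun p M" "bounded_disc_fun q M'"
  obtains s where "s \<longlonglongrightarrow> 1" "\<And>j. 0 \<le> s j" "\<And>j. s j < (1::real)"
    "AE z in lborel. z \<noteq> 0 \<longrightarrow> convergent (\<lambda>j. p (of_real (s j) * sgn z))"
    "AE z in lborel. z \<noteq> 0 \<longrightarrow> convergent (\<lambda>j. q (of_real (s j) * sgn z))"
proof -
  interpret p: bounded_disc_fun p M by fact
  interpret q: bounded_disc_fun q M' by fact
  have "\<exists>r. 0 \<le> r \<and> r < 1 \<and> 1 - 1 / real (Suc j) < r \<and> p.defect r \<le> (1 / 4) ^ j \<and> q.defect r \<le> (1 / 4) ^ j" for j
  proof -
    have "\<forall>\<^sub>F r in at_left 1. p.defect r < (1 / 4) ^ j" "\<forall>\<^sub>F r in at_left 1. q.defect r < (1 / 4) ^ j"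
      using order_tendstoD(2)[OF p.defect_tendsto, of "(1 / 4) ^ j"] order_tendstoD(2)[OF q.defect_tendsto, of "(1 / 4) ^ j"] by auto
    moreover have "\<forall>\<^sub>F r in at_left 1. r \<in> {1 - 1 / real (Suc j)<..<1}"
      by (rule eventually_at_left_real) simp
    ultimately have "\<forall>\<^sub>F r in at_left 1. 0 \<le> r \<and> r < 1 \<and> 1 - 1 / real (Suc j) < r \<and> p.defect r \<le> (1 / 4) ^ j \<and> q.defect r \<le> (1 / 4) ^ j"
    proof eventually_elim
      case (elim r)
      have "0 \<le> 1 - 1 / real (Suc j)" by simp
      moreover have "1 - 1 / real (Suc j) < r" "r < 1" using elim(3) by simp_all
      ultimately show ?case using elim(1,2) by linarith
    qed
    moreover have "at_left (1::real) \<noteq> bot" by simp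
    ultimately show ?thesis using eventually_happens' by blast
  qed
  then obtain s where s: "\<And>j. 0 \<le> s j" "\<And>j. s j < 1" "\<And>j. 1 - 1 / real (Suc j) < s j"
    "\<And>j. p.defect (s j) \<le> (1 / 4) ^ j" "\<And>j. q.defect (s j) \<le> (1 / 4) ^ j"
    by metis
  have "s \<longlonglongrightarrow> 1"
  proof (rule tendsto_sandwich)
    have "(\<lambda>n. 1 - 1 / real (Suc n)) \<longlonglongrightarrow> 1 - 0"
      by (intro tendsto_diff tendsto_const LIMSEQ_Suc lim_1_over_n)
    thus "(\<lambda>n. 1 - 1 / real (Suc n)) \<longlonglongrightarrow> 1" by simp
  qed (use s(2,3) in \<open>auto intro!: always_eventually less_imp_le\<close>)
  thus ?thesis
    by (rule that[OF _ s(1,2) AE_circle_imp_AE_plane[OF p.AE_circle_convergent[OF s(1,2,4)]]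
          AE_circle_imp_AE_plane[OF q.AE_circle_convergent[OF s(1,2,5)]]])
qed

subsection \<open>Quasiconformality of the extension\<close>

text \<open>Any circle can be moved through circles to a small one about 0. Injectivity keeps the
  image loop off the image of the centre, and on the small circle F - F 0 is so close to the
  identity that the winding number is 1.\<close>

lemma sense_preserving_of_injective:
  assumes cont: "continuous_on UNIV F" and inj: "inj F"
    and e: "e > 0" "\<And>w. norm w = e \<Longrightarrow> norm (F w - F 0 - w) < norm w"
  shows "sense_preserving UNIV F"
  unfolding sense_preserving_def
proof (intro allI impI)
  fix z :: complex and r :: real
  assume r: "0 < r \<and> cball z r \<subseteq> UNIV"
  define cp where "cp = (\<lambda>t. exp (2 * of_real pi * \<i> * complex_of_real t))"
  define R where "R = (\<lambda>s. (1 - s) * r + s * e)"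
  define Z where "Z = (\<lambda>s. of_real (1 - s) * z)"
  \<comment> \<open>Subtracting the image of the moving centre turns the task into a homotopy of
    loops that avoid 0.\<close>
  define H where "H = (\<lambda>(s, t). F (Z s + of_real (R s) * cp t) - F (Z s))"
  have R: "R s > 0" if "s \<in> {0..1}" for s
  proof (cases "s = 0")
    case False
    hence "(1 - s) * r \<ge> 0" "s * e > 0" using that r e by auto
    thus ?thesis by (simp add: R_def)
  qed (use r in \<open>simp add: R_def\<close>)
  have "homotopic_loops (- {0}) (\<lambda>t. F (circlepath z r t) - F z) (\<lambda>t. F (circlepath 0 e t) - F 0)"
    unfolding homotopic_loops
  proof (intro exI[of _ H] conjI ballI)
    show "continuous_on ({0..1} \<times> {0..1}) H"
      unfolding H_def case_prod_beta Z_def R_def cp_def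
      by (intro continuous_intros continuous_on_compose2[OF cont]) auto
    show "H \<in> {0..1} \<times> {0..1} \<rightarrow> - {0}"
    proof
      fix x :: "real \<times> real" assume x: "x \<in> {0..1} \<times> {0..1}"
      obtain s t where st: "x = (s, t)" by (cases x)
      have "of_real (R s) * cp t \<noteq> 0" using R[of s] x st by (auto simp: cp_def)
      hence "Z s + of_real (R s) * cp t \<noteq> Z s" by simp
      thus "H x \<in> - {0}" using inj by (auto simp: st H_def inj_eq)
    qed
    show "H (0, t) = F (circlepath z r t) - F z" for t
      by (simp add: H_def Z_def R_def cp_def circlepath)
    show "H (1, t) = F (circlepath 0 e t) - F 0" for t
      by (simp add: H_def Z_def R_def cp_def circlepath)
    show "pathfinish (H \<circ> Pair s) = pathstart (H \<circ> Pair s)" for s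
      by (simp add: pathfinish_def pathstart_def H_def cp_def)
  qed
  hence "winding_number (\<lambda>t. F (circlepath z r t) - F z) 0 = winding_number (\<lambda>t. F (circlepath 0 e t) - F 0) 0"
    by (rule winding_number_homotopic_loops)
  also have "\<dots> = winding_number (circlepath 0 e) 0"
  proof (rule winding_number_nearby_loops_eq)
    show "path (\<lambda>t. F (circlepath 0 e t) - F 0)"
      unfolding path_def using path_circlepath[of 0 e, unfolded path_def]
      by (intro continuous_intros continuous_on_compose2[OF cont]) auto
    show "pathfinish (\<lambda>t. F (circlepath 0 e t) - F 0) = pathstart (\<lambda>t. F (circlepath 0 e t) - F 0)"
      by (simp add: pathfinish_def pathstart_def circlepath)
    fix t :: real
    have "norm (circlepath 0 e t) = e" using e by (simp add: circlepath norm_mult)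
    from e(2)[OF this] show "norm (F (circlepath 0 e t) - F 0 - circlepath 0 e t) < norm (circlepath 0 e t - 0)" by simp
  qed auto
  also have "\<dots> = 1" by (rule winding_number_circlepath_centre[OF e(1)])
  finally show "winding_number (F \<circ> circlepath z r) (F z) = 1"
    unfolding winding_number_offset[of "F \<circ> circlepath z r"] by (simp add: comp_def)
qed

lemma disc_pt_outside: "norm z \<ge> 1 \<Longrightarrow> disc_pt r z = of_real r * sgn z"
  by (simp add: disc_pt_def sgn_div_norm max_def scaleR_conv_of_real divide_inverse mult_ac)

lemma disc_pt_inside: "norm z \<le> 1 \<Longrightarrow> disc_pt r z = of_real r * z"
  by (auto simp: disc_pt_def max_def)

context chain_data begin

text \<open>Near the origin the map is z (1 + W z) with W continuous and W 0 = 0, which is the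
  closeness to the identity required on a small circle.\<close>

lemma qc_ext_sense_preserving: "sense_preserving UNIV (qc_ext 1)"
proof -
  define W where "W = (\<lambda>z. exp ((l z + Ln c + Ln (K z)) / c) - 1)"
  have "continuous_on (ball 0 1) W" unfolding W_def
    by (intro continuous_intros continuous_on_subset[OF l_cont] continuous_on_subset[OF K_cont] K_slit) (auto simp: c_nz)
  hence "isCont W 0" by (simp add: continuous_on_eq_continuous_at)
  moreover have "W 0 = 0"
  proof -
    have "c \<notin> \<real>\<^sub>\<le>\<^sub>0" by (rule not_nonpos_Reals_if_Re_pos[OF Rec])
    thus ?thesis using Ln_inverse[of c] by (simp add: W_def l0 K0 inverse_eq_divide)
  qed
  ultimately have "(W \<longlongrightarrow> 0) (at 0)" by (simp add: isCont_def)
  hence "\<forall>\<^sub>F z in at 0. norm (W z) < 1" using tendstoD[of W 0 "at 0" 1] by simp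
  then obtain d where d: "d > 0" "\<And>z. z \<noteq> 0 \<Longrightarrow> norm z < d \<Longrightarrow> norm (W z) < 1"
    by (auto simp: eventually_at)
  define e where "e = min d 1 / 2"
  have e: "0 < e" "e < d" "e < 1" using d by (auto simp: e_def)
  show ?thesis
  proof (rule sense_preserving_of_injective[OF continuous_qc_ext qc_ext_inj e(1)])
    fix w :: complex assume w: "norm w = e"
    have w0: "w \<noteq> 0" using w e by auto
    have "qc_ext 1 w - qc_ext 1 0 - w = w * W w"
      using qc_ext_disc[of w] w e by (simp add: W_def qc_ext_def[of 1 0] algebra_simps)
    hence "norm (qc_ext 1 w - qc_ext 1 0 - w) = norm w * norm (W w)" by (simp only: norm_mult)
    also have "\<dots> < norm w * 1" using d(2)[OF w0] w w0 e by (intro mult_strict_left_mono) auto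
    finally show "norm (qc_ext 1 w - qc_ext 1 0 - w) < norm w" by simp
  qed auto
qed

lemma measurable_ext_z_ext_zbar:
  assumes r: "0 \<le> r" "r < 1"
  shows "ext_z r \<in> borel_measurable borel" "ext_zbar r \<in> borel_measurable borel"
proof -
  have [measurable]: "qc_ext r \<in> borel_measurable borel" using r by (intro continuous_borel continuous_qc_ext) auto
  have comp: "continuous_on UNIV (\<lambda>z. f (disc_pt r z))" if "f holomorphic_on ball 0 1" for f
    by (rule continuous_on_compose2[OF holomorphic_on_imp_continuous_on[OF that] continuous_disc_pt])
       (use disc_pt_ball[OF r] in auto)
  have [measurable]: "(\<lambda>z. kappa (disc_pt r z) (scale z)) \<in> borel_measurable borel"
    unfolding kappa_def by (intro continuous_borel continuous_intros comp K_hol continuous_scale)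
  have [measurable]: "(\<lambda>z. angular (disc_pt r z) (scale z)) \<in> borel_measurable borel"
    unfolding angular_def by (intro continuous_borel continuous_intros comp h_hol q_hol continuous_scale)
  have [measurable]: "radial r \<in> borel_measurable borel" unfolding radial_def by measurable
  have [measurable]: "cnj \<in> borel_measurable borel" by (intro continuous_borel continuous_intros)
  show "ext_z r \<in> borel_measurable borel" unfolding ext_z_def by measurable
  show "ext_zbar r \<in> borel_measurable borel" unfolding ext_zbar_def by measurable
qed

lemma AE_qc_ext_derivative:
  assumes r: "0 \<le> r" "r < 1"
  shows "AE z in lborel. (qc_ext r has_derivative (\<lambda>v. ext_z r z * v + ext_zbar r z * cnj v)) (at z)"
proof -
  \<comment> \<open>The second set is the real axis, which contains the cut of
    \<open>Ln\<close>.\<close>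
  have "negligible (sphere (0::complex) 1 \<union> {z. \<i> \<bullet> z = 0})"
    by (intro negligible_Un negligible_sphere negligible_hyperplane) auto
  hence "sphere (0::complex) 1 \<union> {z. \<i> \<bullet> z = 0} \<in> null_sets lebesgue"
    by (simp only: negligible_iff_null_sets)
  hence "AE z in lebesgue. z \<notin> sphere (0::complex) 1 \<union> {z. \<i> \<bullet> z = 0}" by (rule AE_not_in)
  hence "AE z in lborel. z \<notin> sphere (0::complex) 1 \<union> {z. \<i> \<bullet> z = 0}" by (simp only: AE_completion_iff)
  thus ?thesis
  proof eventually_elim
    case (elim z)
    show ?case by (rule qc_ext_derivative[OF r]) (use elim in \<open>auto simp: complex_nonpos_Reals_iff inner_complex_def\<close>)
  qed
qed

lemma qc_ext_quasiconformal: "quasiconformal_on k UNIV (qc_ext 1)"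
proof -
  have bdf: "bounded_disc_fun h M" "bounded_disc_fun q M"
    using h_hol q_hol hU qU U_upper by (auto simp: bounded_disc_fun_def)
  obtain s where s: "s \<longlonglongrightarrow> 1" "\<And>j. 0 \<le> s j" "\<And>j. s j < 1"
    and ch: "AE z in lborel. z \<noteq> 0 \<longrightarrow> convergent (\<lambda>j. h (of_real (s j) * sgn z))"
    and cq: "AE z in lborel. z \<noteq> 0 \<longrightarrow> convergent (\<lambda>j. q (of_real (s j) * sgn z))"
    by (rule AE_radial_convergent[OF bdf]) blast
  have s': "s j \<le> 1" for j using s(3)[of j] by simp
  \<comment> \<open>Inside the disc the points s j z tend to an interior point; from the circle on,
    \<open>disc_pt\<close> is s j times \<open>sgn z\<close>, and the radial limit is called
    for.\<close>
  have conv: "convergent (\<lambda>j. f (disc_pt (s j) z))"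
    if "f holomorphic_on ball 0 1" "z \<noteq> 0 \<longrightarrow> convergent (\<lambda>j. f (of_real (s j) * sgn z))" for f z
  proof (cases "norm z < 1")
    case True
    have "(\<lambda>j. f (of_real (s j) * z)) \<longlonglongrightarrow> f (of_real 1 * z)"
    proof (rule continuous_on_tendsto_compose[OF holomorphic_on_imp_continuous_on[OF that(1)]])
      show "(\<lambda>j. of_real (s j) * z) \<longlonglongrightarrow> of_real 1 * z" by (intro tendsto_intros s)
      have "norm (of_real (s j) * z) \<le> norm z" for j
        using s(2)[of j] s'[of j] by (simp add: norm_mult mult_left_le_one_le)
      hence "norm (of_real (s j) * z) < 1" for j using True order.strict_trans1 by blast
      thus "\<forall>\<^sub>F j in sequentially. of_real (s j) * z \<in> ball 0 1" by simp
    qed (use True in auto)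
    thus ?thesis using True by (auto simp: disc_pt_inside convergent_def)
  next
    case False
    hence "z \<noteq> 0" by auto
    thus ?thesis using that(2) False by (simp add: disc_pt_outside)
  qed
  have conv_ab: "AE z in lborel. convergent (\<lambda>j. ext_z (s j) z) \<and> convergent (\<lambda>j. ext_zbar (s j) z)"
    using ch cq
  proof eventually_elim
    case (elim z)
    obtain H Q where H: "(\<lambda>j. h (disc_pt (s j) z)) \<longlonglongrightarrow> H" and Q: "(\<lambda>j. q (disc_pt (s j) z)) \<longlonglongrightarrow> Q"
      using conv[OF h_hol elim(1)] conv[OF q_hol elim(2)] by (auto simp: convergent_def)
    have w: "(\<lambda>j. angular (disc_pt (s j) z) (scale z)) \<longlonglongrightarrow> of_real (scale z) * H + of_real (1 - scale z) * Q"
      unfolding angular_def by (intro tendsto_intros H Q)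
    have e: "(\<lambda>j. radial (s j) z) \<longlonglongrightarrow> (if norm z < 1 then of_real (scale z) * H + of_real (1 - scale z) * Q else 1)"
      using w by (simp add: radial_def)
    have F: "(\<lambda>j. qc_ext (s j) z) \<longlonglongrightarrow> qc_ext 1 z" by (rule qc_ext_tendsto[OF s(1,2) s'])
    have p: "(\<lambda>j. disc_pt (s j) z) \<longlonglongrightarrow> disc_pt 1 z" unfolding disc_pt_def by (intro tendsto_intros s)
    have "(\<lambda>j. K (disc_pt (s j) z)) \<longlonglongrightarrow> K (disc_pt 1 z)"
      by (rule continuous_on_tendsto_compose[OF K_cont p]) (use disc_pt_cball s s' in auto)
    hence kk: "(\<lambda>j. kappa (disc_pt (s j) z) (scale z)) \<longlonglongrightarrow> kappa (disc_pt 1 z) (scale z)"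
      unfolding kappa_def by (intro tendsto_intros)
    have k0: "c * kappa (disc_pt 1 z) (scale z) \<noteq> 0"
      using kappa_bounds(1)[OF disc_pt_cball[of 1 z] scale(2,3)[of z]] c_nz by auto
    \<comment> \<open>For y = 0, which occurs at the origin, the quotient is constantly 0 by
      convention.\<close>
    have quot: "convergent (\<lambda>j. qc_ext (s j) z / y)" for y
    proof (cases "y = 0")
      case False
      thus ?thesis using tendsto_divide[OF F tendsto_const False] by (auto simp: convergent_def)
    qed (auto intro: convergent_const)
    obtain y1 y2 where y: "(\<lambda>j. qc_ext (s j) z / z) \<longlonglongrightarrow> y1" "(\<lambda>j. qc_ext (s j) z / cnj z) \<longlonglongrightarrow> y2"
      using quot by (meson convergent_def)
    have "convergent (\<lambda>j. ext_z (s j) z)" unfolding ext_z_def convergent_def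
      by (rule exI, rule tendsto_mult[OF tendsto_divide[OF y(1) tendsto_mult[OF tendsto_const kk] k0]
            tendsto_divide[OF tendsto_add[OF e w] tendsto_const]]) simp
    moreover have "convergent (\<lambda>j. ext_zbar (s j) z)" unfolding ext_zbar_def convergent_def
      by (rule exI, rule tendsto_mult[OF tendsto_divide[OF y(2) tendsto_mult[OF tendsto_const kk] k0]
            tendsto_divide[OF tendsto_diff[OF e w] tendsto_const]]) simp
    ultimately show ?case ..
  qed
  \<comment> \<open>\<open>lim\<close> is total, so u and v are Borel functions on the whole plane;
    off a null set they are genuine limits.\<close>
  define u v where "u = (\<lambda>z. lim (\<lambda>j. ext_z (s j) z))" and "v = (\<lambda>z. lim (\<lambda>j. ext_zbar (s j) z))"
  have meas: "ext_z (s j) \<in> borel_measurable borel" "ext_zbar (s j) \<in> borel_measurable borel" for j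
    by (rule measurable_ext_z_ext_zbar[OF s(2,3)])+
  have um: "u \<in> borel_measurable borel" and vm: "v \<in> borel_measurable borel"
    unfolding u_def v_def by (intro borel_measurable_lim_metric meas)+
  have ulim: "AE z in lborel. (\<lambda>j. ext_z (s j) z) \<longlonglongrightarrow> u z"
    using conv_ab by eventually_elim (simp add: u_def convergent_LIMSEQ_iff)
  have vlim: "AE z in lborel. (\<lambda>j. ext_zbar (s j) z) \<longlonglongrightarrow> v z"
    using conv_ab by eventually_elim (simp add: v_def convergent_LIMSEQ_iff)
  have abound: "\<exists>C. \<forall>j z. norm z \<le> R \<longrightarrow> norm (ext_z (s j) z) \<le> C" for R
    using ext_z_bound[of R] s by metis
  have bbound: "\<exists>C. \<forall>j z. norm z \<le> R \<longrightarrow> norm (ext_zbar (s j) z) \<le> C" for R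
  proof -
    obtain C where C: "\<forall>j z. norm z \<le> R \<longrightarrow> norm (ext_z (s j) z) \<le> C" using abound by blast
    have "norm (ext_zbar (s j) z) \<le> C" if "norm z \<le> R" for j z
    proof -
      have "norm (ext_zbar (s j) z) \<le> k * norm (ext_z (s j) z)" by (rule ext_zbar_le_ext_z[OF s(2,3)])
      also have "\<dots> \<le> norm (ext_z (s j) z)" using k by (simp add: mult_left_le_one_le)
      finally show ?thesis using C that by (meson order_trans)
    qed
    thus ?thesis by blast
  qed
  have locint: "locally_integrable UNIV f"
    if f: "f \<in> borel_measurable borel" and lim: "AE z in lborel. (\<lambda>j. fs j z) \<longlonglongrightarrow> f z"
      and b: "\<And>R. \<exists>C. \<forall>j z. norm z \<le> R \<longrightarrow> norm (fs j z :: complex) \<le> C" for f :: "complex \<Rightarrow> complex" and fs :: "nat \<Rightarrow> complex \<Rightarrow> complex"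
    unfolding locally_integrable_def
  proof (intro allI impI)
    fix X :: "complex set" assume X: "compact X \<and> X \<subseteq> UNIV"
    then obtain R where R: "X \<subseteq> ball 0 R"
      using bounded_subset_ballD[of X 0] compact_imp_bounded by blast
    obtain C where C: "\<forall>j z. norm z \<le> R \<longrightarrow> norm (fs j z) \<le> C" using b by blast
    have meas: "(\<lambda>x. indicator X x *\<^sub>R f x) \<in> borel_measurable borel"
      using f X by (intro borel_measurable_scaleR borel_measurable_indicator) (auto simp: borel_compact)
    have "integrable lborel (\<lambda>x. indicator X x *\<^sub>R f x)"
    proof (rule Bochner_Integration.integrable_bound[OF integrable_indicator_cball[of C R]])
      show "AE z in lborel. norm (indicator X z *\<^sub>R f z) \<le> norm (C * indicator (cball 0 R) z)"
        using lim
      proof eventually_elim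
        case (elim z)
        show ?case
        proof (cases "z \<in> X")
          case True
          hence z: "norm z \<le> R" using R by auto
          have "norm (f z) \<le> C" by (rule LIMSEQ_le_const2[OF tendsto_norm[OF elim]]) (use C z in auto)
          thus ?thesis using True z by simp
        qed simp
      qed
    qed (use meas in simp)
    thus "f absolutely_integrable_on X"
      unfolding set_integrable_def using integrable_completion[of "\<lambda>x. indicator X x *\<^sub>R f x" lborel] meas by simp
  qed
  have LipF: "\<exists>C. \<forall>z w. norm z \<le> R \<longrightarrow> norm w \<le> R \<longrightarrow> norm (qc_ext r z - qc_ext r w) \<le> C * norm (z - w)"
    if "0 \<le> r" "r \<le> 1" for R r
    using qc_ext_Lipschitz[of R] that by metis
  have Fb: "\<exists>C. \<forall>j z. norm z \<le> R \<longrightarrow> norm (qc_ext (s j) z) \<le> C" for R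
  proof -
    obtain C where C: "C > 0" "\<And>r z. 0 \<le> r \<Longrightarrow> r \<le> 1 \<Longrightarrow> norm z \<le> R \<Longrightarrow> norm (qc_ext r z) \<le> C * norm z"
      by (rule qc_ext_bound[of R]) blast
    have "norm (qc_ext (s j) z) \<le> C * R" if z: "norm z \<le> R" for j z
      using C(2)[OF s(2) s' z, of j] mult_left_mono[OF z, of C] C(1) by linarith
    thus ?thesis by blast
  qed
  have int_eq: "(LINT z:UNIV|lebesgue. f z * g z) = (LINT z|lborel. f z * g z)"
    if "f \<in> borel_measurable borel" "continuous_on UNIV g" for f g :: "complex \<Rightarrow> complex"
    unfolding set_lebesgue_integral_def using that continuous_borel[OF that(2)]
    by (simp add: integral_completion)
  have F1m: "qc_ext 1 \<in> borel_measurable borel" by (intro continuous_borel continuous_qc_ext) auto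
  \<comment> \<open>Dominated convergence on both sides of the identity for s j; \<phi> and \<psi>
    confine the integrals to a disc on which the bounds are uniform in j.\<close>
  have pass: "(LINT z|lborel. f z * \<phi> z) = - (LINT z|lborel. qc_ext 1 z * \<psi> z)"
    if \<phi>: "continuous_on UNIV \<phi>" "\<And>z. norm z > R \<Longrightarrow> \<phi> z = 0"
      and \<psi>: "continuous_on UNIV \<psi>" "\<And>z. norm z > R \<Longrightarrow> \<psi> z = 0"
      and fs: "\<And>j. fs j \<in> borel_measurable borel" "f \<in> borel_measurable borel"
        "AE z in lborel. (\<lambda>j. fs j z) \<longlonglongrightarrow> f z" "\<And>R. \<exists>C. \<forall>j z. norm z \<le> R \<longrightarrow> norm (fs j z :: complex) \<le> C"
      and eq: "\<And>j. (LINT z|lborel. fs j z * \<phi> z) = - (LINT z|lborel. qc_ext (s j) z * \<psi> z)"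
    for f \<phi> \<psi> R and fs :: "nat \<Rightarrow> complex \<Rightarrow> complex"
  proof -
    obtain C where C: "\<forall>j z. norm z \<le> R \<longrightarrow> norm (fs j z) \<le> C" using fs(4) by blast
    obtain C' where C': "\<forall>j z. norm z \<le> R \<longrightarrow> norm (qc_ext (s j) z) \<le> C'" using Fb by blast
    have 1: "(\<lambda>j. LINT z|lborel. fs j z * \<phi> z) \<longlonglongrightarrow> (LINT z|lborel. f z * \<phi> z)"
      by (rule integral_mult_tendsto[OF \<phi> fs(1-3), where C = C]) (use C in auto)
    have 2: "(\<lambda>j. LINT z|lborel. qc_ext (s j) z * \<psi> z) \<longlonglongrightarrow> (LINT z|lborel. qc_ext 1 z * \<psi> z)"
      by (rule integral_mult_tendsto[OF \<psi>, where C = C' and u = "\<lambda>j. qc_ext (s j)"])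
         (use C' F1m qc_ext_tendsto[OF s(1,2) s'] in \<open>auto intro!: continuous_borel continuous_qc_ext s s'\<close>)
    show ?thesis using LIMSEQ_unique[OF 1] tendsto_minus[OF 2] unfolding eq by blast
  qed
  have dist: "distr_dz UNIV (qc_ext 1) u" "distr_dzbar UNIV (qc_ext 1) v"
  proof -
    have "(LINT z:UNIV|lebesgue. u z * \<phi> z) = - (LINT z:UNIV|lebesgue. qc_ext 1 z * wirtinger \<phi> z)
        \<and> (LINT z:UNIV|lebesgue. v z * \<phi> z) = - (LINT z:UNIV|lebesgue. qc_ext 1 z * wirtinger_bar \<phi> z)"
      if test: "test_function UNIV \<phi>" for \<phi>
    proof -
      obtain R C where RC: "R > 0" "C \<ge> 0"
        and zero: "\<And>z. norm z > R \<Longrightarrow> \<phi> z = 0 \<and> partial_x \<phi> z = 0 \<and> partial_y \<phi> z = 0"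
        and c\<phi>: "continuous_on UNIV \<phi>" "continuous_on UNIV (partial_x \<phi>)" "continuous_on UNIV (partial_y \<phi>)"
        and d\<phi>: "\<And>z. (\<phi> has_derivative (\<lambda>v. of_real (Re v) * partial_x \<phi> z + of_real (Im v) * partial_y \<phi> z)) (at z)"
        and L\<phi>: "\<And>z w. norm (\<phi> z - \<phi> w) \<le> C * norm (z - w)"
        by (rule test_function_facts[OF test]) blast
      have cw: "continuous_on UNIV (wirtinger \<phi>)" "continuous_on UNIV (wirtinger_bar \<phi>)"
        unfolding wirtinger_def wirtinger_bar_def by (intro continuous_intros c\<phi>; simp)+
      have zw: "wirtinger \<phi> z = 0" "wirtinger_bar \<phi> z = 0" if "norm z > R" for z
        using zero[OF that] by (simp_all add: wirtinger_def wirtinger_bar_def)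
      have z\<phi>: "\<phi> z = 0" if "norm z > R" for z using zero[OF that] by simp
      have ab1: "\<exists>C. \<forall>z. norm z \<le> R \<longrightarrow> norm (ext_z (s j) z) \<le> C" "\<exists>C. \<forall>z. norm z \<le> R \<longrightarrow> norm (ext_zbar (s j) z) \<le> C" for R j
        using abound[of R] bbound[of R] by blast+
      note weak = weak_wirtinger_derivatives[OF LipF[OF s(2) s'] continuous_qc_ext[OF s(2) s'] meas ab1
          AE_qc_ext_derivative[OF s(2,3)] test]
      have "(LINT z|lborel. u z * \<phi> z) = - (LINT z|lborel. qc_ext 1 z * wirtinger \<phi> z)"
        by (rule pass[OF c\<phi>(1) z\<phi> cw(1) zw(1) meas(1) um ulim abound weak(1)])
      moreover have "(LINT z|lborel. v z * \<phi> z) = - (LINT z|lborel. qc_ext 1 z * wirtinger_bar \<phi> z)"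
        by (rule pass[OF c\<phi>(1) z\<phi> cw(2) zw(2) meas(2) vm vlim bbound weak(2)])
      ultimately show ?thesis by (simp only: int_eq[OF um c\<phi>(1)] int_eq[OF vm c\<phi>(1)] int_eq[OF F1m cw(1)] int_eq[OF F1m cw(2)])
    qed
    thus "distr_dz UNIV (qc_ext 1) u" "distr_dzbar UNIV (qc_ext 1) v"
      unfolding distr_dz_def distr_dzbar_def
      using locint[OF um ulim abound] locint[OF vm vlim bbound] by blast+
  qed
  have "AE z in lborel. norm (v z) \<le> k * norm (u z)"
    using ulim vlim
  proof eventually_elim
    case (elim z)
    show ?case
      by (rule LIMSEQ_le[OF tendsto_norm[OF elim(2)] tendsto_mult_left[OF tendsto_norm[OF elim(1)], of k]])
         (use ext_zbar_le_ext_z[OF s(2,3)] in auto)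
  qed
  hence AE: "AE z in lebesgue. z \<in> UNIV \<longrightarrow> norm (v z) \<le> k * norm (u z)"
    by (simp add: AE_completion_iff)
  obtain G where "homeomorphism UNIV (qc_ext 1 ` UNIV) (qc_ext 1) G"
    by (rule invariance_of_domain_homeomorphism[OF open_UNIV continuous_qc_ext order_refl qc_ext_inj]) auto
  thus ?thesis unfolding quasiconformal_on_def
    using k qc_ext_sense_preserving dist AE by blast
qed

lemma qc_ext_automorphism: "quasiconformal_automorphism k (qc_ext 1)"
  using qc_ext_quasiconformal qc_ext_surj by (simp add: quasiconformal_automorphism_def)

end

text \<open>The bound on z f' controls f' away from the origin, compactness controls it near the
  origin, so f is Lipschitz. This gives l and K the boundary values that h and q may lack.\<close>

lemma extend_to_closed_disc:
  assumes f: "f holomorphic_on ball 0 1" and b: "\<And>z. z \<in> ball 0 1 \<Longrightarrow> norm (z * deriv f z) \<le> C"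
  obtains g where "continuous_on (cball 0 1) g" "\<And>z. z \<in> ball 0 1 \<Longrightarrow> g z = f z"
    "g holomorphic_on ball 0 1" "\<And>z. z \<in> ball 0 1 \<Longrightarrow> deriv g z = deriv f z"
proof -
  have cd: "continuous_on (cball 0 (1 / 2)) (deriv f)"
    by (rule continuous_on_subset[OF holomorphic_on_imp_continuous_on[OF holomorphic_deriv[OF f]]]) auto
  have "bounded (deriv f ` cball 0 (1 / 2))"
    by (rule compact_imp_bounded[OF compact_continuous_image[OF cd compact_cball]])
  then obtain B where "\<forall>y\<in>deriv f ` cball 0 (1 / 2). norm y \<le> B"
    unfolding bounded_iff by blast
  hence B: "norm (deriv f z) \<le> B" if "norm z \<le> 1 / 2" for z using that by simp
  \<comment> \<open>The factor 2 accounts for division by |z| > 1 / 2.\<close>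
  define L where "L = max B (2 * C)"
  have C0: "C \<ge> 0" using b[of 0] by simp
  have dL: "norm (deriv f z) \<le> L" if z: "z \<in> ball 0 1" for z
  proof (cases "norm z \<le> 1 / 2")
    case True
    thus ?thesis using B[OF True] by (simp add: L_def)
  next
    case False
    hence "1 / 2 * norm (deriv f z) \<le> norm z * norm (deriv f z)" by (intro mult_right_mono) auto
    thus ?thesis using b[OF z] by (simp add: L_def norm_mult)
  qed
  have lip: "L-lipschitz_on (ball 0 1) f"
  proof (rule lipschitz_onI)
    show "L \<ge> 0" using C0 by (simp add: L_def)
    fix x y :: complex assume "x \<in> ball 0 1" "y \<in> ball 0 1"
    thus "dist (f x) (f y) \<le> L * dist x y" unfolding dist_norm
      by (intro field_differentiable_bound[where S = "ball 0 1" and f' = "deriv f"])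
         (use dL holomorphic_derivI[OF f] in auto)
  qed
  obtain g where g: "uniformly_continuous_on (closure (ball 0 1)) g" "\<And>x. x \<in> ball 0 1 \<Longrightarrow> f x = g x"
    by (rule uniformly_continuous_on_extension_on_closure[OF lipschitz_on_uniformly_continuous[OF lip]]) blast
  show ?thesis
  proof (rule that[of g])
    show "continuous_on (cball 0 1) g" using uniformly_continuous_imp_continuous[OF g(1)] by simp
    show "g z = f z" if "z \<in> ball 0 1" for z using g(2)[OF that] by simp
    show "g holomorphic_on ball 0 1" by (rule holomorphic_transform[OF f g(2)])
    fix z :: complex assume z: "z \<in> ball 0 1"
    have "(f has_field_derivative deriv f z) (at z)" using holomorphic_derivI[OF f _ z] by auto
    hence "(g has_field_derivative deriv f z) (at z)"
      by (rule has_field_derivative_transform_within_open[OF _ open_ball z g(2)])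
    thus "deriv g z = deriv f z" by (rule DERIV_imp_deriv)
  qed
qed

theorem theorem5:
  fixes \<alpha> \<beta> k :: real and f g h :: "complex \<Rightarrow> complex"
  assumes "\<alpha> > 0" and "0 \<le> k" and "k < 1"
    and "f \<in> bazilevic \<alpha> \<beta>"
    and "bazilevic_rep \<alpha> \<beta> g h f"
    and "\<And>z. z \<in> unit_disc \<Longrightarrow> h z \<in> U k"
    and "\<And>z. z \<in> unit_disc \<Longrightarrow> \<i> * of_real \<beta> + of_real \<alpha> * log_quot g z \<in> U k"
  shows "\<exists>F. quasiconformal_automorphism k F \<and> (\<forall>z\<in>unit_disc. F z = f z)"
proof -
  define c where "c = complex_of_real \<alpha> + \<i> * complex_of_real \<beta>"
  define q where "q = (\<lambda>z. \<i> * complex_of_real \<beta> + complex_of_real \<alpha> * log_quot g z)"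
  have q_eq: "q z = \<i> * complex_of_real \<beta> + complex_of_real \<alpha> * log_quot g z" for z
    by (simp add: q_def)
  define m M where "m = (1 - k) / (1 + k)" and "M = (1 + k) / (1 - k)"
  have mM: "m > 0" "M \<ge> 0" using assms(2,3) by (auto simp: m_def M_def)
  have hU: "h z \<in> U k" and qU: "q z \<in> U k" if "z \<in> ball 0 1" for z
    using assms(6,7)[OF that] by (auto simp: q_def)
  note bounds = U_bounds[OF assms(2,3), folded m_def M_def]
  have Re_h: "Re (h z) > 0" if "z \<in> ball 0 1" for z using bounds(1)[OF hU[OF that]] mM by linarith
  have Rec: "Re c > 0" using assms(1) by (simp add: c_def)
  obtain l0 K0 where lK: "l0 holomorphic_on ball 0 1" "l0 0 = 0" "K0 holomorphic_on ball 0 1" "K0 0 = 1 / c"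
    "\<And>z. z \<in> ball 0 1 \<Longrightarrow> z * deriv l0 z = q z - c"
    "\<And>z. z \<in> ball 0 1 \<Longrightarrow> z * deriv K0 z + q z * K0 z = h z"
    "\<And>z. z \<in> ball 0 1 \<Longrightarrow> f z = z * exp ((l0 z + Ln c + Ln (K0 z)) / c)"
    "q holomorphic_on ball 0 1"
    by (rule bazilevic_data[OF assms(1,5) Re_h, folded c_def, folded q_eq]) (assumption, rule that)
  have lb: "norm (z * deriv l0 z) \<le> M + norm c" if z: "z \<in> ball 0 1" for z
    unfolding lK(5)[OF z] using norm_triangle_ineq4[of "q z" c] bounds(2)[OF qU[OF z]] by linarith
  \<comment> \<open>K must be bounded before the locale is available: the bound enters that of z K',
    and thereby the continuous extension of K.\<close>
  define B where "B = max (norm (1 / c)) (M / m)"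
  have Kb: "norm (K0 z) \<le> B" if z: "z \<in> ball 0 1" for z
  proof (rule radial_norm_bound[OF lK(3) _ _ _ lK(6) z])
    show "norm (K0 0) \<le> B" unfolding lK(4) B_def by simp
    fix z :: complex assume z: "z \<in> ball 0 1"
    show "Re (q z) > 0" using bounds(1)[OF qU[OF z]] mM by linarith
    have "M = M / m * m" using mM by simp
    also have "\<dots> \<le> B * Re (q z)"
      using bounds(1)[OF qU[OF z]] mM by (intro mult_mono) (auto simp: B_def le_max_iff_disj)
    finally show "norm (h z) \<le> B * Re (q z)" using bounds(2)[OF hU[OF z]] by linarith
  qed
  have Kb': "norm (z * deriv K0 z) \<le> M + M * B" if z: "z \<in> ball 0 1" for z
  proof -
    have "z * deriv K0 z = h z - q z * K0 z" using lK(6)[OF z] by (simp add: algebra_simps)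
    hence "norm (z * deriv K0 z) \<le> norm (h z) + norm (q z) * norm (K0 z)"
      using norm_triangle_ineq4[of "h z" "q z * K0 z"] by (simp add: norm_mult)
    also have "\<dots> \<le> M + M * B"
      using bounds(2)[OF hU[OF z]] bounds(2)[OF qU[OF z]] Kb[OF z] mM by (intro add_mono mult_mono) auto
    finally show ?thesis .
  qed
  obtain l where l: "continuous_on (cball 0 1) l" "\<And>z. z \<in> ball 0 1 \<Longrightarrow> l z = l0 z"
    "l holomorphic_on ball 0 1" "\<And>z. z \<in> ball 0 1 \<Longrightarrow> deriv l z = deriv l0 z"
    by (rule extend_to_closed_disc[OF lK(1) lb]) (assumption, rule that)
  obtain K where K: "continuous_on (cball 0 1) K" "\<And>z. z \<in> ball 0 1 \<Longrightarrow> K z = K0 z"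
    "K holomorphic_on ball 0 1" "\<And>z. z \<in> ball 0 1 \<Longrightarrow> deriv K z = deriv K0 z"
    by (rule extend_to_closed_disc[OF lK(3) Kb']) (assumption, rule that)
  \<comment> \<open>The locale asks for continuity on the closed disc, hence the extensions; in the
    open disc their values and derivatives are those of \<open>l0\<close> and
    \<open>K0\<close>.\<close>
  interpret chain_data c k l K h q
  proof
    show "h holomorphic_on ball 0 1" using assms(5) by (simp add: bazilevic_rep_def)
    show "l 0 = 0" "K 0 = 1 / c" using l(2)[of 0] K(2)[of 0] lK(2,4) by simp_all
    fix z :: complex assume z: "z \<in> ball 0 1"
    show "z * deriv l z = q z - c" using lK(5)[OF z] l(4)[OF z] by simp
    show "z * deriv K z + q z * K z = h z" using lK(6)[OF z] K(2,4)[OF z] by simp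
  qed (use Rec assms(2,3) l K lK(8) hU qU in auto)
  have "qc_ext 1 z = f z" if z: "z \<in> ball 0 1" for z
    using qc_ext_disc[of z] lK(7)[OF z] l(2)[OF z] K(2)[OF z] z by simp
  thus ?thesis using qc_ext_automorphism by blast
qed

end
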